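(* Let $k$ be a field, $\Pi$ a finite poset, $i_Z:Z\hookrightarrow\Pi$ the inclusion of a locally closed subset, and $(I^\bullet,\eta^\bullet)$ a bounded minimal injective complex on $Z$, starting in degree $0$ and represented by labeled matrices $\eta^{-1},\dots,\eta^n$. Then the proper pushforward algorithm described in the context outputs a complex of $\Pi$-labeled matrices representing $\mathcal{I}(i_Z)_!I^\bullet$.
   Context: A subset $Z$ of a poset $\Pi$ is locally closed if $a,c\in Z$ and $a\le b\le c$ imply $b\in Z$. $\mathrm{Cl}\,Z=\{\pi\in\Pi:\pi\le\sigma\text{ for some }\sigma\in Z\}$; $\mathrm{St}\,\pi=\{\tau:\pi\le\tau\}$. A sheaf on a finite poset is a functor to finite-dimensional $k$-vector spaces. $[\pi]$ is the sheaf with $[\pi](\sigma)=k$ for $\sigma\le\pi$ and $0$ otherwise (identity maps between copies of $k$); injective sheaves are exactly the sheaves isomorphic to finite direct sums of these. A complex of injective sheaves is minimal if in each degree its number of indecomposable summands is least among all bounded complexes of injective sheaves quasi-isomorphic to it; every bounded complex of sheaves is quasi-isomorphic to a minimal injective complex (its minimal injective resolution), unique up to isomorphism. For a sheaf $F$ on $Z$, $(i_Z)_!F$ is the sheaf on $\Pi$ equal to $F$ on $Z$ and $0$ outside $Z$; $\mathcal{I}(i_Z)_!I^\bullet$ is the minimal injective resolution of $(i_Z)_!I^\bullet$. A $\Pi$-labeled matrix is a matrix over $k$ with each row and column labeled by an element of $\Pi$ (repetitions allowed), such that the entry in a row labeled $\sigma$ and column labeled $\pi$ is nonzero only if $\sigma\le\pi$.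 $M(\pi)$ is the submatrix of rows and columns with labels in $\mathrm{St}\,\pi$. With column labels $\pi_1,\dots,\pi_m$ and row labels $\sigma_1,\dots,\sigma_n$ it represents the natural transformation $\bigoplus_i[\pi_i]\to\bigoplus_j[\sigma_j]$ whose component at $\tau$ is $M(\tau)$. A complex of labeled matrices has the columns of each matrix labeled as the rows of the preceding one and zero consecutive products. Matrices may have no rows or no columns; $\eta^{-1}$ has no columns and rows labeled by the summands of $I^0$; $\eta^d$ is empty (no rows) for $d>n$. MakeExact$(A,B,\pi)$ (for labeled matrices with $BA=0$, columns of $B$ labeled as rows of $A$): choose a basis of $(\mathrm{im}\,A(\pi))^\perp=\{v: v\cdot u=0\ \forall u\in\mathrm{im}\,A(\pi)\}$; for each basis vector $b$ in turn, if $b$ is linearly independent of the current rows of $B(\pi)$, append to $B$ a row labeled $\pi$ equal to $b$ in columns labeled by $\mathrm{St}\,\pi$ and $0$ elsewhere; return $B$. Proper pushforward algorithm ($J^d$ denotes the tuple of row labels of $\delta^{d-1}$; stars are taken in $\Pi$): let $\delta^{-1}$ have no columns and row labels those of $I^0$; set $d=0$. While $J^d\neq0$ or $d\le n$: let $\delta^d$ have columns labeled by $J^d$; add each row $r$ of $\eta^d$ to $\delta^d$ with the same label and with $0$ in columns not labeled by $Z$; for all $\pi\in\mathrm{Cl}\,Z\setminus Z$ in non-increasing order (larger elements first) replace $\delta^d$ by MakeExact$(\delta^{d-1},\delta^d,\pi)$; increase $d$ by $1$. Finally let $m=\max\{m:J^m\ne0\}$ and output $\delta^{-1},\dots,\delta^m$.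 *)

theory Defs
  imports
    "Jordan_Normal_Form.Matrix_Kernel"
    "Jordan_Normal_Form.DL_Submatrix"
begin

section \<open>Sheaves on finite posets\<close>

text \<open>A finite poset is a finite set \<open>X\<close> of elements of an ordered type, with the induced order.
  A finite-dimensional vector space is \<open>k\<^sup>n\<close> and a linear map is a matrix, so a sheaf consists of
  stalk dimensions and restriction matrices \<open>res F \<sigma> \<tau>\<close> from the stalk at \<open>\<sigma>\<close> to the stalk at
  \<open>\<tau>\<close> for \<open>\<sigma> \<le> \<tau>\<close>. Values outside \<open>X\<close> are irrelevant.\<close>

definition locally_closed :: "'p::order set \<Rightarrow> 'p set \<Rightarrow> bool" where
  "locally_closed X Z \<longleftrightarrow> Z \<subseteq> X \<and> (\<forall>a\<in>Z. \<forall>c\<in>Z. \<forall>b\<in>X. a \<le> b \<longrightarrow> b \<le> c \<longrightarrow> b \<in> Z)"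

definition closure_in :: "'p::order set \<Rightarrow> 'p set \<Rightarrow> 'p set" where
  "closure_in X Z = {\<pi> \<in> X. \<exists>\<sigma>\<in>Z. \<pi> \<le> \<sigma>}"

record ('p, 'k) sheaf =
  sdim :: "'p \<Rightarrow> nat"
  res :: "'p \<Rightarrow> 'p \<Rightarrow> 'k mat"

definition sheaf_on :: "'p::order set \<Rightarrow> ('p, 'k::field) sheaf \<Rightarrow> bool" where
  "sheaf_on X F \<longleftrightarrow>
     (\<forall>\<sigma>\<in>X. \<forall>\<tau>\<in>X. \<sigma> \<le> \<tau> \<longrightarrow> res F \<sigma> \<tau> \<in> carrier_mat (sdim F \<tau>) (sdim F \<sigma>)) \<and>
     (\<forall>\<sigma>\<in>X. res F \<sigma> \<sigma> = 1\<^sub>m (sdim F \<sigma>)) \<and>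
     (\<forall>\<sigma>\<in>X. \<forall>\<tau>\<in>X. \<forall>\<upsilon>\<in>X. \<sigma> \<le> \<tau> \<longrightarrow> \<tau> \<le> \<upsilon> \<longrightarrow> res F \<sigma> \<upsilon> = res F \<tau> \<upsilon> * res F \<sigma> \<tau>)"

definition sheaf_hom ::
  "'p::order set \<Rightarrow> ('p, 'k::field) sheaf \<Rightarrow> ('p, 'k) sheaf \<Rightarrow> ('p \<Rightarrow> 'k mat) \<Rightarrow> bool" where
  "sheaf_hom X F G \<phi> \<longleftrightarrow>
     (\<forall>\<sigma>\<in>X. \<phi> \<sigma> \<in> carrier_mat (sdim G \<sigma>) (sdim F \<sigma>)) \<and>
     (\<forall>\<sigma>\<in>X. \<forall>\<tau>\<in>X. \<sigma> \<le> \<tau> \<longrightarrow> \<phi> \<tau> * res F \<sigma> \<tau> = res G \<sigma> \<tau> * \<phi> \<sigma>)"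

definition sheaf_isomorphic ::
  "'p::order set \<Rightarrow> ('p, 'k::field) sheaf \<Rightarrow> ('p, 'k) sheaf \<Rightarrow> bool" where
  "sheaf_isomorphic X F G \<longleftrightarrow>
     (\<exists>\<phi> \<psi>. sheaf_hom X F G \<phi> \<and> sheaf_hom X G F \<psi> \<and>
       (\<forall>\<sigma>\<in>X. \<psi> \<sigma> * \<phi> \<sigma> = 1\<^sub>m (sdim F \<sigma>) \<and> \<phi> \<sigma> * \<psi> \<sigma> = 1\<^sub>m (sdim G \<sigma>)))"

definition elementary_sheaf :: "'p::order \<Rightarrow> ('p, 'k::field) sheaf" where
  "elementary_sheaf \<pi> =
     \<lparr> sdim = (\<lambda>\<sigma>. if \<sigma> \<le> \<pi> then 1 else 0),
       res = (\<lambda>\<sigma> \<tau>. if \<tau> \<le> \<pi> then 1\<^sub>m 1 else 0\<^sub>m 0 (if \<sigma> \<le> \<pi> then 1 else 0)) \<rparr>"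

definition sheaf_sum :: "('p, 'k::field) sheaf list \<Rightarrow> ('p, 'k) sheaf" where
  "sheaf_sum Fs =
     \<lparr> sdim = (\<lambda>\<tau>. \<Sum>F\<leftarrow>Fs. sdim F \<tau>),
       res = (\<lambda>\<sigma> \<tau>. diag_block_mat (map (\<lambda>F. res F \<sigma> \<tau>) Fs)) \<rparr>"

definition labeled_sum :: "'p::order list \<Rightarrow> ('p, 'k::field) sheaf" where
  "labeled_sum \<pi>s = sheaf_sum (map elementary_sheaf \<pi>s)"

definition injective_sheaf :: "'p::order set \<Rightarrow> ('p, 'k::field) sheaf \<Rightarrow> bool" where
  "injective_sheaf X F \<longleftrightarrow>
     sheaf_on X F \<and> (\<exists>\<pi>s. set \<pi>s \<subseteq> X \<and> sheaf_isomorphic X F (labeled_sum \<pi>s))"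

text \<open>The decomposition of an injective sheaf into sheaves \<open>[\<pi>]\<close> is unique up to order, so
  \<open>LEAST\<close> only selects the one possible value.\<close>

definition num_summands :: "'p::order set \<Rightarrow> ('p, 'k::field) sheaf \<Rightarrow> nat" where
  "num_summands X F =
     (LEAST n. \<exists>\<pi>s. set \<pi>s \<subseteq> X \<and> length \<pi>s = n \<and> sheaf_isomorphic X F (labeled_sum \<pi>s))"


section \<open>Complexes of sheaves\<close>

record ('p, 'k) sheaf_complex =
  obj :: "int \<Rightarrow> ('p, 'k) sheaf"
  diff :: "int \<Rightarrow> 'p \<Rightarrow> 'k mat"

definition bounded_complex :: "'p::order set \<Rightarrow> ('p, 'k::field) sheaf_complex \<Rightarrow> bool" where
  "bounded_complex X C \<longleftrightarrow>
     (\<forall>d. sheaf_on X (obj C d)) \<and>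
     (\<forall>d. sheaf_hom X (obj C d) (obj C (d + 1)) (diff C d)) \<and>
     (\<forall>d. \<forall>\<pi>\<in>X. diff C (d + 1) \<pi> * diff C d \<pi> = 0\<^sub>m (sdim (obj C (d + 2)) \<pi>) (sdim (obj C d) \<pi>)) \<and>
     (\<exists>a b. \<forall>d. d < a \<or> b < d \<longrightarrow> (\<forall>\<pi>\<in>X. sdim (obj C d) \<pi> = 0))"

definition chain_map ::
  "'p::order set \<Rightarrow> ('p, 'k::field) sheaf_complex \<Rightarrow> ('p, 'k) sheaf_complex \<Rightarrow>
    (int \<Rightarrow> 'p \<Rightarrow> 'k mat) \<Rightarrow> bool" where
  "chain_map X C D f \<longleftrightarrow>
     (\<forall>d. sheaf_hom X (obj C d) (obj D d) (f d)) \<and>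
     (\<forall>d. \<forall>\<pi>\<in>X. f (d + 1) \<pi> * diff C d \<pi> = diff D d \<pi> * f d \<pi>)"

definition complex_isomorphic ::
  "'p::order set \<Rightarrow> ('p, 'k::field) sheaf_complex \<Rightarrow> ('p, 'k) sheaf_complex \<Rightarrow> bool" where
  "complex_isomorphic X C D \<longleftrightarrow>
     (\<exists>f g. chain_map X C D f \<and> chain_map X D C g \<and>
       (\<forall>d. \<forall>\<pi>\<in>X. g d \<pi> * f d \<pi> = 1\<^sub>m (sdim (obj C d) \<pi>) \<and>
                    f d \<pi> * g d \<pi> = 1\<^sub>m (sdim (obj D d) \<pi>)))"

definition mat_image :: "'k::field mat \<Rightarrow> 'k vec set" where
  "mat_image A = {A *\<^sub>v u | u. u \<in> carrier_vec (dim_col A)}"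

text \<open>Kernels, images and quotients of sheaves are formed stalkwise, so a cohomology sheaf is given
  by its stalks; the elements of a stalk are cosets of \<open>mat_image (diff C (d - 1) \<pi>)\<close>.\<close>

definition coh_class :: "('p, 'k::field) sheaf_complex \<Rightarrow> int \<Rightarrow> 'p \<Rightarrow> 'k vec \<Rightarrow> 'k vec set" where
  "coh_class C d \<pi> v = {v + u | u. u \<in> mat_image (diff C (d - 1) \<pi>)}"

definition cohomology :: "('p, 'k::field) sheaf_complex \<Rightarrow> int \<Rightarrow> 'p \<Rightarrow> 'k vec set set" where
  "cohomology C d \<pi> = coh_class C d \<pi> ` mat_kernel (diff C d \<pi>)"

definition coh_map ::
  "('p, 'k::field) sheaf_complex \<Rightarrow> (int \<Rightarrow> 'p \<Rightarrow> 'k mat) \<Rightarrow> int \<Rightarrow> 'p \<Rightarrow> 'k vec set \<Rightarrow> 'k vec set" where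
  "coh_map D f d \<pi> c = (\<Union>v\<in>c. coh_class D d \<pi> (f d \<pi> *\<^sub>v v))"

definition quasi_iso ::
  "'p::order set \<Rightarrow> ('p, 'k::field) sheaf_complex \<Rightarrow> ('p, 'k) sheaf_complex \<Rightarrow>
    (int \<Rightarrow> 'p \<Rightarrow> 'k mat) \<Rightarrow> bool" where
  "quasi_iso X C D f \<longleftrightarrow> chain_map X C D f \<and>
     (\<forall>d. \<forall>\<pi>\<in>X. bij_betw (coh_map D f d \<pi>) (cohomology C d \<pi>) (cohomology D d \<pi>))"

text \<open>Quasi-isomorphic complexes are those connected by a zigzag of quasi-isomorphisms.\<close>

definition quasi_isomorphic ::
  "'p::order set \<Rightarrow> ('p, 'k::field) sheaf_complex \<Rightarrow> ('p, 'k) sheaf_complex \<Rightarrow> bool" where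
  "quasi_isomorphic X =
     equivclp (\<lambda>C D. bounded_complex X C \<and> bounded_complex X D \<and> (\<exists>f. quasi_iso X C D f))"

definition injective_complex :: "'p::order set \<Rightarrow> ('p, 'k::field) sheaf_complex \<Rightarrow> bool" where
  "injective_complex X C \<longleftrightarrow> bounded_complex X C \<and> (\<forall>d. injective_sheaf X (obj C d))"

definition minimal_injective_complex :: "'p::order set \<Rightarrow> ('p, 'k::field) sheaf_complex \<Rightarrow> bool" where
  "minimal_injective_complex X C \<longleftrightarrow> injective_complex X C \<and>
     (\<forall>D. injective_complex X D \<longrightarrow> quasi_isomorphic X C D \<longrightarrow>
       (\<forall>d. num_summands X (obj C d) \<le> num_summands X (obj D d)))"

definition minimal_injective_resolution ::
  "'p::order set \<Rightarrow> ('p, 'k::field) sheaf_complex \<Rightarrow> ('p, 'k) sheaf_complex \<Rightarrow> bool" where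
  "minimal_injective_resolution X C J \<longleftrightarrow>
     bounded_complex X C \<and> minimal_injective_complex X J \<and> quasi_isomorphic X C J"

definition extend_sheaf :: "'p set \<Rightarrow> ('p, 'k::field) sheaf \<Rightarrow> ('p, 'k) sheaf" where
  "extend_sheaf Z F =
     (let n = (\<lambda>\<sigma>. if \<sigma> \<in> Z then sdim F \<sigma> else 0) in
      \<lparr> sdim = n,
        res = (\<lambda>\<sigma> \<tau>. if \<sigma> \<in> Z \<and> \<tau> \<in> Z then res F \<sigma> \<tau> else 0\<^sub>m (n \<tau>) (n \<sigma>)) \<rparr>)"

definition extend_complex :: "'p set \<Rightarrow> ('p, 'k::field) sheaf_complex \<Rightarrow> ('p, 'k) sheaf_complex" where
  "extend_complex Z C =
     \<lparr> obj = (\<lambda>d. extend_sheaf Z (obj C d)),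
       diff = (\<lambda>d \<sigma>. if \<sigma> \<in> Z then diff C d \<sigma> else 0\<^sub>m 0 0) \<rparr>"


section \<open>Labeled matrices\<close>

record ('p, 'k) labeled_mat =
  row_labels :: "'p list"
  col_labels :: "'p list"
  entries :: "'k mat"

definition labeled_matrix :: "'p::order set \<Rightarrow> ('p, 'k::field) labeled_mat \<Rightarrow> bool" where
  "labeled_matrix X M \<longleftrightarrow>
     set (row_labels M) \<subseteq> X \<and> set (col_labels M) \<subseteq> X \<and>
     entries M \<in> carrier_mat (length (row_labels M)) (length (col_labels M)) \<and>
     (\<forall>i < length (row_labels M). \<forall>j < length (col_labels M).
        entries M $$ (i, j) \<noteq> 0 \<longrightarrow> row_labels M ! i \<le> col_labels M ! j)"

definition positions :: "'p set \<Rightarrow> 'p list \<Rightarrow> nat set" where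
  "positions S ls = {i. i < length ls \<and> ls ! i \<in> S}"

text \<open>The matrix \<open>M(\<pi>)\<close>. The star of \<open>\<pi>\<close> appears as \<open>{\<pi>..}\<close>: all labels lie in the poset, so it is
  the same to form it in the poset or in the whole type.\<close>

definition at_star :: "('p::order, 'k::field) labeled_mat \<Rightarrow> 'p \<Rightarrow> 'k mat" where
  "at_star M \<pi> =
     submatrix (entries M) (positions {\<pi>..} (row_labels M)) (positions {\<pi>..} (col_labels M))"

text \<open>In a list \<open>Ms\<close> of labeled matrices representing a complex, the matrix of index \<open>i\<close> is the
  differential from degree \<open>i - 1\<close> to degree \<open>i\<close>; the list therefore begins with degree \<open>-1\<close>, and
  the row labels at index \<open>d\<close> are the summands in degree \<open>d\<close>.\<close>

definition labeled_complex :: "'p::order set \<Rightarrow> ('p, 'k::field) labeled_mat list \<Rightarrow> bool" where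
  "labeled_complex X Ms \<longleftrightarrow>
     Ms \<noteq> [] \<and> col_labels (hd Ms) = [] \<and> (\<forall>M \<in> set Ms. labeled_matrix X M) \<and>
     (\<forall>i. Suc i < length Ms \<longrightarrow>
        col_labels (Ms ! Suc i) = row_labels (Ms ! i) \<and>
        entries (Ms ! Suc i) * entries (Ms ! i) =
          0\<^sub>m (length (row_labels (Ms ! Suc i))) (length (col_labels (Ms ! i))))"

definition complex_of :: "('p::order, 'k::field) labeled_mat list \<Rightarrow> ('p, 'k) sheaf_complex" where
  "complex_of Ms =
     (let I = (\<lambda>d. labeled_sum
                 (if 0 \<le> d \<and> d < int (length Ms) then row_labels (Ms ! nat d) else [])) in
      \<lparr> obj = I,
        diff = (\<lambda>d \<tau>. if 0 \<le> d \<and> d + 1 < int (length Ms) then at_star (Ms ! nat (d + 1)) \<tau>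
                       else 0\<^sub>m (sdim (I (d + 1) :: ('p, 'k) sheaf) \<tau>) (sdim (I d :: ('p, 'k) sheaf) \<tau>)) \<rparr>)"

definition represents ::
  "'p::order set \<Rightarrow> ('p, 'k::field) labeled_mat list \<Rightarrow> ('p, 'k) sheaf_complex \<Rightarrow> bool" where
  "represents X Ms C \<longleftrightarrow> labeled_complex X Ms \<and> complex_isomorphic X (complex_of Ms) C"


section \<open>The proper pushforward algorithm\<close>

text \<open>Both the bases chosen by MakeExact and the order in which \<open>Cl Z - Z\<close> is traversed are free, so
  the algorithm is a transition relation that admits every choice.\<close>

text \<open>The vector indexed by \<open>ls\<close> that lists the entries of \<open>v\<close> at the labels in \<open>S\<close> and is zero
  elsewhere.\<close>

definition spread :: "'p set \<Rightarrow> 'p list \<Rightarrow> 'k::field vec \<Rightarrow> 'k vec" where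
  "spread S ls v =
     vec (length ls) (\<lambda>j. if ls ! j \<in> S then v $ card {i \<in> positions S ls. i < j} else 0)"

definition append_row ::
  "('p, 'k::field) labeled_mat \<Rightarrow> 'p \<Rightarrow> 'k vec \<Rightarrow> ('p, 'k) labeled_mat" where
  "append_row B \<pi> v =
     B \<lparr> row_labels := row_labels B @ [\<pi>],
         entries := entries B @\<^sub>r mat_of_rows (length (col_labels B)) [v] \<rparr>"

definition try_row ::
  "'p::order \<Rightarrow> 'k::field vec \<Rightarrow> ('p, 'k) labeled_mat \<Rightarrow> ('p, 'k) labeled_mat" where
  "try_row \<pi> b B =
     (if b \<in> vec_space.row_space (dim_col (at_star B \<pi>)) (at_star B \<pi>) then B
      else append_row B \<pi> (spread {\<pi>..} (col_labels B) b))"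

definition basis_list :: "nat \<Rightarrow> 'k::field vec set \<Rightarrow> 'k vec list \<Rightarrow> bool" where
  "basis_list n W bs \<longleftrightarrow> distinct bs \<and>
     vectorspace.basis class_ring ((module_vec TYPE('k) n)\<lparr>carrier := W\<rparr>) (set bs)"

definition make_exact ::
  "('p::order, 'k::field) labeled_mat \<Rightarrow> 'p \<Rightarrow> ('p, 'k) labeled_mat \<Rightarrow> ('p, 'k) labeled_mat \<Rightarrow> bool"
where
  "make_exact A \<pi> B B' \<longleftrightarrow>
     (let n = dim_row (at_star A \<pi>) in
      \<exists>bs. basis_list n (vec_module.orthogonal_complement n (mat_image (at_star A \<pi>))) bs \<and>
           B' = fold (try_row \<pi>) bs B)"

primrec make_exact_along ::
  "('p::order, 'k::field) labeled_mat \<Rightarrow> 'p list \<Rightarrow> ('p, 'k) labeled_mat \<Rightarrow> ('p, 'k) labeled_mat \<Rightarrow> bool"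
where
  "make_exact_along A [] B B' \<longleftrightarrow> B' = B"
| "make_exact_along A (\<pi> # \<pi>s) B B' \<longleftrightarrow>
     (\<exists>B1. make_exact A \<pi> B B1 \<and> make_exact_along A \<pi>s B1 B')"

definition non_increasing_enum :: "'p::order set \<Rightarrow> 'p list \<Rightarrow> bool" where
  "non_increasing_enum S \<pi>s \<longleftrightarrow>
     distinct \<pi>s \<and> set \<pi>s = S \<and> sorted_wrt (\<lambda>\<sigma> \<tau>. \<not> \<sigma> < \<tau>) \<pi>s"

text \<open>\<open>\<eta>s ! i\<close> is $\eta^{i-1}$, and matrices past the end of the list have no rows.\<close>

definition input_rows :: "('p, 'k::field) labeled_mat list \<Rightarrow> nat \<Rightarrow> 'p list \<times> 'k vec list" where
  "input_rows \<eta>s i =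
     (if i < length \<eta>s then (row_labels (\<eta>s ! i), rows (entries (\<eta>s ! i))) else ([], []))"

definition start_matrix ::
  "'p set \<Rightarrow> ('p, 'k::field) labeled_mat list \<Rightarrow> nat \<Rightarrow> 'p list \<Rightarrow> ('p, 'k) labeled_mat" where
  "start_matrix Z \<eta>s i cs =
     \<lparr> row_labels = fst (input_rows \<eta>s i),
       col_labels = cs,
       entries = mat_of_rows (length cs) (map (spread Z cs) (snd (input_rows \<eta>s i))) \<rparr>"

text \<open>A state is the list $\delta^{-1}, \dots, \delta^{d-1}$, whose length is \<open>d + 1\<close>, and \<open>\<eta>s\<close> has
  length \<open>n + 2\<close>; hence \<open>d \<le> n\<close> reads \<open>length \<delta>s < length \<eta>s\<close>.\<close>

definition push_init :: "('p, 'k::field) labeled_mat list \<Rightarrow> ('p, 'k) labeled_mat list" where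
  "push_init \<eta>s =
     (let ls = row_labels (hd \<eta>s) in
      [\<lparr> row_labels = ls, col_labels = [], entries = 0\<^sub>m (length ls) 0 \<rparr>])"

definition push_continue ::
  "('p, 'k::field) labeled_mat list \<Rightarrow> ('p, 'k) labeled_mat list \<Rightarrow> bool" where
  "push_continue \<eta>s \<delta>s \<longleftrightarrow> row_labels (last \<delta>s) \<noteq> [] \<or> length \<delta>s < length \<eta>s"

definition push_step ::
  "'p::order set \<Rightarrow> 'p set \<Rightarrow> ('p, 'k::field) labeled_mat list \<Rightarrow>
    ('p, 'k) labeled_mat list \<Rightarrow> ('p, 'k) labeled_mat list \<Rightarrow> bool" where
  "push_step X Z \<eta>s \<delta>s \<delta>s' \<longleftrightarrow>
     push_continue \<eta>s \<delta>s \<and>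
     (\<exists>\<pi>s B. non_increasing_enum (closure_in X Z - Z) \<pi>s \<and>
        make_exact_along (last \<delta>s) \<pi>s
          (start_matrix Z \<eta>s (length \<delta>s) (row_labels (last \<delta>s))) B \<and>
        \<delta>s' = \<delta>s @ [B])"

text \<open>If every \<open>J\<^sup>d\<close> is zero then \<open>m\<close> does not exist and the output is $\delta^{-1}$ alone.\<close>

definition push_result :: "('p, 'k::field) labeled_mat list \<Rightarrow> ('p, 'k) labeled_mat list" where
  "push_result \<delta>s =
     (let S = {m. m < length \<delta>s \<and> row_labels (\<delta>s ! m) \<noteq> []} in
      if S = {} then take 1 \<delta>s else take (Max S + 2) \<delta>s)"

definition push_output ::
  "'p::order set \<Rightarrow> 'p set \<Rightarrow> ('p, 'k::field) labeled_mat list \<Rightarrow> ('p, 'k) labeled_mat list \<Rightarrow> bool"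
where
  "push_output X Z \<eta>s out \<longleftrightarrow>
     (\<exists>\<delta>s. (push_step X Z \<eta>s)\<^sup>*\<^sup>* (push_init \<eta>s) \<delta>s \<and> \<not> push_continue \<eta>s \<delta>s \<and>
       out = push_result \<delta>s)"

text \<open>Whatever the choices, no run gets stuck inside the loop and none is infinite.\<close>

definition push_terminates ::
  "'p::order set \<Rightarrow> 'p set \<Rightarrow> ('p, 'k::field) labeled_mat list \<Rightarrow> bool" where
  "push_terminates X Z \<eta>s \<longleftrightarrow>
     (\<forall>\<delta>s. (push_step X Z \<eta>s)\<^sup>*\<^sup>* (push_init \<eta>s) \<delta>s \<longrightarrow> push_continue \<eta>s \<delta>s \<longrightarrow>
        (\<exists>\<delta>s'. push_step X Z \<eta>s \<delta>s \<delta>s')) \<and>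
     \<not> (\<exists>run. run 0 = push_init \<eta>s \<and> (\<forall>t::nat. push_step X Z \<eta>s (run t) (run (Suc t))))"

end

theory Submission
  imports Defs
begin

text \<open>A homomorphism between sums of sheaves \<open>[\<pi>]\<close> is a labeled matrix, and for convex \<open>S\<close> passing
  to the rows and columns with labels in \<open>S\<close> is functorial. MakeExact adds rows labeled \<open>\<pi>\<close> that
  span the annihilator of the image, so the output is exact at every \<open>\<pi>\<close> in the closure of \<open>Z\<close> outside
  \<open>Z\<close>; on stalks over \<open>Z\<close> it is the input, so the inclusion of the extended complex is a
  quasi-isomorphism. A new row is independent of the earlier ones at \<open>\<pi>\<close>, so the relations given by the next
  matrix cannot involve it: no entry has row and column label both equal to \<open>\<pi>\<close> outside \<open>Z\<close>. This
  vanishing makes labels increase strictly from each degree to the preceding one beyond the input, hence the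
  algorithm stops. It also gives minimality. Lifting along quasi-isomorphisms turns a zigzag
  to another injective complex \<open>D\<close> into a homotopy equivalence. On summands \<open>[\<pi>]\<close> with \<open>\<pi>\<close> outside
  \<open>Z\<close> the homotopy on the output is zero, so \<open>D\<close> has at least as many of them, and the summands
  of \<open>D\<close> with labels in \<open>Z\<close> form an injective complex quasi-isomorphic to the given minimal one.\<close>

section \<open>Linear algebra\<close>

text \<open>Two obstacles shape the proof. Maps found stalk by stalk need not commute with
  restriction, and minimality is a comparison with a whole class of complexes connected only by
  zigzags. Sums of sheaves \<open>[\<pi>]\<close> remove both. A map into \<open>[b]\<close> may be
  prescribed freely at the stalk at \<open>b\<close> and is determined by its value there, so
  solutions found at each point separately can be corrected to a morphism. Equations that hold at
  every stalk hold for the global matrices, and from these one can cut blocks that are not stalks,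
  such as the rows and columns with label exactly \<open>\<pi>\<close>. Exactness is kept in dual
  form because MakeExact produces functionals; a double annihilator argument turns it back into
  exactness. The minimality of the input is available only as an inequality between numbers of
  summands, with no information on single labels or entries. Hence labels in \<open>Z\<close> are
  counted together, through a complex on \<open>Z\<close>, while labels outside \<open>Z\<close> are
  counted one by one.\<close>

lemma functional_in_span:
  fixes f :: "nat \<Rightarrow> 'v \<Rightarrow> 'k::field" and comb :: "'v \<Rightarrow> 'k \<Rightarrow> 'v \<Rightarrow> 'v"
  assumes closed: "\<And>c v w. v \<in> W \<Longrightarrow> w \<in> W \<Longrightarrow> comb v c w \<in> W"
    and f: "\<And>i c v w. i < m \<Longrightarrow> v \<in> W \<Longrightarrow> w \<in> W \<Longrightarrow> f i (comb v c w) = f i v - c * f i w"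
    and r: "\<And>c v w. v \<in> W \<Longrightarrow> w \<in> W \<Longrightarrow> r (comb v c w) = r v - c * r w"
    and ker: "\<And>v. v \<in> W \<Longrightarrow> (\<And>i. i < m \<Longrightarrow> f i v = 0) \<Longrightarrow> r v = 0"
  shows "\<exists>c. \<forall>v\<in>W. r v = (\<Sum>i<m. c i * f i v)"
  using assms
proof (induction m arbitrary: W)
  case 0
  then show ?case by auto
next
  case (Suc m)
  \<comment> \<open>On the kernel of the last functional the other ones suffice by induction. A
    vector \<open>w\<close> outside this kernel fixes the last coefficient, since every
    \<open>v\<close> enters the kernel after a multiple of \<open>w\<close> is subtracted.\<close>
  let ?W = "{v \<in> W. f m v = 0}"
  have "\<exists>c. \<forall>v\<in>?W. r v = (\<Sum>i<m. c i * f i v)"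
  proof (rule Suc.IH)
    fix v assume "v \<in> ?W" "\<And>i. i < m \<Longrightarrow> f i v = 0"
    then show "r v = 0" using Suc.prems(4)[of v] by (auto simp: less_Suc_eq)
  qed (use Suc.prems in \<open>auto simp: less_Suc_eq\<close>)
  then obtain c where c: "\<And>v. v \<in> W \<Longrightarrow> f m v = 0 \<Longrightarrow> r v = (\<Sum>i<m. c i * f i v)" by auto
  show ?case
  proof (cases "\<exists>w\<in>W. f m w \<noteq> 0")
    case False
    then have "\<forall>v\<in>W. r v = (\<Sum>i<Suc m. c i * f i v)" using c by auto
    then show ?thesis by blast
  next
    case True
    then obtain w where w: "w \<in> W" "f m w \<noteq> 0" by auto
    let ?s = "r w - (\<Sum>i<m. c i * f i w)"
    define c' where "c' = c(m := ?s / f m w)"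
    have "r v = (\<Sum>i<Suc m. c' i * f i v)" if v: "v \<in> W" for v
    proof -
      let ?t = "f m v / f m w"
      have "f m (comb v ?t w) = 0" using Suc.prems(2)[of m v w ?t] v w by simp
      then have "r (comb v ?t w) = (\<Sum>i<m. c i * f i (comb v ?t w))"
        using c Suc.prems(1) v w by auto
      also have "\<dots> = (\<Sum>i<m. c i * f i v - ?t * (c i * f i w))"
        using Suc.prems(2)[of _ v w ?t] v w by (intro sum.cong) (simp_all add: right_diff_distrib)
      also have "\<dots> = (\<Sum>i<m. c i * f i v) - ?t * (\<Sum>i<m. c i * f i w)"
        by (simp add: sum_subtractf sum_distrib_left)
      finally have "r v = (\<Sum>i<m. c i * f i v) + ?t * ?s"
        using Suc.prems(3)[of v w ?t] v w by (simp add: algebra_simps)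
      then show ?thesis using w by (simp add: c'_def mult.commute)
    qed
    then show ?thesis by blast
  qed
qed

text \<open>The functionals are the rows of \<open>M\<close>. \<open>functional_in_span\<close>
  gives the coefficients, and evaluation at unit vectors turns an identity of functionals into one
  of vectors.\<close>

lemma row_space_of_kernel:
  fixes M :: "'k::field mat"
  assumes M: "M \<in> carrier_mat m n" and r: "r \<in> carrier_vec n"
    and ker: "\<And>v. v \<in> carrier_vec n \<Longrightarrow> M *\<^sub>v v = 0\<^sub>v m \<Longrightarrow> r \<bullet> v = 0"
  shows "\<exists>s\<in>carrier_vec m. r = transpose_mat M *\<^sub>v s"
proof -
  have row: "row M i \<in> carrier_vec n" if "i < m" for i using M that by auto
  have lin: "x \<bullet> (v - c \<cdot>\<^sub>v w) = x \<bullet> v - c * (x \<bullet> w)"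
    if "x \<in> carrier_vec n" "v \<in> carrier_vec n" "w \<in> carrier_vec n" for x v w and c :: 'k
    using that by (simp add: scalar_prod_minus_distrib)
  have "\<exists>c. \<forall>v\<in>carrier_vec n. r \<bullet> v = (\<Sum>i<m. c i * (row M i \<bullet> v))"
  proof (rule functional_in_span[where comb = "\<lambda>v c w. v - c \<cdot>\<^sub>v w"])
    fix v assume "v \<in> carrier_vec n" "\<And>i. i < m \<Longrightarrow> row M i \<bullet> v = 0"
    then show "r \<bullet> v = 0" using M by (intro ker) (auto intro!: eq_vecI)
  qed (use lin r row in auto)
  then obtain c where c: "\<And>v. v \<in> carrier_vec n \<Longrightarrow> r \<bullet> v = (\<Sum>i<m. c i * (row M i \<bullet> v))" by auto
  have "r = transpose_mat M *\<^sub>v vec m c"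
  proof (rule eq_vecI)
    fix j assume "j < dim_vec (transpose_mat M *\<^sub>v vec m c)"
    then have j: "j < n" using M by auto
    have "r $ j = r \<bullet> unit_vec n j" using j r by simp
    also have "\<dots> = (\<Sum>i<m. c i * M $$ (i, j))"
      using c[of "unit_vec n j"] j M row by (auto intro!: sum.cong)
    also have "\<dots> = (transpose_mat M *\<^sub>v vec m c) $ j"
      using M j by (auto simp: scalar_prod_def lessThan_atLeast0 intro!: sum.cong)
    finally show "r $ j = (transpose_mat M *\<^sub>v vec m c) $ j" .
  qed (use M r in auto)
  then show ?thesis by (intro bexI[of _ "vec m c"]) auto
qed

text \<open>Row by row this is \<open>row_space_of_kernel\<close>. It expresses injectivity of
  vector spaces: a map that kills the kernel of \<open>M\<close> extends from the image of
  \<open>M\<close> to its target. The extensions of sheaf maps below are assembled from it.\<close>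

lemma factor_through:
  fixes M :: "'k::field mat"
  assumes M: "M \<in> carrier_mat m n" and R: "R \<in> carrier_mat l n"
    and ker: "\<And>v. v \<in> carrier_vec n \<Longrightarrow> M *\<^sub>v v = 0\<^sub>v m \<Longrightarrow> R *\<^sub>v v = 0\<^sub>v l"
  shows "\<exists>S\<in>carrier_mat l m. R = S * M"
proof -
  have "\<exists>s\<in>carrier_vec m. row R i = transpose_mat M *\<^sub>v s" if i: "i < l" for i
  proof (rule row_space_of_kernel[OF M])
    fix v assume v: "v \<in> carrier_vec n" "M *\<^sub>v v = 0\<^sub>v m"
    have "(R *\<^sub>v v) $ i = 0" using ker[OF v] i by simp
    then show "row R i \<bullet> v = 0" using R i by simp
  qed (use R i in auto)
  then obtain s where s: "\<And>i. i < l \<Longrightarrow> s i \<in> carrier_vec m \<and> row R i = transpose_mat M *\<^sub>v s i"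
    by metis
  let ?S = "mat l m (\<lambda>(i, j). s i $ j)"
  have "R = ?S * M"
  proof (rule eq_matI)
    fix i j assume "i < dim_row (?S * M)" "j < dim_col (?S * M)"
    then have ij: "i < l" "j < n" using M by auto
    have "R $$ (i, j) = row R i $ j" using R ij by auto
    also have "\<dots> = (?S * M) $$ (i, j)"
      using s[OF ij(1)] ij M by (auto simp: scalar_prod_def mult.commute intro!: sum.cong)
    finally show "R $$ (i, j) = (?S * M) $$ (i, j)" .
  qed (use M R in auto)
  then show ?thesis by (intro bexI[of _ ?S]) auto
qed

text \<open>\<open>row_space_of_kernel\<close> for the transpose: the image is its own double
  annihilator. This turns the dual form of exactness established by MakeExact back into
  exactness.\<close>

lemma image_of_orthogonal:
  fixes M :: "'k::field mat"
  assumes M: "M \<in> carrier_mat m n" and v: "v \<in> carrier_vec m"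
    and orth: "\<And>b. b \<in> carrier_vec m \<Longrightarrow> transpose_mat M *\<^sub>v b = 0\<^sub>v n \<Longrightarrow> b \<bullet> v = 0"
  shows "\<exists>u\<in>carrier_vec n. v = M *\<^sub>v u"
proof -
  have "\<exists>u\<in>carrier_vec n. v = transpose_mat (transpose_mat M) *\<^sub>v u"
    using M v orth by (intro row_space_of_kernel) (auto simp: comm_scalar_prod)
  then show ?thesis by simp
qed

lemma right_inverse_dim_le:
  fixes A :: "'k::field mat"
  assumes A: "A \<in> carrier_mat a b" and B: "B \<in> carrier_mat b a" and AB: "A * B = 1\<^sub>m a"
  shows "a \<le> b"
proof (rule ccontr)
  assume "\<not> a \<le> b"
  then have ba: "b < a" by simp
  \<comment> \<open>If \<open>b < a\<close>, padding with zeros makes both factors square and keeps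
    their product. A one-sided inverse of a square matrix is two-sided, but row \<open>b\<close> of
    \<open>?B\<close> is zero.\<close>
  let ?A = "mat a a (\<lambda>(i, j). if j < b then A $$ (i, j) else 0)"
  let ?B = "mat a a (\<lambda>(i, j). if i < b then B $$ (i, j) else 0)"
  have "?A * ?B = A * B"
  proof (rule eq_matI)
    fix i j assume "i < dim_row (A * B)" "j < dim_col (A * B)"
    then have ij: "i < a" "j < a" using A B by auto
    have "(?A * ?B) $$ (i, j) = (\<Sum>l<a. if l < b then A $$ (i, l) * B $$ (l, j) else 0)"
      using ij by (auto simp: scalar_prod_def lessThan_atLeast0 intro!: sum.cong)
    also have "\<dots> = (\<Sum>l<b. A $$ (i, l) * B $$ (l, j))"
      using ba by (intro sum.mono_neutral_cong_right) auto
    also have "\<dots> = (A * B) $$ (i, j)"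
      using ij A B by (auto simp: scalar_prod_def lessThan_atLeast0 intro!: sum.cong)
    finally show "(?A * ?B) $$ (i, j) = (A * B) $$ (i, j)" .
  qed (use A B in auto)
  with AB have 1: "?A * ?B = 1\<^sub>m a" by simp
  have "?B * ?A = 1\<^sub>m a"
    by (rule mat_mult_left_right_inverse[OF _ _ 1]) auto
  moreover have "(?B * ?A) $$ (b, b) = 0" using ba by (auto simp: scalar_prod_def)
  ultimately show False using ba by simp
qed

section \<open>Blocks of labeled matrices\<close>

text \<open>\<open>locally_closed\<close> without the condition \<open>S \<subseteq> X\<close>. The
  stars \<open>{\<pi>..}\<close>, formed in the whole type, and the singletons
  \<open>{\<pi>}\<close> then count as convex, so that they share one product rule for blocks with
  \<open>Z\<close>.\<close>

definition convex_in :: "'p::order set \<Rightarrow> 'p set \<Rightarrow> bool" where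
  "convex_in X S \<longleftrightarrow> (\<forall>a\<in>S. \<forall>c\<in>S. \<forall>b\<in>X. a \<le> b \<longrightarrow> b \<le> c \<longrightarrow> b \<in> S)"

text \<open>For convex \<open>S\<close> this is functorial on labeled matrices; \<open>M(\<pi>)\<close> is the block of the star of \<open>\<pi>\<close>.\<close>

definition block :: "'p set \<Rightarrow> 'p list \<Rightarrow> 'p list \<Rightarrow> 'k mat \<Rightarrow> 'k mat" where
  "block S as bs M = submatrix M (positions S as) (positions S bs)"

text \<open>\<open>labeled_matrix\<close> for bare label lists. Row labels come first, so a map from
  the sum over \<open>bs\<close> to the sum over \<open>as\<close> is an
  \<open>lmat as bs\<close>.\<close>

definition lmat :: "'p::order list \<Rightarrow> 'p list \<Rightarrow> 'k::field mat \<Rightarrow> bool" where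
  "lmat as bs M \<longleftrightarrow> M \<in> carrier_mat (length as) (length bs) \<and>
     (\<forall>i < length as. \<forall>j < length bs. M $$ (i, j) \<noteq> 0 \<longrightarrow> as ! i \<le> bs ! j)"

lemma convex_in_simps[simp]: "convex_in X {\<pi>..}" "convex_in X {\<pi>}"
  by (auto simp: convex_in_def)

lemma locally_closed_convex_in: "locally_closed X Z \<Longrightarrow> convex_in X Z"
  unfolding locally_closed_def convex_in_def by blast

lemma finite_positions[simp]: "finite (positions S ls)"
  by (auto simp: positions_def)

lemma positions_eq[simp]: "{i. i < length ls \<and> i \<in> positions S ls} = positions S ls"
  by (auto simp: positions_def)

lemma positions_Nil[simp]: "positions S [] = {}"
  by (auto simp: positions_def)

lemma pick_eqI: "i \<in> P \<Longrightarrow> card {a\<in>P. a < i} = k \<Longrightarrow> pick P k = i"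
  using pick_card_in_set by blast

lemma bij_betw_pick: assumes "finite P" shows "bij_betw (pick P) {..<card P} P"
  unfolding bij_betw_def
proof
  show "inj_on (pick P) {..<card P}"
    by (intro inj_onI) (metis card_pick_le lessThan_iff)
  show "pick P ` {..<card P} = P"
  proof (intro equalityI subsetI)
    fix i assume "i \<in> P"
    then have "card {a\<in>P. a < i} < card P" using assms by (intro psubset_card_mono) auto
    then show "i \<in> pick P ` {..<card P}" using pick_card_in_set[OF \<open>i \<in> P\<close>] by force
  qed (auto intro: pick_in_set_le)
qed

lemma pick_positions:
  assumes "k < card (positions S ls)"
  shows "pick (positions S ls) k < length ls" "ls ! pick (positions S ls) k \<in> S"
  using pick_in_set_le[OF assms] by (auto simp: positions_def)

lemma pick_eq_iff: "k < card P \<Longrightarrow> l < card P \<Longrightarrow> pick P k = pick P l \<longleftrightarrow> k = l"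
  by (metis card_pick_le)

lemma obtain_pick:
  assumes "i < length ls" "ls ! i \<in> S"
  obtains k where "k < card (positions S ls)" "pick (positions S ls) k = i"
proof -
  have "i \<in> pick (positions S ls) ` {..<card (positions S ls)}"
    using bij_betw_pick[OF finite_positions, of S ls] assms by (auto simp: bij_betw_def positions_def)
  then show ?thesis using that by auto
qed

lemma dim_block[simp]:
  assumes "M \<in> carrier_mat (length as) (length bs)"
  shows "block S as bs M \<in> carrier_mat (card (positions S as)) (card (positions S bs))"
    "dim_row (block S as bs M) = card (positions S as)"
    "dim_col (block S as bs M) = card (positions S bs)"
  using assms by (auto simp: block_def dim_submatrix intro!: carrier_matI)

lemma block_index:
  assumes "M \<in> carrier_mat (length as) (length bs)"
    "i < card (positions S as)" "j < card (positions S bs)"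
  shows "block S as bs M $$ (i, j) = M $$ (pick (positions S as) i, pick (positions S bs) j)"
  using assms by (auto simp: block_def submatrix_index)

lemma block_eqI:
  assumes "M \<in> carrier_mat (length as) (length bs)"
    and "B \<in> carrier_mat (card (positions S as)) (card (positions S bs))"
    and "\<And>i j. i < card (positions S as) \<Longrightarrow> j < card (positions S bs) \<Longrightarrow>
      B $$ (i, j) = M $$ (pick (positions S as) i, pick (positions S bs) j)"
  shows "block S as bs M = B"
  using assms by (intro eq_matI) (auto simp: block_index)

lemma sum_positions:
  "(\<Sum>i\<in>positions S ls. f i) = (\<Sum>k<card (positions S ls). f (pick (positions S ls) k))"
  using sum.reindex_bij_betw[OF bij_betw_pick[OF finite_positions]] by metis

lemma block_mult:
  fixes M N :: "'k::field mat"
  assumes M: "M \<in> carrier_mat (length as) (length cs)" and N: "N \<in> carrier_mat (length cs) (length bs)"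
    and z: "\<And>i l j. i < length as \<Longrightarrow> as ! i \<in> S \<Longrightarrow> l < length cs \<Longrightarrow> cs ! l \<notin> S \<Longrightarrow>
       j < length bs \<Longrightarrow> bs ! j \<in> S \<Longrightarrow> M $$ (i, l) * N $$ (l, j) = 0"
  shows "block S as bs (M * N) = block S as cs M * block S cs bs N"
proof (rule block_eqI)
  fix i j assume i: "i < card (positions S as)" and j: "j < card (positions S bs)"
  let ?i = "pick (positions S as) i" and ?j = "pick (positions S bs) j"
  have ij: "?i < length as" "as ! ?i \<in> S" "?j < length bs" "bs ! ?j \<in> S"
    using pick_positions i j by auto
  have "(M * N) $$ (?i, ?j) = (\<Sum>l<length cs. M $$ (?i, l) * N $$ (l, ?j))"
    using M N ij by (auto simp: scalar_prod_def lessThan_atLeast0 intro!: sum.cong)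
  also have "\<dots> = (\<Sum>l\<in>positions S cs. M $$ (?i, l) * N $$ (l, ?j))"
    using z ij by (intro sum.mono_neutral_cong_right) (auto simp: positions_def)
  also have "\<dots> = (\<Sum>k<card (positions S cs). block S as cs M $$ (i, k) * block S cs bs N $$ (k, j))"
    unfolding sum_positions using M N i j by (intro sum.cong) (auto simp: block_index)
  also have "\<dots> = (block S as cs M * block S cs bs N) $$ (i, j)"
    using M N i j by (auto simp: scalar_prod_def lessThan_atLeast0 intro!: sum.cong)
  finally show "(block S as cs M * block S cs bs N) $$ (i, j) = (M * N) $$ (?i, ?j)" by simp
qed (use M N in auto)

lemma lmatD:
  assumes "lmat as bs M"
  shows "M \<in> carrier_mat (length as) (length bs)"
    and "i < length as \<Longrightarrow> j < length bs \<Longrightarrow> M $$ (i, j) \<noteq> 0 \<Longrightarrow> as ! i \<le> bs ! j"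
  using assms by (auto simp: lmat_def)

text \<open>A nonzero term of the product has labels
  \<open>as ! i \<le> cs ! l \<le> bs ! j\<close>. If the outer two lie in \<open>S\<close>,
  convexity puts the middle one there too, so no term is lost when the summation index is cut down
  to \<open>S\<close>.\<close>

lemma block_mult_lmat:
  assumes M: "lmat as cs M" and N: "lmat cs bs N" and S: "convex_in X S" "set cs \<subseteq> X"
  shows "block S as bs (M * N) = block S as cs M * block S cs bs N"
proof (rule block_mult[OF lmatD(1)[OF M] lmatD(1)[OF N]])
  fix i l j assume "i < length as" "as ! i \<in> S" "l < length cs" "cs ! l \<notin> S" "j < length bs" "bs ! j \<in> S"
  then show "M $$ (i, l) * N $$ (l, j) = 0"
    using lmatD(2)[OF M, of i l] lmatD(2)[OF N, of l j] S unfolding convex_in_def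
    by (metis mult_eq_0_iff nth_mem subsetD)
qed

lemma block_add:
  "M \<in> carrier_mat (length as) (length bs) \<Longrightarrow> N \<in> carrier_mat (length as) (length bs) \<Longrightarrow>
   block S as bs (M + N) = block S as bs M + block S as bs N"
  by (intro block_eqI) (auto simp: block_index pick_positions)

lemma block_zero[simp]:
  "block S as bs (0\<^sub>m (length as) (length bs)) = 0\<^sub>m (card (positions S as)) (card (positions S bs))"
  by (intro block_eqI) (auto simp: pick_positions)

lemma block_one[simp]: "block S ls ls (1\<^sub>m (length ls)) = 1\<^sub>m (card (positions S ls))"
  by (intro block_eqI) (auto simp: pick_positions pick_eq_iff)

lemma lmat_mult:
  assumes M: "lmat as cs M" and N: "lmat cs bs N"
  shows "lmat as bs (M * N)"
  unfolding lmat_def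
proof (intro conjI allI impI)
  fix i j assume ij: "i < length as" "j < length bs" and nz: "(M * N) $$ (i, j) \<noteq> 0"
  have "(M * N) $$ (i, j) = (\<Sum>l<length cs. M $$ (i, l) * N $$ (l, j))"
    using lmatD(1)[OF M] lmatD(1)[OF N] ij by (auto simp: scalar_prod_def lessThan_atLeast0 intro!: sum.cong)
  with nz obtain l where "l < length cs" "M $$ (i, l) * N $$ (l, j) \<noteq> 0"
    by (metis (no_types, lifting) lessThan_iff sum.neutral)
  then show "as ! i \<le> bs ! j" using lmatD(2)[OF M ij(1), of l] lmatD(2)[OF N _ ij(2), of l] by force
qed (use lmatD(1)[OF M] lmatD(1)[OF N] in auto)

lemma lmat_add: "lmat as bs M \<Longrightarrow> lmat as bs N \<Longrightarrow> lmat as bs (M + N)"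
  by (auto simp: lmat_def) (metis add.right_neutral)

lemma lmat_one: "lmat ls ls (1\<^sub>m (length ls))"
  by (auto simp: lmat_def split: if_splits)

lemma lmat_zero: "lmat as bs (0\<^sub>m (length as) (length bs))"
  by (auto simp: lmat_def)

lemma length_nths_positions: "length (nths ls (positions S ls)) = card (positions S ls)"
  by (simp add: length_nths)

lemma nths_positions_nth:
  "k < card (positions S ls) \<Longrightarrow> nths ls (positions S ls) ! k = ls ! pick (positions S ls) k"
  by (simp add: nth_nths)

lemma set_nths_positions: "set (nths ls (positions S ls)) = set ls \<inter> S"
  by (auto simp: set_nths positions_def in_set_conv_nth)

lemma lmat_block:
  assumes "lmat as bs M"
  shows "lmat (nths as (positions S as)) (nths bs (positions S bs)) (block S as bs M)"
  unfolding lmat_def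
proof (intro conjI allI impI)
  fix i j assume ij: "i < length (nths as (positions S as))" "j < length (nths bs (positions S bs))"
    and nz: "block S as bs M $$ (i, j) \<noteq> 0"
  then show "nths as (positions S as) ! i \<le> nths bs (positions S bs) ! j"
    using lmatD(1)[OF assms] lmatD(2)[OF assms pick_positions(1) pick_positions(1)]
    by (simp add: length_nths_positions nths_positions_nth block_index)
qed (use lmatD(1)[OF assms] in \<open>simp add: length_nths_positions\<close>)

lemma at_star_eq_block: "at_star M \<pi> = block {\<pi>..} (row_labels M) (col_labels M) (entries M)"
  by (simp add: at_star_def block_def)

section \<open>Injective sheaves and labeled matrices\<close>

lemma mult_mat_index:
  fixes A :: "'k::semiring_0 mat"
  assumes "A \<in> carrier_mat m n" "B \<in> carrier_mat n p" "i < m" "j < p"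
  shows "(A * B) $$ (i, j) = (\<Sum>l<n. A $$ (i, l) * B $$ (l, j))"
  using assms by (auto simp: scalar_prod_def lessThan_atLeast0 intro!: sum.cong)

text \<open>Inverse of \<open>pick (positions S ls)\<close>: it takes a position in the whole list
  to its position among the labels in \<open>S\<close>, that is, to a row or column number of a
  block.\<close>

definition idx :: "'p set \<Rightarrow> 'p list \<Rightarrow> nat \<Rightarrow> nat" where
  "idx S ls i = card {a \<in> positions S ls. a < i}"

lemma idx_less: "i < length ls \<Longrightarrow> ls ! i \<in> S \<Longrightarrow> idx S ls i < card (positions S ls)"
  unfolding idx_def by (intro psubset_card_mono) (auto simp: positions_def)

lemma pick_idx: "i < length ls \<Longrightarrow> ls ! i \<in> S \<Longrightarrow> pick (positions S ls) (idx S ls i) = i"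
  unfolding idx_def by (rule pick_card_in_set) (auto simp: positions_def)

lemma idx_pick: "k < card (positions S ls) \<Longrightarrow> idx S ls (pick (positions S ls) k) = k"
  unfolding idx_def by (rule card_pick_le)

section \<open>Stalks and restriction maps of a sum of sheaves \<open>[\<pi>]\<close>\<close>

lemma positions_Cons:
  "positions S (x # xs) = (if x \<in> S then insert 0 (Suc ` positions S xs) else Suc ` positions S xs)"
proof (rule Set.set_eqI)
  fix i show "i \<in> positions S (x # xs) \<longleftrightarrow>
    i \<in> (if x \<in> S then insert 0 (Suc ` positions S xs) else Suc ` positions S xs)"
    by (cases i) (auto simp: positions_def)
qed

lemma card_positions_Cons:
  "card (positions S (x # xs)) = (if x \<in> S then 1 else 0) + card (positions S xs)"
  by (simp add: positions_Cons card_image card_insert_if image_iff)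

text \<open>\<open>labeled_sum\<close> is built summand by summand through
  \<open>diag_block_mat\<close>, whereas blocks refer to positions in the whole list. This recursion
  reconciles the two.\<close>

lemma pick_positions_Cons:
  assumes k: "k < card (positions S (x # xs))"
  shows "pick (positions S (x # xs)) k =
    (if x \<in> S then (if k = 0 then 0 else Suc (pick (positions S xs) (k - 1)))
     else Suc (pick (positions S xs) k))"
proof -
  have *: "{a \<in> Suc ` P. a < Suc i} = Suc ` {a \<in> P. a < i}" for P i by auto
  show ?thesis
  proof (cases "x \<in> S")
    case True
    show ?thesis
    proof (cases k)
      case 0
      then show ?thesis using True by (simp add: positions_Cons)
    next
      case (Suc l)
      then have l: "l < card (positions S xs)" using k True by (simp add: card_positions_Cons)
      let ?i = "pick (positions S xs) l"
      have "{a \<in> positions S (x # xs). a < Suc ?i} = insert 0 (Suc ` {a \<in> positions S xs. a < ?i})"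
        using True by (auto simp: positions_Cons)
      then have "card {a \<in> positions S (x # xs). a < Suc ?i} = Suc l"
        using card_pick_le[OF l] by (simp add: card_insert_if card_image image_iff)
      then have "pick (positions S (x # xs)) k = Suc ?i"
        using Suc pick_in_set_le[OF l] True by (intro pick_eqI) (auto simp: positions_Cons)
      then show ?thesis using True Suc by simp
    qed
  next
    case False
    then have l: "k < card (positions S xs)" using k by (simp add: card_positions_Cons)
    have "pick (positions S (x # xs)) k = Suc (pick (positions S xs) k)"
      using pick_in_set_le[OF l] False card_pick_le[OF l]
      by (intro pick_eqI) (auto simp: positions_Cons * card_image)
    then show ?thesis using False by simp
  qed
qed

lemma sdim_labeled_sum[simp]:
  "sdim (labeled_sum ls :: ('p::order, 'k::field) sheaf) \<tau> = card (positions {\<tau>..} ls)"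
proof (induction ls)
  case (Cons x xs)
  then show ?case
    by (simp add: labeled_sum_def sheaf_sum_def elementary_sheaf_def card_positions_Cons)
qed (simp add: labeled_sum_def sheaf_sum_def)

lemma dim_res_labeled_sum:
  assumes "\<sigma> \<le> \<tau>"
  shows "res (labeled_sum ls :: ('p::order, 'k::field) sheaf) \<sigma> \<tau> \<in>
    carrier_mat (card (positions {\<tau>..} ls)) (card (positions {\<sigma>..} ls))"
proof (induction ls)
  case (Cons x xs)
  have "\<tau> \<le> x \<Longrightarrow> \<sigma> \<le> x" using assms by auto
  with Cons show ?case
    by (auto simp: labeled_sum_def sheaf_sum_def elementary_sheaf_def card_positions_Cons Let_def)
qed (simp add: labeled_sum_def sheaf_sum_def)

text \<open>Both stalks are indexed through positions in \<open>ls\<close>, and restriction matches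
  equal positions. Once this formula is available, the block-diagonal construction is not unfolded
  again.\<close>

lemma res_labeled_sum_index:
  assumes st: "\<sigma> \<le> \<tau>" and "k < card (positions {\<tau>..} ls)" "l < card (positions {\<sigma>..} ls)"
  shows "res (labeled_sum ls :: ('p::order, 'k::field) sheaf) \<sigma> \<tau> $$ (k, l) =
    (if pick (positions {\<tau>..} ls) k = pick (positions {\<sigma>..} ls) l then 1 else 0)"
  using assms(2,3)
proof (induction ls arbitrary: k l)
  case (Cons x xs)
  let ?R = "res (labeled_sum xs :: ('p, 'k) sheaf) \<sigma> \<tau>"
  let ?A = "res (elementary_sheaf x :: ('p, 'k) sheaf) \<sigma> \<tau>"
  have R: "?R \<in> carrier_mat (card (positions {\<tau>..} xs)) (card (positions {\<sigma>..} xs))"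
    using dim_res_labeled_sum[OF st] .
  have A: "?A = (if \<tau> \<le> x then 1\<^sub>m 1 else 0\<^sub>m 0 (if \<sigma> \<le> x then 1 else 0))"
    by (simp add: elementary_sheaf_def)
  have e: "res (labeled_sum (x # xs) :: ('p, 'k) sheaf) \<sigma> \<tau> =
    four_block_mat ?A (0\<^sub>m (dim_row ?A) (dim_col ?R)) (0\<^sub>m (dim_row ?R) (dim_col ?A)) ?R"
    by (simp add: labeled_sum_def sheaf_sum_def Let_def)
  have tx: "\<tau> \<le> x \<Longrightarrow> \<sigma> \<le> x" using st by auto
  show ?case
    using Cons.prems Cons.IH[of "if \<tau> \<le> x then k - 1 else k" "if \<sigma> \<le> x then l - 1 else l"] R tx
    unfolding e pick_positions_Cons[OF Cons.prems(1)] pick_positions_Cons[OF Cons.prems(2)]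
    by (auto simp: A card_positions_Cons split: if_splits)
qed simp

text \<open>The star of \<open>\<tau>\<close> lies in the star of \<open>\<sigma>\<close>, so each
  row at \<open>\<tau>\<close> occurs at \<open>\<sigma>\<close> already and the 0/1 matrix on the
  left selects it. In \<open>mult_labeled_sum_index\<close> it acts on the right, and columns whose
  summand is zero at \<open>\<tau>\<close> become zero.\<close>

lemma labeled_sum_mult_index:
  fixes A :: "'k::field mat"
  assumes st: "\<sigma> \<le> \<tau>" and A: "A \<in> carrier_mat (card (positions {\<sigma>..} ls)) n"
    and k: "k < card (positions {\<tau>..} ls)" and j: "j < n"
  shows "(res (labeled_sum ls) \<sigma> \<tau> * A) $$ (k, j) =
    A $$ (idx {\<sigma>..} ls (pick (positions {\<tau>..} ls) k), j)"
proof -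
  let ?i = "pick (positions {\<tau>..} ls) k"
  let ?m = "idx {\<sigma>..} ls ?i"
  have i: "?i < length ls" "ls ! ?i \<in> {\<sigma>..}" using pick_positions[OF k] st by auto
  have "(res (labeled_sum ls) \<sigma> \<tau> * A) $$ (k, j) =
     (\<Sum>l<card (positions {\<sigma>..} ls). res (labeled_sum ls) \<sigma> \<tau> $$ (k, l) * A $$ (l, j))"
    using dim_res_labeled_sum[OF st, of ls, where 'k='k] A k j
    by (auto simp: scalar_prod_def lessThan_atLeast0 intro!: sum.cong)
  also have "\<dots> = (\<Sum>l<card (positions {\<sigma>..} ls). if l = ?m then A $$ (l, j) else 0)"
    using pick_idx[OF i]
    by (intro sum.cong) (auto simp: res_labeled_sum_index[OF st k] idx_pick)
  also have "\<dots> = A $$ (?m, j)" using idx_less[OF i] by simp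
  finally show ?thesis .
qed

lemma mult_labeled_sum_index:
  fixes A :: "'k::field mat"
  assumes st: "\<sigma> \<le> \<tau>" and A: "A \<in> carrier_mat m (card (positions {\<tau>..} ls))"
    and l: "l < card (positions {\<sigma>..} ls)" and i: "i < m"
  shows "(A * res (labeled_sum ls) \<sigma> \<tau>) $$ (i, l) =
    (if \<tau> \<le> ls ! pick (positions {\<sigma>..} ls) l
     then A $$ (i, idx {\<tau>..} ls (pick (positions {\<sigma>..} ls) l)) else 0)"
proof -
  let ?j = "pick (positions {\<sigma>..} ls) l"
  let ?m = "idx {\<tau>..} ls ?j"
  have j: "?j < length ls" using pick_positions[OF l] by auto
  have "(A * res (labeled_sum ls) \<sigma> \<tau>) $$ (i, l) =
     (\<Sum>k<card (positions {\<tau>..} ls). A $$ (i, k) * res (labeled_sum ls) \<sigma> \<tau> $$ (k, l))"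
    using dim_res_labeled_sum[OF st, of ls, where 'k='k] A l i
    by (auto simp: scalar_prod_def lessThan_atLeast0 intro!: sum.cong)
  also have "\<dots> = (\<Sum>k<card (positions {\<tau>..} ls). if \<tau> \<le> ls ! ?j \<and> k = ?m then A $$ (i, k) else 0)"
  proof (intro sum.cong refl)
    fix k assume "k \<in> {..<card (positions {\<tau>..} ls)}"
    then have k: "k < card (positions {\<tau>..} ls)" by simp
    have "pick (positions {\<tau>..} ls) k = ?j \<longleftrightarrow> \<tau> \<le> ls ! ?j \<and> k = ?m"
      using pick_positions[OF k] idx_pick[OF k] pick_idx[OF j, of "{\<tau>..}"] by auto
    then show "A $$ (i, k) * res (labeled_sum ls) \<sigma> \<tau> $$ (k, l) =
        (if \<tau> \<le> ls ! ?j \<and> k = ?m then A $$ (i, k) else 0)"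
      by (simp add: res_labeled_sum_index[OF st k l])
  qed
  also have "\<dots> = (if \<tau> \<le> ls ! ?j then A $$ (i, ?m) else 0)"
    using idx_less[OF j, of "{\<tau>..}"] by auto
  finally show ?thesis .
qed

lemma sheaf_on_labeled_sum: "sheaf_on X (labeled_sum ls :: ('p::order, 'k::field) sheaf)"
  unfolding sheaf_on_def
proof (intro conjI ballI impI)
  fix \<sigma> \<tau> :: 'p assume st: "\<sigma> \<le> \<tau>"
  then show "res (labeled_sum ls :: ('p, 'k) sheaf) \<sigma> \<tau> \<in>
     carrier_mat (sdim (labeled_sum ls :: ('p, 'k) sheaf) \<tau>) (sdim (labeled_sum ls :: ('p, 'k) sheaf) \<sigma>)"
    using dim_res_labeled_sum by simp
  fix \<upsilon> :: 'p assume tu: "\<tau> \<le> \<upsilon>"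
  then have su: "\<sigma> \<le> \<upsilon>" using st by auto
  let ?r = "res (labeled_sum ls :: ('p, 'k) sheaf)"
  note d = dim_res_labeled_sum[where 'k='k and ls=ls]
  show "?r \<sigma> \<upsilon> = ?r \<tau> \<upsilon> * ?r \<sigma> \<tau>"
  proof (rule eq_matI)
    fix k l assume "k < dim_row (?r \<tau> \<upsilon> * ?r \<sigma> \<tau>)" "l < dim_col (?r \<tau> \<upsilon> * ?r \<sigma> \<tau>)"
    then have kl: "k < card (positions {\<upsilon>..} ls)" "l < card (positions {\<sigma>..} ls)"
      using d[OF st] d[OF tu] by auto
    have i: "pick (positions {\<upsilon>..} ls) k < length ls" "ls ! pick (positions {\<upsilon>..} ls) k \<in> {\<tau>..}"
      using pick_positions[OF kl(1)] tu by auto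
    show "?r \<sigma> \<upsilon> $$ (k, l) = (?r \<tau> \<upsilon> * ?r \<sigma> \<tau>) $$ (k, l)"
      unfolding labeled_sum_mult_index[OF tu d[OF st] kl] res_labeled_sum_index[OF su kl]
        res_labeled_sum_index[OF st idx_less[OF i] kl(2)] pick_idx[OF i] ..
  qed (use d[OF st] d[OF tu] d[OF su] in auto)
next
  fix \<sigma> :: 'p
  show "res (labeled_sum ls :: ('p, 'k) sheaf) \<sigma> \<sigma> = 1\<^sub>m (sdim (labeled_sum ls :: ('p, 'k) sheaf) \<sigma>)"
    using dim_res_labeled_sum[of \<sigma> \<sigma> ls, where 'k='k]
    by (intro eq_matI) (auto simp: res_labeled_sum_index pick_eq_iff)
qed

section \<open>Homomorphisms into sums and labeled matrices\<close>

lemma sheaf_hom_block: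
  fixes M :: "'k::field mat" and as bs :: "'p::order list"
  assumes M: "lmat bs as M"
  shows "sheaf_hom X (labeled_sum as) (labeled_sum bs) (\<lambda>\<tau>. block {\<tau>..} bs as M)"
  unfolding sheaf_hom_def
proof (intro conjI ballI impI)
  fix \<sigma>
  show "block {\<sigma>..} bs as M \<in> carrier_mat (sdim (labeled_sum bs :: ('p, 'k) sheaf) \<sigma>)
      (sdim (labeled_sum as :: ('p, 'k) sheaf) \<sigma>)"
    using lmatD(1)[OF M] by simp
  fix \<tau> assume st: "\<sigma> \<le> \<tau>"
  let ?r = "res (labeled_sum as :: ('p, 'k) sheaf) \<sigma> \<tau>" and ?r' = "res (labeled_sum bs :: ('p, 'k) sheaf) \<sigma> \<tau>"
  note d = dim_res_labeled_sum[OF st, where 'k='k] and B = dim_block[OF lmatD(1)[OF M]]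
  show "block {\<tau>..} bs as M * ?r = ?r' * block {\<sigma>..} bs as M"
  proof (rule eq_matI)
    fix k l assume "k < dim_row (?r' * block {\<sigma>..} bs as M)" "l < dim_col (?r' * block {\<sigma>..} bs as M)"
    then have kl: "k < card (positions {\<tau>..} bs)" "l < card (positions {\<sigma>..} as)"
      using d[of bs] d[of as] B by auto
    have i: "pick (positions {\<tau>..} bs) k < length bs" "bs ! pick (positions {\<tau>..} bs) k \<in> {\<sigma>..}"
      "\<tau> \<le> bs ! pick (positions {\<tau>..} bs) k"
      using pick_positions[OF kl(1)] st by auto
    note j = pick_positions[OF kl(2)]
    let ?m = "M $$ (pick (positions {\<tau>..} bs) k, pick (positions {\<sigma>..} as) l)"
    have "(?r' * block {\<sigma>..} bs as M) $$ (k, l) = ?m"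
      unfolding labeled_sum_mult_index[OF st B(1) kl]
      using lmatD(1)[OF M] by (simp add: block_index idx_less[OF i(1,2)] kl pick_idx[OF i(1,2)])
    moreover have "(block {\<tau>..} bs as M * ?r) $$ (k, l) = ?m"
    proof (cases "\<tau> \<le> as ! pick (positions {\<sigma>..} as) l")
      case True
      then have "as ! pick (positions {\<sigma>..} as) l \<in> {\<tau>..}" by simp
      then show ?thesis
        unfolding mult_labeled_sum_index[OF st B(1) kl(2,1)]
        using lmatD(1)[OF M] True by (simp add: block_index idx_less[OF j(1)] kl pick_idx[OF j(1)])
    next
      case False
      \<comment> \<open>The summand of this column is zero at \<open>\<tau>\<close>. The label
        condition of \<open>lmat\<close> makes the entry of \<open>M\<close> vanish as well;
        naturality depends on this condition here.\<close>
      then have "?m = 0" using lmatD(2)[OF M i(1) j(1)] i(3) order_trans by blast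
      then show ?thesis
        unfolding mult_labeled_sum_index[OF st B(1) kl(2,1)] using False by simp
    qed
    ultimately show "(block {\<tau>..} bs as M * ?r) $$ (k, l) = (?r' * block {\<sigma>..} bs as M) $$ (k, l)"
      by simp
  qed (use d[of bs] d[of as] B in auto)
qed

lemma sheaf_homD:
  assumes "sheaf_hom X F G \<phi>"
  shows "\<sigma> \<in> X \<Longrightarrow> \<phi> \<sigma> \<in> carrier_mat (sdim G \<sigma>) (sdim F \<sigma>)"
    and "\<sigma> \<in> X \<Longrightarrow> \<tau> \<in> X \<Longrightarrow> \<sigma> \<le> \<tau> \<Longrightarrow> \<phi> \<tau> * res F \<sigma> \<tau> = res G \<sigma> \<tau> * \<phi> \<sigma>"
  using assms unfolding sheaf_hom_def by blast+

lemma sheaf_onD: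
  assumes "sheaf_on X F"
  shows "\<sigma> \<in> X \<Longrightarrow> \<tau> \<in> X \<Longrightarrow> \<sigma> \<le> \<tau> \<Longrightarrow> res F \<sigma> \<tau> \<in> carrier_mat (sdim F \<tau>) (sdim F \<sigma>)"
    and "\<sigma> \<in> X \<Longrightarrow> res F \<sigma> \<sigma> = 1\<^sub>m (sdim F \<sigma>)"
    and "\<sigma> \<in> X \<Longrightarrow> \<tau> \<in> X \<Longrightarrow> \<upsilon> \<in> X \<Longrightarrow> \<sigma> \<le> \<tau> \<Longrightarrow> \<tau> \<le> \<upsilon> \<Longrightarrow> res F \<sigma> \<upsilon> = res F \<tau> \<upsilon> * res F \<sigma> \<tau>"
  using assms unfolding sheaf_on_def by blast+

text \<open>A homomorphism into \<open>[b]\<close> is a linear functional on the stalk at \<open>b\<close>.\<close>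

lemma hom_row:
  assumes h: "sheaf_hom X F (labeled_sum bs) (\<phi> :: 'p::order \<Rightarrow> 'k::field mat)"
    and t: "\<tau> \<in> X" and bs: "set bs \<subseteq> X"
    and k: "k < card (positions {\<tau>..} bs)" and l: "l < sdim F \<tau>"
  defines "j \<equiv> pick (positions {\<tau>..} bs) k"
  shows "\<phi> \<tau> $$ (k, l) = (\<phi> (bs ! j) * res F \<tau> (bs ! j)) $$ (idx {bs ! j..} bs j, l)"
proof -
  have j: "j < length bs" "\<tau> \<le> bs ! j" "bs ! j \<in> X"
    using pick_positions[OF k] bs unfolding j_def by (auto simp: subset_iff)
  have "(\<phi> (bs ! j) * res F \<tau> (bs ! j)) $$ (idx {bs ! j..} bs j, l) =
     (res (labeled_sum bs) \<tau> (bs ! j) * \<phi> \<tau>) $$ (idx {bs ! j..} bs j, l)"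
    using sheaf_homD(2)[OF h t j(3,2)] by simp
  also have "\<dots> = \<phi> \<tau> $$ (idx {\<tau>..} bs (pick (positions {bs ! j..} bs) (idx {bs ! j..} bs j)), l)"
    using sheaf_homD(1)[OF h t] j l by (intro labeled_sum_mult_index) (auto intro: idx_less)
  also have "\<dots> = \<phi> \<tau> $$ (idx {\<tau>..} bs j, l)" using j by (simp add: pick_idx)
  finally show ?thesis using k by (simp add: j_def idx_pick)
qed

text \<open>The converse of \<open>hom_row\<close>. Of \<open>s b\<close> only the rows that belong
  to summands labeled \<open>b\<close> are used; every other row is forced by restriction to the
  label of its summand.\<close>

definition cohom :: "('p::order, 'k::field) sheaf \<Rightarrow> 'p list \<Rightarrow> ('p \<Rightarrow> 'k mat) \<Rightarrow> 'p \<Rightarrow> 'k mat" where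
  "cohom F bs s \<tau> = mat (card (positions {\<tau>..} bs)) (sdim F \<tau>)
     (\<lambda>(k, l). let j = pick (positions {\<tau>..} bs) k in
        (s (bs ! j) * res F \<tau> (bs ! j)) $$ (idx {bs ! j..} bs j, l))"

text \<open>Functoriality of \<open>F\<close> suffices: restricting from \<open>\<sigma>\<close> to
  \<open>\<tau>\<close> and then to \<open>b\<close> is restricting from \<open>\<sigma>\<close> to
  \<open>b\<close>. The matrices \<open>s b\<close> at different points need not be related.\<close>

lemma sheaf_hom_cohom:
  assumes F: "sheaf_on X (F :: ('p::order, 'k::field) sheaf)" and bs: "set bs \<subseteq> X"
    and s: "\<And>b. b \<in> X \<Longrightarrow> s b \<in> carrier_mat (card (positions {b..} bs)) (sdim F b)"
  shows "sheaf_hom X F (labeled_sum bs) (cohom F bs s)"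
  unfolding sheaf_hom_def
proof (intro conjI ballI impI)
  fix \<sigma> \<tau> assume st: "\<sigma> \<in> X" "\<tau> \<in> X" "\<sigma> \<le> \<tau>"
  let ?r = "res (labeled_sum bs :: ('p, 'k) sheaf) \<sigma> \<tau>"
  have c: "cohom F bs s \<upsilon> \<in> carrier_mat (card (positions {\<upsilon>..} bs)) (sdim F \<upsilon>)" for \<upsilon>
    by (simp add: cohom_def)
  note R = sheaf_onD(1)[OF F] and d = dim_res_labeled_sum[OF st(3), where 'k='k]
  show "cohom F bs s \<tau> * res F \<sigma> \<tau> = ?r * cohom F bs s \<sigma>"
  proof (rule eq_matI)
    fix k l assume "k < dim_row (?r * cohom F bs s \<sigma>)" "l < dim_col (?r * cohom F bs s \<sigma>)"
    then have kl: "k < card (positions {\<tau>..} bs)" "l < sdim F \<sigma>" using d[of bs] c[of \<sigma>] by auto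
    define j where "j = pick (positions {\<tau>..} bs) k"
    let ?b = "bs ! j"
    have j: "j < length bs" "\<tau> \<le> ?b" "?b \<in> X" "\<sigma> \<le> ?b"
      using pick_positions[OF kl(1)] bs st unfolding j_def by (auto simp: subset_iff)
    let ?i = "idx {?b..} bs j"
    have i: "?i < card (positions {?b..} bs)" using j by (intro idx_less) auto
    have e: "cohom F bs s \<tau> $$ (k, l') = (s ?b * res F \<tau> ?b) $$ (?i, l')" if "l' < sdim F \<tau>" for l'
      using that kl by (simp add: cohom_def Let_def j_def)
    have "(cohom F bs s \<tau> * res F \<sigma> \<tau>) $$ (k, l) = (\<Sum>l'<sdim F \<tau>. cohom F bs s \<tau> $$ (k, l') * res F \<sigma> \<tau> $$ (l', l))"
      using c[of \<tau>] R[OF st] kl by (auto simp: scalar_prod_def lessThan_atLeast0 intro!: sum.cong)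
    also have "\<dots> = (\<Sum>l'<sdim F \<tau>. (s ?b * res F \<tau> ?b) $$ (?i, l') * res F \<sigma> \<tau> $$ (l', l))"
      using e by (intro sum.cong) auto
    also have "\<dots> = ((s ?b * res F \<tau> ?b) * res F \<sigma> \<tau>) $$ (?i, l)"
      using mult_mat_index[OF mult_carrier_mat[OF s[OF j(3)] R[OF st(2) j(3,2)]] R[OF st] i kl(2)]
      by simp
    also have "(s ?b * res F \<tau> ?b) * res F \<sigma> \<tau> = s ?b * (res F \<tau> ?b * res F \<sigma> \<tau>)"
      using s[OF j(3)] R[OF st] R[OF st(2) j(3,2)] by simp
    also have "\<dots> = s ?b * res F \<sigma> ?b"
      using sheaf_onD(3)[OF F st(1,2) j(3) st(3) j(2)] by simp
    also have "(s ?b * res F \<sigma> ?b) $$ (?i, l) = cohom F bs s \<sigma> $$ (idx {\<sigma>..} bs j, l)"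
      using kl j by (simp add: cohom_def Let_def pick_idx idx_less)
    also have "\<dots> = (?r * cohom F bs s \<sigma>) $$ (k, l)"
      unfolding labeled_sum_mult_index[OF st(3) c kl] j_def ..
    finally show "(cohom F bs s \<tau> * res F \<sigma> \<tau>) $$ (k, l) = (?r * cohom F bs s \<sigma>) $$ (k, l)" .
  qed (use d[of bs] R[OF st] in \<open>simp_all add: cohom_def\<close>)
qed (simp add: cohom_def)

text \<open>The restriction from \<open>b\<close> to itself is the identity, so at its own label a
  summand keeps the row chosen by \<open>s\<close>.\<close>

lemma cohom_label:
  assumes F: "sheaf_on X (F :: ('p::order, 'k::field) sheaf)" and b: "b \<in> X"
    and s: "s b \<in> carrier_mat (card (positions {b..} bs)) (sdim F b)"
    and j: "j < length bs" "bs ! j = b"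
  shows "row (cohom F bs s b) (idx {b..} bs j) = row (s b) (idx {b..} bs j)"
proof -
  have i: "idx {b..} bs j < card (positions {b..} bs)" using j by (intro idx_less) auto
  then show ?thesis
    using s j sheaf_onD(2)[OF F b] pick_idx[OF j(1), of "{b..}"]
    by (auto intro!: eq_vecI simp: cohom_def Let_def)
qed

text \<open>From \<open>[a]\<close> to \<open>[b]\<close> there is one map up to a scalar if
  \<open>b \<le> a\<close>, and only zero otherwise. The scalar is read at the stalk at
  \<open>b\<close>, the largest point where \<open>[b]\<close> lives, and \<open>hom_row\<close>
  carries it to the other stalks.\<close>

lemma hom_labeled_sum_lmat:
  fixes \<phi> :: "'p::order \<Rightarrow> 'k::field mat"
  assumes h: "sheaf_hom X (labeled_sum as) (labeled_sum bs) \<phi>" and bs: "set bs \<subseteq> X"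
  obtains M where "lmat bs as M" "\<And>\<tau>. \<tau> \<in> X \<Longrightarrow> \<phi> \<tau> = block {\<tau>..} bs as M"
proof
  let ?M = "mat (length bs) (length as) (\<lambda>(j, i). if bs ! j \<le> as ! i
     then \<phi> (bs ! j) $$ (idx {bs ! j..} bs j, idx {bs ! j..} as i) else 0)"
  show L: "lmat bs as ?M" by (auto simp: lmat_def split: if_splits)
  fix \<tau> assume t: "\<tau> \<in> X"
  have B: "block {\<tau>..} bs as ?M \<in> carrier_mat (card (positions {\<tau>..} bs)) (card (positions {\<tau>..} as))" by simp
  have P: "\<phi> \<tau> \<in> carrier_mat (card (positions {\<tau>..} bs)) (card (positions {\<tau>..} as))"
    using sheaf_homD(1)[OF h t] by simp
  show "\<phi> \<tau> = block {\<tau>..} bs as ?M"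
  proof (rule eq_matI)
    fix k l assume "k < dim_row (block {\<tau>..} bs as ?M)" "l < dim_col (block {\<tau>..} bs as ?M)"
    then have kl: "k < card (positions {\<tau>..} bs)" "l < card (positions {\<tau>..} as)" using B by auto
    define j where "j = pick (positions {\<tau>..} bs) k"
    define i where "i = pick (positions {\<tau>..} as) l"
    have j: "j < length bs" "\<tau> \<le> bs ! j" "bs ! j \<in> X"
      using pick_positions[OF kl(1)] bs unfolding j_def by (auto simp: subset_iff)
    have i: "i < length as" using pick_positions[OF kl(2)] unfolding i_def by auto
    have P': "\<phi> (bs ! j) \<in> carrier_mat (card (positions {bs ! j..} bs)) (card (positions {bs ! j..} as))"
      using sheaf_homD(1)[OF h j(3)] by simp
    have jj: "idx {bs ! j..} bs j < card (positions {bs ! j..} bs)" using j by (intro idx_less) auto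
    have "\<phi> \<tau> $$ (k, l) = (\<phi> (bs ! j) * res (labeled_sum as) \<tau> (bs ! j)) $$ (idx {bs ! j..} bs j, l)"
      using hom_row[OF h t bs kl(1)] kl(2) by (simp add: j_def)
    also have "\<dots> = ?M $$ (j, i)"
      unfolding mult_labeled_sum_index[OF j(2) P' kl(2) jj] using i j by (simp add: i_def)
    also have "\<dots> = block {\<tau>..} bs as ?M $$ (k, l)" using kl by (simp add: block_index i_def j_def)
    finally show "\<phi> \<tau> $$ (k, l) = block {\<tau>..} bs as ?M $$ (k, l)" .
  qed (use B P in auto)
qed

text \<open>An entry that the labels allow is visible in the star of its row label, and all other
  entries are zero in both matrices. This is the passage from identities at all stalks to identities
  of global matrices.\<close>

lemma lmat_eqI:
  assumes M: "lmat bs as M" and N: "lmat bs as N" and bs: "set bs \<subseteq> X"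
    and eq: "\<And>\<tau>. \<tau> \<in> X \<Longrightarrow> block {\<tau>..} bs as M = block {\<tau>..} bs as N"
  shows "M = N"
proof (rule eq_matI)
  fix j i assume "j < dim_row N" "i < dim_col N"
  then have ij: "j < length bs" "i < length as" using lmatD(1)[OF N] by auto
  show "M $$ (j, i) = N $$ (j, i)"
  proof (cases "bs ! j \<le> as ! i")
    case True
    let ?b = "bs ! j"
    have b: "?b \<in> X" using ij bs by auto
    have "block {?b..} bs as M $$ (idx {?b..} bs j, idx {?b..} as i) =
      block {?b..} bs as N $$ (idx {?b..} bs j, idx {?b..} as i)" using eq[OF b] by simp
    then show ?thesis using ij True lmatD(1)[OF M] lmatD(1)[OF N]
      by (simp add: block_index idx_less pick_idx)
  next
    case False
    then show ?thesis using lmatD(2)[OF M ij] lmatD(2)[OF N ij] by metis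
  qed
qed (use lmatD(1)[OF M] lmatD(1)[OF N] in auto)

section \<open>Quasi-isomorphisms\<close>

lemma mult_mat_zero_vec: "A \<in> carrier_mat m n \<Longrightarrow> A *\<^sub>v 0\<^sub>v n = 0\<^sub>v m" for A :: "'k::field mat"
  by (intro eq_vecI) auto

lemma zero_mat_mult_vec: "v \<in> carrier_vec n \<Longrightarrow> 0\<^sub>m m n *\<^sub>v v = 0\<^sub>v m" for v :: "'k::field vec"
  by (intro eq_vecI) auto

lemma mult_eq_mult_vec:
  fixes A B C D :: "'k::field mat"
  assumes "A * B = C * D" "A \<in> carrier_mat m n" "B \<in> carrier_mat n p"
    "C \<in> carrier_mat m n'" "D \<in> carrier_mat n' p" "v \<in> carrier_vec p"
  shows "A *\<^sub>v (B *\<^sub>v v) = C *\<^sub>v (D *\<^sub>v v)"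
  by (metis assms(1) assoc_mult_mat_vec[OF assms(2,3,6)] assoc_mult_mat_vec[OF assms(4,5,6)])

text \<open>\<open>coh_class\<close> with the incoming differential as a parameter, so that the
  comparison of two cohomology stalks is pure matrix algebra.\<close>

definition coset :: "'k::field mat \<Rightarrow> 'k vec \<Rightarrow> 'k vec set" where
  "coset A v = {v + u | u. u \<in> mat_image A}"

lemma coset_iff:
  assumes A: "A \<in> carrier_mat n a"
  shows "x \<in> coset A v \<longleftrightarrow> (\<exists>u\<in>carrier_vec a. x = v + A *\<^sub>v u)"
  using A by (auto simp: coset_def mat_image_def)

lemma coset_eq_iff:
  assumes A: "A \<in> carrier_mat n a" and v: "v \<in> carrier_vec n" "v' \<in> carrier_vec n"
  shows "coset A v = coset A v' \<longleftrightarrow> (\<exists>u\<in>carrier_vec a. v = v' + A *\<^sub>v u)"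
proof
  assume "coset A v = coset A v'"
  moreover have "v \<in> coset A v"
    unfolding coset_iff[OF A] using A v by (intro bexI[of _ "0\<^sub>v a"]) auto
  ultimately show "\<exists>u\<in>carrier_vec a. v = v' + A *\<^sub>v u" by (simp add: coset_iff[OF A])
next
  assume "\<exists>u\<in>carrier_vec a. v = v' + A *\<^sub>v u"
  then obtain u where u: "u \<in> carrier_vec a" "v = v' + A *\<^sub>v u" by auto
  have "x \<in> coset A v \<longleftrightarrow> x \<in> coset A v'" for x
  proof
    assume "x \<in> coset A v"
    then obtain w where w: "w \<in> carrier_vec a" "x = v + A *\<^sub>v w" by (auto simp: coset_iff[OF A])
    then have "x = v' + A *\<^sub>v (u + w)" using A v u
      by (auto simp: mult_add_distrib_mat_vec[OF A] intro!: eq_vecI)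
    then show "x \<in> coset A v'" using u w by (auto simp: coset_iff[OF A])
  next
    assume "x \<in> coset A v'"
    then obtain w where w: "w \<in> carrier_vec a" "x = v' + A *\<^sub>v w" by (auto simp: coset_iff[OF A])
    then have "x = v + A *\<^sub>v (w - u)" using A v u
      by (auto simp: mult_minus_distrib_mat_vec[OF A] intro!: eq_vecI)
    then show "x \<in> coset A v" using u w by (auto simp: coset_iff[OF A])
  qed
  then show "coset A v = coset A v'" by blast
qed

text \<open>The square with \<open>F'\<close> makes the map respect boundaries, the one with
  \<open>F''\<close> makes it respect cycles. The right-hand side speaks of vectors only; after
  \<open>quasi_iso_iff\<close> has been derived from it, sets of cosets do not occur any
  more.\<close>

lemma coset_bij_iff:
  fixes A A' B B' F F' F'' :: "'k::field mat"
  assumes A: "A \<in> carrier_mat n a" and B: "B \<in> carrier_mat b n"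
    and A': "A' \<in> carrier_mat n' a'" and B': "B' \<in> carrier_mat b' n'"
    and F: "F \<in> carrier_mat n' n" and F': "F' \<in> carrier_mat a' a" and F'': "F'' \<in> carrier_mat b' b"
    and FA: "F * A = A' * F'" and FB: "F'' * B = B' * F"
  shows "bij_betw (\<lambda>c. \<Union>v\<in>c. coset A' (F *\<^sub>v v)) (coset A ` mat_kernel B) (coset A' ` mat_kernel B') \<longleftrightarrow>
    (\<forall>v\<in>carrier_vec n. B *\<^sub>v v = 0\<^sub>v b \<longrightarrow> (\<exists>w\<in>carrier_vec a'. F *\<^sub>v v = A' *\<^sub>v w) \<longrightarrow>
      (\<exists>u\<in>carrier_vec a. v = A *\<^sub>v u)) \<and>
    (\<forall>w\<in>carrier_vec n'. B' *\<^sub>v w = 0\<^sub>v b' \<longrightarrow>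
      (\<exists>v\<in>carrier_vec n. B *\<^sub>v v = 0\<^sub>v b \<and> (\<exists>u\<in>carrier_vec a'. w = F *\<^sub>v v + A' *\<^sub>v u)))"
    (is "bij_betw ?m ?K ?K' \<longleftrightarrow> ?inj \<and> ?surj")
proof -
  have FAv: "F *\<^sub>v (A *\<^sub>v u) = A' *\<^sub>v (F' *\<^sub>v u)" if "u \<in> carrier_vec a" for u
    using mult_eq_mult_vec[OF FA F A A' F' that] .
  have FBv: "F'' *\<^sub>v (B *\<^sub>v u) = B' *\<^sub>v (F *\<^sub>v u)" if "u \<in> carrier_vec n" for u
    using mult_eq_mult_vec[OF FB F'' B B' F that] .
  \<comment> \<open>All representatives of a coset have the same image coset, because
    \<open>F'\<close> carries the difference of two representatives into the image of
    \<open>A'\<close>. The union in \<open>coh_map\<close> therefore collapses to one coset.\<close>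
  have m: "?m (coset A v) = coset A' (F *\<^sub>v v)" if v: "v \<in> carrier_vec n" for v
  proof -
    have "coset A' (F *\<^sub>v x) = coset A' (F *\<^sub>v v)" if "x \<in> coset A v" for x
    proof -
      obtain u where u: "u \<in> carrier_vec a" "x = v + A *\<^sub>v u" using \<open>x \<in> coset A v\<close> by (auto simp: coset_iff[OF A])
      have x: "x \<in> carrier_vec n" using u v A by simp
      show ?thesis
      proof (subst coset_eq_iff[OF A'])
        show "\<exists>u\<in>carrier_vec a'. F *\<^sub>v x = F *\<^sub>v v + A' *\<^sub>v u"
          using u v FAv F F' A by (intro bexI[of _ "F' *\<^sub>v u"]) (auto simp: mult_add_distrib_mat_vec[OF F])
      qed (use F x v in auto)
    qed
    moreover have "coset A v \<noteq> {}"
      using A zero_carrier_vec[of a] by (auto simp: coset_def mat_image_def simp del: zero_carrier_vec)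
    ultimately show ?thesis by (intro SUP_eq_const)
  qed
  have K: "v \<in> mat_kernel B \<longleftrightarrow> v \<in> carrier_vec n \<and> B *\<^sub>v v = 0\<^sub>v b" for v
    using B by (auto simp: mat_kernel)
  have K': "v \<in> mat_kernel B' \<longleftrightarrow> v \<in> carrier_vec n' \<and> B' *\<^sub>v v = 0\<^sub>v b'" for v
    using B' by (auto simp: mat_kernel)
  have FK: "F *\<^sub>v v \<in> mat_kernel B'" if "v \<in> mat_kernel B" for v
    using that FBv[of v] F mult_mat_zero_vec[OF F''] by (auto simp: K K')
  have inj: "inj_on ?m ?K \<longleftrightarrow> ?inj"
  proof
    assume i: "inj_on ?m ?K"
    show ?inj
    proof (intro ballI impI)
      fix v assume v: "v \<in> carrier_vec n" "B *\<^sub>v v = 0\<^sub>v b" and "\<exists>w\<in>carrier_vec a'. F *\<^sub>v v = A' *\<^sub>v w"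
      then obtain w where w: "w \<in> carrier_vec a'" "F *\<^sub>v v = A' *\<^sub>v w" by auto
      have "coset A' (F *\<^sub>v v) = coset A' (F *\<^sub>v 0\<^sub>v n)"
        using F v w A' by (subst coset_eq_iff[OF A']) (auto intro!: bexI[of _ w])
      then have "?m (coset A v) = ?m (coset A (0\<^sub>v n))" using m[OF v(1)] m[of "0\<^sub>v n"] by simp
      moreover have "coset A v \<in> ?K" "coset A (0\<^sub>v n) \<in> ?K"
        using v by (auto simp: K mult_mat_zero_vec[OF B] intro!: imageI)
      ultimately have "coset A v = coset A (0\<^sub>v n)" by (rule inj_onD[OF i])
      then show "\<exists>u\<in>carrier_vec a. v = A *\<^sub>v u"
        using v A unfolding coset_eq_iff[OF A v(1) zero_carrier_vec] by auto
    qed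
  next
    assume i: ?inj
    show "inj_on ?m ?K"
    proof (rule inj_onI)
      fix c c' assume "c \<in> ?K" "c' \<in> ?K" and e: "?m c = ?m c'"
      then obtain v v' where v: "v \<in> mat_kernel B" "c = coset A v" "v' \<in> mat_kernel B" "c' = coset A v'" by auto
      have vc: "v \<in> carrier_vec n" "v' \<in> carrier_vec n" "B *\<^sub>v v = 0\<^sub>v b" "B *\<^sub>v v' = 0\<^sub>v b" using v by (auto simp: K)
      have "coset A' (F *\<^sub>v v) = coset A' (F *\<^sub>v v')" using e m[OF vc(1)] m[OF vc(2)] v by simp
      then obtain u where u: "u \<in> carrier_vec a'" "F *\<^sub>v v = F *\<^sub>v v' + A' *\<^sub>v u"
        using F vc by (subst (asm) coset_eq_iff[OF A']) auto
      have "F *\<^sub>v (v - v') = A' *\<^sub>v u"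
        using u F vc A' by (auto simp: mult_minus_distrib_mat_vec[OF F] intro!: eq_vecI)
      moreover have "B *\<^sub>v (v - v') = 0\<^sub>v b" using vc B by (auto simp: mult_minus_distrib_mat_vec[OF B])
      ultimately obtain u' where u': "u' \<in> carrier_vec a" "v - v' = A *\<^sub>v u'"
        using i u vc by (metis minus_carrier_vec)
      have "v = v' + (v - v')" using vc by (auto intro!: eq_vecI)
      then have "v = v' + A *\<^sub>v u'" using u' by simp
      then show "c = c'" using v vc u' by (subst v(2), subst v(4), subst coset_eq_iff[OF A]) auto
    qed
  qed
  have surj: "?m ` ?K = ?K' \<longleftrightarrow> ?surj"
  proof
    assume e: "?m ` ?K = ?K'"
    show ?surj
    proof (intro ballI impI)
      fix w assume w: "w \<in> carrier_vec n'" "B' *\<^sub>v w = 0\<^sub>v b'"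
      then have "coset A' w \<in> ?m ` ?K" unfolding e by (auto simp: K')
      then obtain v where v: "v \<in> mat_kernel B" "coset A' w = ?m (coset A v)" by auto
      then have "coset A' w = coset A' (F *\<^sub>v v)" using m by (simp add: K)
      then have "\<exists>u\<in>carrier_vec a'. w = F *\<^sub>v v + A' *\<^sub>v u"
        using w v F by (subst (asm) coset_eq_iff[OF A']) (auto simp: K)
      then show "\<exists>v\<in>carrier_vec n. B *\<^sub>v v = 0\<^sub>v b \<and> (\<exists>u\<in>carrier_vec a'. w = F *\<^sub>v v + A' *\<^sub>v u)"
        using v by (auto simp: K)
    qed
  next
    assume s: ?surj
    show "?m ` ?K = ?K'"
    proof (intro equalityI subsetI)
      fix c assume "c \<in> ?m ` ?K"
      then obtain v where v: "v \<in> mat_kernel B" "c = ?m (coset A v)" by auto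
      then have "c = coset A' (F *\<^sub>v v)" using m by (simp add: K)
      then show "c \<in> ?K'" using FK v by auto
    next
      fix c assume "c \<in> ?K'"
      then obtain w where w: "w \<in> mat_kernel B'" "c = coset A' w" by auto
      then obtain v u where v: "v \<in> carrier_vec n" "B *\<^sub>v v = 0\<^sub>v b" "u \<in> carrier_vec a'" "w = F *\<^sub>v v + A' *\<^sub>v u"
        using s by (auto simp: K')
      then have "c = coset A' (F *\<^sub>v v)"
        using w F A' by (subst w(2), subst coset_eq_iff[OF A']) (auto simp: K')
      then have "c = ?m (coset A v)" using m v by simp
      then show "c \<in> ?m ` ?K" using v by (auto simp: K)
    qed
  qed
  show ?thesis unfolding bij_betw_def inj surj by blast
qed

section \<open>Cycles and boundaries at a stalk\<close>

lemma bounded_complexD: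
  assumes "bounded_complex X C"
  shows "sheaf_on X (obj C d)"
    and "sheaf_hom X (obj C d) (obj C (d + 1)) (diff C d)"
    and "\<pi> \<in> X \<Longrightarrow> diff C (d + 1) \<pi> * diff C d \<pi> = 0\<^sub>m (sdim (obj C (d + 2)) \<pi>) (sdim (obj C d) \<pi>)"
    and "\<exists>a b. \<forall>d. d < a \<or> b < d \<longrightarrow> (\<forall>\<pi>\<in>X. sdim (obj C d) \<pi> = 0)"
  using assms unfolding bounded_complex_def by blast+

lemma diff_carrier:
  assumes "bounded_complex X C" "\<pi> \<in> X"
  shows "diff C d \<pi> \<in> carrier_mat (sdim (obj C (d + 1)) \<pi>) (sdim (obj C d) \<pi>)"
    and "diff C (d - 1) \<pi> \<in> carrier_mat (sdim (obj C d) \<pi>) (sdim (obj C (d - 1)) \<pi>)"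
    and "diff C (d + 1) \<pi> \<in> carrier_mat (sdim (obj C (d + 2)) \<pi>) (sdim (obj C (d + 1)) \<pi>)"
  using sheaf_homD(1)[OF bounded_complexD(2)[OF assms(1), of d] assms(2)]
    sheaf_homD(1)[OF bounded_complexD(2)[OF assms(1), of "d - 1"] assms(2)]
    sheaf_homD(1)[OF bounded_complexD(2)[OF assms(1), of "d + 1"] assms(2)]
  by (simp_all add: add.assoc)

lemma diff_diff:
  assumes "bounded_complex X C" "\<pi> \<in> X"
  shows "v \<in> carrier_vec (sdim (obj C d) \<pi>) \<Longrightarrow>
      diff C (d + 1) \<pi> *\<^sub>v (diff C d \<pi> *\<^sub>v v) = 0\<^sub>v (sdim (obj C (d + 2)) \<pi>)"
    and "v \<in> carrier_vec (sdim (obj C (d - 1)) \<pi>) \<Longrightarrow>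
      diff C d \<pi> *\<^sub>v (diff C (d - 1) \<pi> *\<^sub>v v) = 0\<^sub>v (sdim (obj C (d + 1)) \<pi>)"
proof -
  have *: "diff C (d + 1) \<pi> *\<^sub>v (diff C d \<pi> *\<^sub>v v) = 0\<^sub>v (sdim (obj C (d + 2)) \<pi>)"
    if "v \<in> carrier_vec (sdim (obj C d) \<pi>)" for d v
    using arg_cong[OF bounded_complexD(3)[OF assms, of d], of "\<lambda>M. M *\<^sub>v v"]
      diff_carrier[OF assms, of d] that by (simp add: zero_mat_mult_vec)
  show "v \<in> carrier_vec (sdim (obj C d) \<pi>) \<Longrightarrow>
      diff C (d + 1) \<pi> *\<^sub>v (diff C d \<pi> *\<^sub>v v) = 0\<^sub>v (sdim (obj C (d + 2)) \<pi>)" by (rule *)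
  show "v \<in> carrier_vec (sdim (obj C (d - 1)) \<pi>) \<Longrightarrow>
      diff C d \<pi> *\<^sub>v (diff C (d - 1) \<pi> *\<^sub>v v) = 0\<^sub>v (sdim (obj C (d + 1)) \<pi>)"
    using *[of v "d - 1"] by (simp add: algebra_simps)
qed

lemma chain_mapD:
  assumes "chain_map X C D f"
  shows "sheaf_hom X (obj C d) (obj D d) (f d)"
    and "\<pi> \<in> X \<Longrightarrow> f d \<pi> \<in> carrier_mat (sdim (obj D d) \<pi>) (sdim (obj C d) \<pi>)"
    and "\<pi> \<in> X \<Longrightarrow> f (d + 1) \<pi> * diff C d \<pi> = diff D d \<pi> * f d \<pi>"
    and "\<pi> \<in> X \<Longrightarrow> f d \<pi> * diff C (d - 1) \<pi> = diff D (d - 1) \<pi> * f (d - 1) \<pi>"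
proof -
  have *: "f (d + 1) \<pi> * diff C d \<pi> = diff D d \<pi> * f d \<pi>" if "\<pi> \<in> X" for d \<pi>
    using assms that unfolding chain_map_def by blast
  show 1: "sheaf_hom X (obj C d) (obj D d) (f d)" using assms unfolding chain_map_def by blast
  show "\<pi> \<in> X \<Longrightarrow> f d \<pi> \<in> carrier_mat (sdim (obj D d) \<pi>) (sdim (obj C d) \<pi>)" by (rule sheaf_homD(1)[OF 1])
  show "\<pi> \<in> X \<Longrightarrow> f (d + 1) \<pi> * diff C d \<pi> = diff D d \<pi> * f d \<pi>" by (rule *)
  show "\<pi> \<in> X \<Longrightarrow> f d \<pi> * diff C (d - 1) \<pi> = diff D (d - 1) \<pi> * f (d - 1) \<pi>" using *[of \<pi> "d - 1"] by simp
qed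

lemma chain_map_vec:
  assumes C: "bounded_complex X C" and D: "bounded_complex X D" and f: "chain_map X C D f" and p: "\<pi> \<in> X"
  shows "v \<in> carrier_vec (sdim (obj C d) \<pi>) \<Longrightarrow> f (d + 1) \<pi> *\<^sub>v (diff C d \<pi> *\<^sub>v v) = diff D d \<pi> *\<^sub>v (f d \<pi> *\<^sub>v v)"
    and "v \<in> carrier_vec (sdim (obj C (d - 1)) \<pi>) \<Longrightarrow>
      f d \<pi> *\<^sub>v (diff C (d - 1) \<pi> *\<^sub>v v) = diff D (d - 1) \<pi> *\<^sub>v (f (d - 1) \<pi> *\<^sub>v v)"
proof -
  have *: "f (d + 1) \<pi> *\<^sub>v (diff C d \<pi> *\<^sub>v v) = diff D d \<pi> *\<^sub>v (f d \<pi> *\<^sub>v v)"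
    if "v \<in> carrier_vec (sdim (obj C d) \<pi>)" for v d
    using mult_eq_mult_vec[OF chain_mapD(3)[OF f p] chain_mapD(2)[OF f p] diff_carrier(1)[OF C p]
        diff_carrier(1)[OF D p] chain_mapD(2)[OF f p] that] .
  show "v \<in> carrier_vec (sdim (obj C d) \<pi>) \<Longrightarrow> f (d + 1) \<pi> *\<^sub>v (diff C d \<pi> *\<^sub>v v) = diff D d \<pi> *\<^sub>v (f d \<pi> *\<^sub>v v)"
    by (rule *)
  show "v \<in> carrier_vec (sdim (obj C (d - 1)) \<pi>) \<Longrightarrow>
      f d \<pi> *\<^sub>v (diff C (d - 1) \<pi> *\<^sub>v v) = diff D (d - 1) \<pi> *\<^sub>v (f (d - 1) \<pi> *\<^sub>v v)"
    using *[of v "d - 1"] by simp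
qed

abbreviation stalk :: "('p, 'k::field) sheaf_complex \<Rightarrow> int \<Rightarrow> 'p \<Rightarrow> 'k vec set" where
  "stalk C d \<pi> \<equiv> carrier_vec (sdim (obj C d) \<pi>)"

definition is_cycle :: "('p, 'k::field) sheaf_complex \<Rightarrow> int \<Rightarrow> 'p \<Rightarrow> 'k vec \<Rightarrow> bool" where
  "is_cycle C d \<pi> v \<longleftrightarrow> v \<in> stalk C d \<pi> \<and> diff C d \<pi> *\<^sub>v v = 0\<^sub>v (sdim (obj C (d + 1)) \<pi>)"

definition is_boundary :: "('p, 'k::field) sheaf_complex \<Rightarrow> int \<Rightarrow> 'p \<Rightarrow> 'k vec \<Rightarrow> bool" where
  "is_boundary C d \<pi> v \<longleftrightarrow> (\<exists>u\<in>stalk C (d - 1) \<pi>. v = diff C (d - 1) \<pi> *\<^sub>v u)"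

definition bijective_on_cohomology where
  "bijective_on_cohomology X C D f \<longleftrightarrow> (\<forall>d. \<forall>\<pi>\<in>X.
     (\<forall>v. is_cycle C d \<pi> v \<longrightarrow> is_boundary D d \<pi> (f d \<pi> *\<^sub>v v) \<longrightarrow> is_boundary C d \<pi> v) \<and>
     (\<forall>w. is_cycle D d \<pi> w \<longrightarrow> (\<exists>v u. is_cycle C d \<pi> v \<and> is_boundary D d \<pi> u \<and> w = f d \<pi> *\<^sub>v v + u)))"

lemma quasi_iso_iff:
  assumes C: "bounded_complex X C" and D: "bounded_complex X D"
  shows "quasi_iso X C D f \<longleftrightarrow> chain_map X C D f \<and> bijective_on_cohomology X C D f"
proof (cases "chain_map X C D f")
  case f: True
  have "bij_betw (coh_map D f d \<pi>) (cohomology C d \<pi>) (cohomology D d \<pi>) \<longleftrightarrow>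
     (\<forall>v. is_cycle C d \<pi> v \<longrightarrow> is_boundary D d \<pi> (f d \<pi> *\<^sub>v v) \<longrightarrow> is_boundary C d \<pi> v) \<and>
     (\<forall>w. is_cycle D d \<pi> w \<longrightarrow> (\<exists>v u. is_cycle C d \<pi> v \<and> is_boundary D d \<pi> u \<and> w = f d \<pi> *\<^sub>v v + u))"
    if p: "\<pi> \<in> X" for d \<pi>
  proof -
    have cl: "coh_class E d \<pi> = coset (diff E (d - 1) \<pi>)" for E :: "('a, 'b) sheaf_complex"
      by (auto simp: coh_class_def coset_def fun_eq_iff)
    have "bij_betw (coh_map D f d \<pi>) (cohomology C d \<pi>) (cohomology D d \<pi>) \<longleftrightarrow>
      bij_betw (\<lambda>c. \<Union>v\<in>c. coset (diff D (d - 1) \<pi>) (f d \<pi> *\<^sub>v v))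
       (coset (diff C (d - 1) \<pi>) ` mat_kernel (diff C d \<pi>)) (coset (diff D (d - 1) \<pi>) ` mat_kernel (diff D d \<pi>))"
      by (simp add: coh_map_def[abs_def] cohomology_def cl)
    then show ?thesis
      unfolding coset_bij_iff[OF diff_carrier(2)[OF C p, of d] diff_carrier(1)[OF C p, of d]
        diff_carrier(2)[OF D p, of d] diff_carrier(1)[OF D p, of d] chain_mapD(2)[OF f p, of d]
        chain_mapD(2)[OF f p, of "d - 1"] chain_mapD(2)[OF f p, of "d + 1"]
        chain_mapD(4)[OF f p, of d] chain_mapD(3)[OF f p, of d]]
      unfolding is_cycle_def is_boundary_def by blast
  qed
  then show ?thesis using f unfolding quasi_iso_def bijective_on_cohomology_def by blast
qed (auto simp: quasi_iso_def)

lemma boundary_add: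
  assumes "bounded_complex X C" "\<pi> \<in> X" "is_boundary C d \<pi> v" "is_boundary C d \<pi> w"
  shows "is_boundary C d \<pi> (v + w)"
proof -
  obtain a b where "a \<in> stalk C (d - 1) \<pi>" "v = diff C (d - 1) \<pi> *\<^sub>v a"
    "b \<in> stalk C (d - 1) \<pi>" "w = diff C (d - 1) \<pi> *\<^sub>v b"
    using assms(3,4) unfolding is_boundary_def by blast
  then show ?thesis using diff_carrier(2)[OF assms(1,2), of d] unfolding is_boundary_def
    by (intro bexI[of _ "a + b"]) (auto simp: mult_add_distrib_mat_vec)
qed

lemma boundary_minus:
  assumes "bounded_complex X C" "\<pi> \<in> X" "is_boundary C d \<pi> v" "is_boundary C d \<pi> w"
  shows "is_boundary C d \<pi> (v - w)"
proof -
  obtain a b where "a \<in> stalk C (d - 1) \<pi>" "v = diff C (d - 1) \<pi> *\<^sub>v a"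
    "b \<in> stalk C (d - 1) \<pi>" "w = diff C (d - 1) \<pi> *\<^sub>v b"
    using assms(3,4) unfolding is_boundary_def by blast
  then show ?thesis using diff_carrier(2)[OF assms(1,2), of d] unfolding is_boundary_def
    by (intro bexI[of _ "a - b"]) (auto simp: mult_minus_distrib_mat_vec)
qed

lemma boundary_carrier:
  assumes "bounded_complex X C" "\<pi> \<in> X" "is_boundary C d \<pi> v"
  shows "v \<in> stalk C d \<pi>"
  using assms diff_carrier(2)[OF assms(1,2), of d] unfolding is_boundary_def by auto

lemma boundary_cycle:
  assumes "bounded_complex X C" "\<pi> \<in> X" "is_boundary C d \<pi> v"
  shows "is_cycle C d \<pi> v"
  using assms boundary_carrier[OF assms] diff_diff(2)[OF assms(1,2), of _ d]
  unfolding is_boundary_def is_cycle_def by blast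

lemma chain_map_boundary:
  assumes "bounded_complex X C" "bounded_complex X D" "chain_map X C D f" "\<pi> \<in> X" "is_boundary C d \<pi> v"
  shows "is_boundary D d \<pi> (f d \<pi> *\<^sub>v v)"
proof -
  obtain a where "a \<in> stalk C (d - 1) \<pi>" "v = diff C (d - 1) \<pi> *\<^sub>v a" using assms(5) unfolding is_boundary_def by blast
  then show ?thesis using chain_map_vec(2)[OF assms(1-4), of a d] chain_mapD(2)[OF assms(3,4), of "d - 1"]
    unfolding is_boundary_def by (intro bexI[of _ "f (d - 1) \<pi> *\<^sub>v a"]) auto
qed

lemma chain_map_cycle:
  assumes "bounded_complex X C" "bounded_complex X D" "chain_map X C D f" "\<pi> \<in> X" "is_cycle C d \<pi> v"
  shows "is_cycle D d \<pi> (f d \<pi> *\<^sub>v v)"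
proof -
  have v: "v \<in> stalk C d \<pi>" "diff C d \<pi> *\<^sub>v v = 0\<^sub>v (sdim (obj C (d + 1)) \<pi>)"
    using assms(5) unfolding is_cycle_def by auto
  have "diff D d \<pi> *\<^sub>v (f d \<pi> *\<^sub>v v) = 0\<^sub>v (sdim (obj D (d + 1)) \<pi>)"
    using chain_map_vec(1)[OF assms(1-4) v(1)] v(2) mult_mat_zero_vec[OF chain_mapD(2)[OF assms(3,4), of "d + 1"]] by simp
  then show ?thesis using v chain_mapD(2)[OF assms(3,4), of d] unfolding is_cycle_def by simp
qed

section \<open>Homotopies, composition and cancellation of quasi-isomorphisms\<close>

definition homotopic where
  "homotopic X C D f g h \<longleftrightarrow> (\<forall>d. sheaf_hom X (obj C d) (obj D (d - 1)) (h d)) \<and>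
     (\<forall>d. \<forall>\<pi>\<in>X. f d \<pi> = g d \<pi> + (diff D (d - 1) \<pi> * h d \<pi> + h (d + 1) \<pi> * diff C d \<pi>))"

text \<open>On a cycle, the summand of the homotopy that begins with the differential vanishes and
  the other one is a boundary. Homotopic maps thus agree on cohomology.\<close>

lemma homotopic_cycle:
  assumes C: "bounded_complex X C" and D: "bounded_complex X D" and h: "homotopic X C D f g h"
    and g: "g d \<pi> \<in> carrier_mat (sdim (obj D d) \<pi>) (sdim (obj C d) \<pi>)"
    and p: "\<pi> \<in> X" and v: "is_cycle C d \<pi> v"
  obtains u where "is_boundary D d \<pi> u" "f d \<pi> *\<^sub>v v = g d \<pi> *\<^sub>v v + u"
proof
  have H: "h d \<pi> \<in> carrier_mat (sdim (obj D (d - 1)) \<pi>) (sdim (obj C d) \<pi>)"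
    "h (d + 1) \<pi> \<in> carrier_mat (sdim (obj D d) \<pi>) (sdim (obj C (d + 1)) \<pi>)"
  proof -
    have "sheaf_hom X (obj C e) (obj D (e - 1)) (h e)" for e using h unfolding homotopic_def by blast
    from sheaf_homD(1)[OF this p, of d] sheaf_homD(1)[OF this p, of "d + 1"]
    show "h d \<pi> \<in> carrier_mat (sdim (obj D (d - 1)) \<pi>) (sdim (obj C d) \<pi>)"
    "h (d + 1) \<pi> \<in> carrier_mat (sdim (obj D d) \<pi>) (sdim (obj C (d + 1)) \<pi>)" by simp_all
  qed
  have f: "f d \<pi> = g d \<pi> + (diff D (d - 1) \<pi> * h d \<pi> + h (d + 1) \<pi> * diff C d \<pi>)"
    using h p unfolding homotopic_def by blast
  have vc: "v \<in> stalk C d \<pi>" "diff C d \<pi> *\<^sub>v v = 0\<^sub>v (sdim (obj C (d + 1)) \<pi>)"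
    using v unfolding is_cycle_def by auto
  note dC = diff_carrier(1)[OF C p, of d] and dD = diff_carrier(2)[OF D p, of d]
  let ?u = "diff D (d - 1) \<pi> *\<^sub>v (h d \<pi> *\<^sub>v v)"
  show "is_boundary D d \<pi> ?u" unfolding is_boundary_def using H vc by (intro bexI[of _ "h d \<pi> *\<^sub>v v"]) auto
  show "f d \<pi> *\<^sub>v v = g d \<pi> *\<^sub>v v + ?u"
    unfolding f using H vc dC dD g
    by (subst add_mult_distrib_mat_vec[OF g _ vc(1)], force,
        subst add_mult_distrib_mat_vec[OF mult_carrier_mat[OF dD H(1)] mult_carrier_mat[OF H(2) dC] vc(1)])
       (simp add: mult_mat_zero_vec[OF H(2)])
qed

lemma sheaf_hom_comp:
  assumes F: "sheaf_on X F" and G: "sheaf_on X G" and H: "sheaf_on X H"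
    and f: "sheaf_hom X F G \<phi>" and g: "sheaf_hom X G H \<psi>"
  shows "sheaf_hom X F H (\<lambda>\<tau>. \<psi> \<tau> * \<phi> \<tau>)"
  unfolding sheaf_hom_def
proof (intro conjI ballI impI)
  fix \<sigma> assume s: "\<sigma> \<in> X"
  note cs = sheaf_homD(1)[OF f s] sheaf_homD(1)[OF g s]
  show "\<psi> \<sigma> * \<phi> \<sigma> \<in> carrier_mat (sdim H \<sigma>) (sdim F \<sigma>)" using mult_carrier_mat[OF cs(2,1)] .
  fix \<tau> assume t: "\<tau> \<in> X" "\<sigma> \<le> \<tau>"
  note ct = sheaf_homD(1)[OF f t(1)] sheaf_homD(1)[OF g t(1)]
  note r = sheaf_onD(1)[OF F s t] sheaf_onD(1)[OF G s t] sheaf_onD(1)[OF H s t]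
  have "\<psi> \<tau> * \<phi> \<tau> * res F \<sigma> \<tau> = \<psi> \<tau> * (res G \<sigma> \<tau> * \<phi> \<sigma>)"
    using assoc_mult_mat[OF ct(2) ct(1) r(1)] sheaf_homD(2)[OF f s t] by simp
  also have "\<dots> = res H \<sigma> \<tau> * \<psi> \<sigma> * \<phi> \<sigma>"
    using assoc_mult_mat[OF ct(2) r(2) cs(1)] sheaf_homD(2)[OF g s t] by simp
  also have "\<dots> = res H \<sigma> \<tau> * (\<psi> \<sigma> * \<phi> \<sigma>)"
    using assoc_mult_mat[OF r(3) cs(2) cs(1)] by simp
  finally show "\<psi> \<tau> * \<phi> \<tau> * res F \<sigma> \<tau> = res H \<sigma> \<tau> * (\<psi> \<sigma> * \<phi> \<sigma>)" .
qed

lemma bijective_on_cohomology_comp: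
  assumes B: "bounded_complex X B" and C: "bounded_complex X C" and D: "bounded_complex X D"
    and f: "chain_map X B C f" and g: "chain_map X C D g"
    and bf: "bijective_on_cohomology X B C f" and bg: "bijective_on_cohomology X C D g"
  shows "quasi_iso X B D (\<lambda>d \<pi>. g d \<pi> * f d \<pi>)"
  unfolding quasi_iso_iff[OF B D]
proof
  show "chain_map X B D (\<lambda>d \<pi>. g d \<pi> * f d \<pi>)"
    unfolding chain_map_def
  proof (intro conjI allI ballI)
    fix d
    show "sheaf_hom X (obj B d) (obj D d) (\<lambda>\<pi>. g d \<pi> * f d \<pi>)"
      by (rule sheaf_hom_comp[OF bounded_complexD(1)[OF B] bounded_complexD(1)[OF C] bounded_complexD(1)[OF D]
          chain_mapD(1)[OF f] chain_mapD(1)[OF g]])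
    fix \<sigma> assume s: "\<sigma> \<in> X"
    note cs = chain_mapD(2)[OF f s] chain_mapD(2)[OF g s] diff_carrier(1)[OF B s] diff_carrier(1)[OF C s] diff_carrier(1)[OF D s]
    have "g (d + 1) \<sigma> * f (d + 1) \<sigma> * diff B d \<sigma> = g (d + 1) \<sigma> * (diff C d \<sigma> * f d \<sigma>)"
      using assoc_mult_mat[OF cs(2) cs(1) cs(3)] chain_mapD(3)[OF f s] by simp
    also have "\<dots> = diff D d \<sigma> * g d \<sigma> * f d \<sigma>"
      using assoc_mult_mat[OF cs(2) cs(4) cs(1)] chain_mapD(3)[OF g s] by simp
    also have "\<dots> = diff D d \<sigma> * (g d \<sigma> * f d \<sigma>)"
      using assoc_mult_mat[OF cs(5) cs(2) cs(1)] by simp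
    finally show "g (d + 1) \<sigma> * f (d + 1) \<sigma> * diff B d \<sigma> = diff D d \<sigma> * (g d \<sigma> * f d \<sigma>)" .
  qed
  show "bijective_on_cohomology X B D (\<lambda>d \<pi>. g d \<pi> * f d \<pi>)"
    unfolding bijective_on_cohomology_def
  proof (intro allI ballI conjI impI)
    fix d \<pi> v assume p: "\<pi> \<in> X" and v: "is_cycle B d \<pi> v" and b: "is_boundary D d \<pi> ((g d \<pi> * f d \<pi>) *\<^sub>v v)"
    have "(g d \<pi> * f d \<pi>) *\<^sub>v v = g d \<pi> *\<^sub>v (f d \<pi> *\<^sub>v v)"
      using v assoc_mult_mat_vec[OF chain_mapD(2)[OF g p] chain_mapD(2)[OF f p]] unfolding is_cycle_def by blast
    then show "is_boundary B d \<pi> v"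
      using b v bf bg p chain_map_cycle[OF B C f p v] unfolding bijective_on_cohomology_def by metis
  next
    fix d \<pi> w assume p: "\<pi> \<in> X" and w: "is_cycle D d \<pi> w"
    obtain v u where v: "is_cycle C d \<pi> v" "is_boundary D d \<pi> u" "w = g d \<pi> *\<^sub>v v + u"
      using bg w p unfolding bijective_on_cohomology_def by blast
    obtain v' u' where v': "is_cycle B d \<pi> v'" "is_boundary C d \<pi> u'" "v = f d \<pi> *\<^sub>v v' + u'"
      using bf v(1) p unfolding bijective_on_cohomology_def by blast
    note cf = chain_mapD(2)[OF f p, of d] and cg = chain_mapD(2)[OF g p, of d]
    have v'c: "v' \<in> stalk B d \<pi>" using v' unfolding is_cycle_def by simp
    note uc = boundary_carrier[OF D p v(2)] boundary_carrier[OF C p v'(2)]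
    have "w = (g d \<pi> * f d \<pi>) *\<^sub>v v' + (g d \<pi> *\<^sub>v u' + u)"
      unfolding v(3) v'(3) using cf cg v'c uc
      by (subst mult_add_distrib_mat_vec[OF cg]) (auto intro!: assoc_add_vec)
    moreover have "is_boundary D d \<pi> (g d \<pi> *\<^sub>v u' + u)"
      using boundary_add[OF D p chain_map_boundary[OF C D g p v'(2)] v(2)] .
    ultimately show "\<exists>v u. is_cycle B d \<pi> v \<and> is_boundary D d \<pi> u \<and> w = (g d \<pi> * f d \<pi>) *\<^sub>v v + u"
      using v' by blast
  qed
qed

text \<open>On classes, \<open>f\<close> is \<open>f'\<close> after \<open>q\<close>, since the
  homotopy contributes boundaries only. Every class of \<open>C\<close> comes from \<open>B\<close>
  because \<open>q\<close> is onto, so bijectivity passes from \<open>f\<close> to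
  \<open>f'\<close>.\<close>

lemma bijective_on_cohomology_cancel_right:
  assumes B: "bounded_complex X B" and C: "bounded_complex X C" and D: "bounded_complex X D"
    and q: "chain_map X B C q" and f': "chain_map X C D f'" and f: "chain_map X B D f"
    and h: "homotopic X B D f (\<lambda>d \<pi>. f' d \<pi> * q d \<pi>) h"
    and bq: "bijective_on_cohomology X B C q" and bf: "bijective_on_cohomology X B D f"
  shows "bijective_on_cohomology X C D f'"
proof -
  have hv: "\<exists>u. is_boundary D d \<pi> u \<and> f d \<pi> *\<^sub>v v = f' d \<pi> *\<^sub>v (q d \<pi> *\<^sub>v v) + u"
    if p: "\<pi> \<in> X" and v: "is_cycle B d \<pi> v" for d \<pi> v
  proof -
    note c = chain_mapD(2)[OF f' p, of d] chain_mapD(2)[OF q p, of d]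
    obtain u where "is_boundary D d \<pi> u" "f d \<pi> *\<^sub>v v = (f' d \<pi> * q d \<pi>) *\<^sub>v v + u"
      using homotopic_cycle[OF B D h mult_carrier_mat[OF c] p v] .
    moreover have "(f' d \<pi> * q d \<pi>) *\<^sub>v v = f' d \<pi> *\<^sub>v (q d \<pi> *\<^sub>v v)"
      using c v unfolding is_cycle_def by simp
    ultimately show ?thesis by auto
  qed
  show ?thesis
    unfolding bijective_on_cohomology_def
  proof (intro allI ballI conjI impI)
    fix d \<pi> y assume p: "\<pi> \<in> X" and y: "is_cycle C d \<pi> y" and b: "is_boundary D d \<pi> (f' d \<pi> *\<^sub>v y)"
    obtain x z where x: "is_cycle B d \<pi> x" "is_boundary C d \<pi> z" "y = q d \<pi> *\<^sub>v x + z"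
      using bq y p unfolding bijective_on_cohomology_def by blast
    obtain u where u: "is_boundary D d \<pi> u" "f d \<pi> *\<^sub>v x = f' d \<pi> *\<^sub>v (q d \<pi> *\<^sub>v x) + u"
      using hv[OF p x(1)] by blast
    note c' = chain_mapD(2)[OF f' p, of d] and cq = chain_mapD(2)[OF q p, of d]
    have xc: "x \<in> stalk B d \<pi>" using x unfolding is_cycle_def by simp
    have zb: "is_boundary D d \<pi> (f' d \<pi> *\<^sub>v z)" using chain_map_boundary[OF C D f' p x(2)] .
    note zc = boundary_carrier[OF C p x(2)] and uc = boundary_carrier[OF D p u(1)]
    have "f' d \<pi> *\<^sub>v y = f' d \<pi> *\<^sub>v (q d \<pi> *\<^sub>v x) + f' d \<pi> *\<^sub>v z"
      unfolding x(3) using c' cq xc zc by (intro mult_add_distrib_mat_vec) auto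
    then have "f d \<pi> *\<^sub>v x = (f' d \<pi> *\<^sub>v y - f' d \<pi> *\<^sub>v z) + u"
      unfolding u(2) using c' cq xc zc uc by (auto intro!: eq_vecI)
    then have "is_boundary D d \<pi> (f d \<pi> *\<^sub>v x)"
      using boundary_add[OF D p boundary_minus[OF D p b zb] u(1)] by simp
    then have "is_boundary B d \<pi> x" using bf x p unfolding bijective_on_cohomology_def by blast
    then show "is_boundary C d \<pi> y"
      unfolding x(3) using boundary_add[OF C p chain_map_boundary[OF B C q p] x(2)] by blast
  next
    fix d \<pi> w assume p: "\<pi> \<in> X" and w: "is_cycle D d \<pi> w"
    obtain x z where x: "is_cycle B d \<pi> x" "is_boundary D d \<pi> z" "w = f d \<pi> *\<^sub>v x + z"
      using bf w p unfolding bijective_on_cohomology_def by blast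
    obtain u where u: "is_boundary D d \<pi> u" "f d \<pi> *\<^sub>v x = f' d \<pi> *\<^sub>v (q d \<pi> *\<^sub>v x) + u"
      using hv[OF p x(1)] by blast
    note c' = chain_mapD(2)[OF f' p, of d] and cq = chain_mapD(2)[OF q p, of d]
    have xc: "x \<in> stalk B d \<pi>" using x unfolding is_cycle_def by simp
    note zc = boundary_carrier[OF D p x(2)] and uc = boundary_carrier[OF D p u(1)]
    have "w = f' d \<pi> *\<^sub>v (q d \<pi> *\<^sub>v x) + (u + z)"
      unfolding x(3) u(2) using c' cq xc zc uc by (intro assoc_add_vec) auto
    then show "\<exists>v u. is_cycle C d \<pi> v \<and> is_boundary D d \<pi> u \<and> w = f' d \<pi> *\<^sub>v v + u"
      using chain_map_cycle[OF B C q p x(1)] boundary_add[OF D p u(1) x(2)] by blast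
  qed
qed

section \<open>Lifting along quasi-isomorphisms\<close>

lemma sum_lessThan_add: "(\<Sum>k<m + (n::nat). g k) = (\<Sum>k<m. g k) + (\<Sum>k<n. g (m + k))"
  for g :: "nat \<Rightarrow> 'a::comm_monoid_add"
  by (induction n) (auto simp: add.assoc)

lemma zero_vec_append: "0\<^sub>v m @\<^sub>v 0\<^sub>v n = (0\<^sub>v (m + n) :: 'k::field vec)"
  by (intro eq_vecI) auto

text \<open>\<open>factor_through\<close> for maps on a direct sum. The matrix \<open>?M\<close>
  sends \<open>(y, x)\<close> to \<open>(a y + q x, e x)\<close>, and the two equations for
  \<open>s1\<close> and \<open>s2\<close> are the two column blocks of
  \<open>?R = S * ?M\<close>.\<close>

lemma factor_through_pair:
  fixes a q e r1 r2 :: "'k::field mat"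
  assumes a: "a \<in> carrier_mat m1 n1" and q: "q \<in> carrier_mat m1 n2" and e: "e \<in> carrier_mat m2 n2"
    and r1: "r1 \<in> carrier_mat l n1" and r2: "r2 \<in> carrier_mat l n2"
    and ker: "\<And>y x. y \<in> carrier_vec n1 \<Longrightarrow> x \<in> carrier_vec n2 \<Longrightarrow> a *\<^sub>v y + q *\<^sub>v x = 0\<^sub>v m1 \<Longrightarrow>
       e *\<^sub>v x = 0\<^sub>v m2 \<Longrightarrow> r1 *\<^sub>v y + r2 *\<^sub>v x = 0\<^sub>v l"
  obtains s1 s2 where "s1 \<in> carrier_mat l m1" "s2 \<in> carrier_mat l m2" "s1 * a = r1" "s1 * q + s2 * e = r2"
proof -
  let ?M = "four_block_mat a q (0\<^sub>m m2 n1) e"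
  \<comment> \<open>A lower part with no rows turns \<open>four_block_mat\<close> into the single
    block row \<open>(r1, r2)\<close>.\<close>
  let ?R = "four_block_mat r1 r2 (0\<^sub>m 0 n1) (0\<^sub>m 0 n2)"
  have M: "?M \<in> carrier_mat (m1 + m2) (n1 + n2)" using a q e by auto
  have R: "?R \<in> carrier_mat l (n1 + n2)" using r1 r2 by auto
  have "\<exists>S\<in>carrier_mat l (m1 + m2). ?R = S * ?M"
  proof (rule factor_through[OF M R])
    fix v :: "'k vec" assume v: "v \<in> carrier_vec (n1 + n2)" and 0: "?M *\<^sub>v v = 0\<^sub>v (m1 + m2)"
    let ?y = "vec_first v n1" and ?x = "vec_last v n2"
    have yx: "?y \<in> carrier_vec n1" "?x \<in> carrier_vec n2" by auto
    have vv: "v = ?y @\<^sub>v ?x" using v by simp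
    have "?M *\<^sub>v v = (a *\<^sub>v ?y + q *\<^sub>v ?x) @\<^sub>v (0\<^sub>m m2 n1 *\<^sub>v ?y + e *\<^sub>v ?x)"
      by (subst vv, rule four_block_mat_mult_vec[OF a q _ e yx]) simp
    also have "0\<^sub>m m2 n1 *\<^sub>v ?y + e *\<^sub>v ?x = e *\<^sub>v ?x" using e yx by (simp add: zero_mat_mult_vec)
    finally have "(a *\<^sub>v ?y + q *\<^sub>v ?x) @\<^sub>v (e *\<^sub>v ?x) = 0\<^sub>v m1 @\<^sub>v 0\<^sub>v m2"
      using 0 by (metis zero_vec_append)
    then have "a *\<^sub>v ?y + q *\<^sub>v ?x = 0\<^sub>v m1" "e *\<^sub>v ?x = 0\<^sub>v m2"
      using a q yx by (auto simp: append_vec_eq[where n = m1])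
    then have *: "r1 *\<^sub>v ?y + r2 *\<^sub>v ?x = 0\<^sub>v l" using ker yx by blast
    have "?R *\<^sub>v v = (r1 *\<^sub>v ?y + r2 *\<^sub>v ?x) @\<^sub>v (0\<^sub>m 0 n1 *\<^sub>v ?y + 0\<^sub>m 0 n2 *\<^sub>v ?x)"
      by (subst vv, rule four_block_mat_mult_vec[OF r1 r2 zero_carrier_mat zero_carrier_mat yx])
    also have "\<dots> = 0\<^sub>v l" unfolding * by (intro eq_vecI) auto
    finally show "?R *\<^sub>v v = 0\<^sub>v l" .
  qed
  then obtain S where S: "S \<in> carrier_mat l (m1 + m2)" "?R = S * ?M" by blast
  let ?s1 = "mat l m1 (\<lambda>(i, j). S $$ (i, j))"
  let ?s2 = "mat l m2 (\<lambda>(i, j). S $$ (i, m1 + j))"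
  have s: "?s1 \<in> carrier_mat l m1" "?s2 \<in> carrier_mat l m2" by auto
  have row: "?R $$ (i, j) = (\<Sum>k<m1. S $$ (i, k) * ?M $$ (k, j)) + (\<Sum>k<m2. S $$ (i, m1 + k) * ?M $$ (m1 + k, j))"
    if "i < l" "j < n1 + n2" for i j
    unfolding S(2) mult_mat_index[OF S(1) M that] sum_lessThan_add ..
  have "?s1 * a = r1"
  proof (rule eq_matI)
    fix i j assume "i < dim_row r1" "j < dim_col r1"
    then have ij: "i < l" "j < n1" using r1 by auto
    then have "r1 $$ (i, j) = ?R $$ (i, j)" using r1 r2 by simp
    also have "\<dots> = (\<Sum>k<m1. S $$ (i, k) * a $$ (k, j))"
      using row[of i j] ij a q e by simp
    also have "\<dots> = (?s1 * a) $$ (i, j)" using mult_mat_index[OF s(1) a ij] ij by simp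
    finally show "(?s1 * a) $$ (i, j) = r1 $$ (i, j)" by simp
  qed (use a r1 in auto)
  moreover have "?s1 * q + ?s2 * e = r2"
  proof (rule eq_matI)
    fix i j assume "i < dim_row r2" "j < dim_col r2"
    then have ij: "i < l" "j < n2" using r2 by auto
    then have "r2 $$ (i, j) = ?R $$ (i, n1 + j)" using r1 r2 by simp
    also have "\<dots> = (\<Sum>k<m1. S $$ (i, k) * q $$ (k, j)) + (\<Sum>k<m2. S $$ (i, m1 + k) * e $$ (k, j))"
      using row[of i "n1 + j"] ij a q e by simp
    also have "\<dots> = (?s1 * q + ?s2 * e) $$ (i, j)"
      using mult_mat_index[OF s(1) q ij] mult_mat_index[OF s(2) e ij] ij q e by simp
    finally show "(?s1 * q + ?s2 * e) $$ (i, j) = r2 $$ (i, j)" by simp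
  qed (use q e r2 in auto)
  ultimately show ?thesis using that s by blast
qed

lemma sheaf_hom_add:
  assumes F: "sheaf_on X F" and G: "sheaf_on X G" and f: "sheaf_hom X F G \<phi>" and g: "sheaf_hom X F G \<psi>"
  shows "sheaf_hom X F G (\<lambda>\<tau>. \<phi> \<tau> + \<psi> \<tau>)"
  unfolding sheaf_hom_def
proof (intro conjI ballI impI)
  fix \<sigma> assume s: "\<sigma> \<in> X"
  note cs = sheaf_homD(1)[OF f s] sheaf_homD(1)[OF g s]
  show "\<phi> \<sigma> + \<psi> \<sigma> \<in> carrier_mat (sdim G \<sigma>) (sdim F \<sigma>)" using cs by simp
  fix \<tau> assume t: "\<tau> \<in> X" "\<sigma> \<le> \<tau>"
  note ct = sheaf_homD(1)[OF f t(1)] sheaf_homD(1)[OF g t(1)]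
  note r = sheaf_onD(1)[OF F s t] sheaf_onD(1)[OF G s t]
  show "(\<phi> \<tau> + \<psi> \<tau>) * res F \<sigma> \<tau> = res G \<sigma> \<tau> * (\<phi> \<sigma> + \<psi> \<sigma>)"
    unfolding add_mult_distrib_mat[OF ct r(1)] mult_add_distrib_mat[OF r(2) cs]
      sheaf_homD(2)[OF f s t] sheaf_homD(2)[OF g s t] ..
qed

lemma sheaf_hom_minus:
  assumes F: "sheaf_on X F" and G: "sheaf_on X G" and f: "sheaf_hom X F G \<phi>" and g: "sheaf_hom X F G \<psi>"
  shows "sheaf_hom X F G (\<lambda>\<tau>. \<phi> \<tau> - \<psi> \<tau>)"
  unfolding sheaf_hom_def
proof (intro conjI ballI impI)
  fix \<sigma> assume s: "\<sigma> \<in> X"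
  note cs = sheaf_homD(1)[OF f s] sheaf_homD(1)[OF g s]
  show "\<phi> \<sigma> - \<psi> \<sigma> \<in> carrier_mat (sdim G \<sigma>) (sdim F \<sigma>)" using minus_carrier_mat[OF cs(2)] .
  fix \<tau> assume t: "\<tau> \<in> X" "\<sigma> \<le> \<tau>"
  note ct = sheaf_homD(1)[OF f t(1)] sheaf_homD(1)[OF g t(1)]
  note r = sheaf_onD(1)[OF F s t] sheaf_onD(1)[OF G s t]
  show "(\<phi> \<tau> - \<psi> \<tau>) * res F \<sigma> \<tau> = res G \<sigma> \<tau> * (\<phi> \<sigma> - \<psi> \<sigma>)"
    unfolding minus_mult_distrib_mat[OF ct r(1)] mult_minus_distrib_mat[OF r(2) cs]
      sheaf_homD(2)[OF f s t] sheaf_homD(2)[OF g s t] ..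
qed

lemma sheaf_hom_zero:
  assumes F: "sheaf_on X F" and G: "sheaf_on X G"
  shows "sheaf_hom X F G (\<lambda>\<tau>. 0\<^sub>m (sdim G \<tau>) (sdim F \<tau>))"
  unfolding sheaf_hom_def
proof (intro conjI ballI impI)
  fix \<sigma> \<tau> assume "\<sigma> \<in> X" "\<tau> \<in> X" "\<sigma> \<le> \<tau>"
  then show "0\<^sub>m (sdim G \<tau>) (sdim F \<tau>) * res F \<sigma> \<tau> = res G \<sigma> \<tau> * 0\<^sub>m (sdim G \<sigma>) (sdim F \<sigma>)"
    using sheaf_onD(1)[OF F] sheaf_onD(1)[OF G] by (metis left_mult_zero_mat right_mult_zero_mat)
qed simp

text \<open>Extension of a morphism into an injective sheaf along the map
  \<open>(y, x) \<mapsto> (a y + q x, e x)\<close> from \<open>A1 \<oplus> A2\<close> to \<open>B1 \<oplus> B2\<close>.\<close>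

lemma injective_extension:
  fixes A1 A2 B1 B2 :: "('p::order, 'k::field) sheaf"
  assumes sh: "sheaf_on X A1" "sheaf_on X A2" "sheaf_on X B1" "sheaf_on X B2" and bs: "set bs \<subseteq> X"
    and a: "sheaf_hom X A1 B1 a" and q: "sheaf_hom X A2 B1 q" and e: "sheaf_hom X A2 B2 e"
    and r1: "sheaf_hom X A1 (labeled_sum bs) r1" and r2: "sheaf_hom X A2 (labeled_sum bs) r2"
    and ker: "\<And>\<pi> y x. \<pi> \<in> X \<Longrightarrow> y \<in> carrier_vec (sdim A1 \<pi>) \<Longrightarrow> x \<in> carrier_vec (sdim A2 \<pi>) \<Longrightarrow>
       a \<pi> *\<^sub>v y + q \<pi> *\<^sub>v x = 0\<^sub>v (sdim B1 \<pi>) \<Longrightarrow> e \<pi> *\<^sub>v x = 0\<^sub>v (sdim B2 \<pi>) \<Longrightarrow>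
       r1 \<pi> *\<^sub>v y + r2 \<pi> *\<^sub>v x = 0\<^sub>v (sdim (labeled_sum bs :: ('p, 'k) sheaf) \<pi>)"
  obtains s1 s2 where "sheaf_hom X B1 (labeled_sum bs) s1" "sheaf_hom X B2 (labeled_sum bs) s2"
    "\<And>\<pi>. \<pi> \<in> X \<Longrightarrow> s1 \<pi> * a \<pi> = r1 \<pi>" "\<And>\<pi>. \<pi> \<in> X \<Longrightarrow> s1 \<pi> * q \<pi> + s2 \<pi> * e \<pi> = r2 \<pi>"
proof -
  let ?L = "labeled_sum bs :: ('p, 'k) sheaf"
  \<comment> \<open>Solutions exist at each point separately but have no reason to commute with
    restriction. From the solution at \<open>b\<close>, \<open>cohom\<close> keeps the rows of the
    summands labeled \<open>b\<close> and recomputes all others.\<close>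
  have "\<exists>s1 s2. s1 \<in> carrier_mat (sdim ?L \<pi>) (sdim B1 \<pi>) \<and> s2 \<in> carrier_mat (sdim ?L \<pi>) (sdim B2 \<pi>) \<and>
     s1 * a \<pi> = r1 \<pi> \<and> s1 * q \<pi> + s2 * e \<pi> = r2 \<pi>" if p: "\<pi> \<in> X" for \<pi>
  proof -
    obtain s1 s2 where "s1 \<in> carrier_mat (sdim ?L \<pi>) (sdim B1 \<pi>)" "s2 \<in> carrier_mat (sdim ?L \<pi>) (sdim B2 \<pi>)"
      "s1 * a \<pi> = r1 \<pi>" "s1 * q \<pi> + s2 * e \<pi> = r2 \<pi>"
      by (rule factor_through_pair[OF sheaf_homD(1)[OF a p] sheaf_homD(1)[OF q p] sheaf_homD(1)[OF e p]
        sheaf_homD(1)[OF r1 p] sheaf_homD(1)[OF r2 p]]) (use ker[OF p] in auto)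
    then show ?thesis by blast
  qed
  then obtain s1 s2 where
    s: "\<And>\<pi>. \<pi> \<in> X \<Longrightarrow> s1 \<pi> \<in> carrier_mat (card (positions {\<pi>..} bs)) (sdim B1 \<pi>)"
      "\<And>\<pi>. \<pi> \<in> X \<Longrightarrow> s2 \<pi> \<in> carrier_mat (card (positions {\<pi>..} bs)) (sdim B2 \<pi>)"
    and eq: "\<And>\<pi>. \<pi> \<in> X \<Longrightarrow> s1 \<pi> * a \<pi> = r1 \<pi>" "\<And>\<pi>. \<pi> \<in> X \<Longrightarrow> s1 \<pi> * q \<pi> + s2 \<pi> * e \<pi> = r2 \<pi>"
    unfolding sdim_labeled_sum by metis
  let ?c1 = "cohom B1 bs s1" and ?c2 = "cohom B2 bs s2"
  have c1: "sheaf_hom X B1 ?L ?c1" by (rule sheaf_hom_cohom[OF sh(3) bs s(1)])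
  have c2: "sheaf_hom X B2 ?L ?c2" by (rule sheaf_hom_cohom[OF sh(4) bs s(2)])
  \<comment> \<open>By \<open>hom_row\<close> a homomorphism into a labeled sum is determined by
    these rows. The two equations therefore have to be checked only where \<open>cohom\<close>
    agrees with the stalkwise solution.\<close>
  have rowhom: "\<phi> \<tau> = \<psi> \<tau>"
    if \<phi>: "sheaf_hom X F ?L \<phi>" and \<psi>: "sheaf_hom X F ?L \<psi>" and t: "\<tau> \<in> X" and F: "sheaf_on X F"
    and rows: "\<And>j. j < length bs \<Longrightarrow> row (\<phi> (bs ! j)) (idx {bs ! j..} bs j) = row (\<psi> (bs ! j)) (idx {bs ! j..} bs j)"
    for \<phi> \<psi> \<tau> and F :: "('p, 'k) sheaf"
  proof (rule eq_matI)
    fix k l assume "k < dim_row (\<psi> \<tau>)" "l < dim_col (\<psi> \<tau>)"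
    then have kl: "k < card (positions {\<tau>..} bs)" "l < sdim F \<tau>" using sheaf_homD(1)[OF \<psi> t] by auto
    let ?j = "pick (positions {\<tau>..} bs) k"
    have j: "?j < length bs" "\<tau> \<le> bs ! ?j" "bs ! ?j \<in> X"
      using pick_positions[OF kl(1)] bs by (auto simp: subset_iff)
    have i: "idx {bs ! ?j..} bs ?j < card (positions {bs ! ?j..} bs)" using j by (intro idx_less) auto
    note R = sheaf_onD(1)[OF F t j(3,2)]
    have "(\<phi> (bs ! ?j) * res F \<tau> (bs ! ?j)) $$ (idx {bs ! ?j..} bs ?j, l) =
      row (\<phi> (bs ! ?j)) (idx {bs ! ?j..} bs ?j) \<bullet> col (res F \<tau> (bs ! ?j)) l"
      using sheaf_homD(1)[OF \<phi> j(3)] R i kl by simp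
    also have "\<dots> = (\<psi> (bs ! ?j) * res F \<tau> (bs ! ?j)) $$ (idx {bs ! ?j..} bs ?j, l)"
      unfolding rows[OF j(1)] using sheaf_homD(1)[OF \<psi> j(3)] R i kl by simp
    finally show "\<phi> \<tau> $$ (k, l) = \<psi> \<tau> $$ (k, l)"
      unfolding hom_row[OF \<phi> t bs kl] hom_row[OF \<psi> t bs kl] .
  qed (use sheaf_homD(1)[OF \<phi> t] sheaf_homD(1)[OF \<psi> t] in auto)
  have row_mult: "row (A * B) i = row (A' * B) i" if "row A i = row A' i" "i < n" "A \<in> carrier_mat n m"
    "A' \<in> carrier_mat n m" "B \<in> carrier_mat m l" for A A' B :: "'k mat" and i n m l
    using that by (intro eq_vecI) auto
  have lab: "bs ! j \<in> X" "idx {bs ! j..} bs j < card (positions {bs ! j..} bs)" if "j < length bs" for j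
    using that bs by (auto intro: idx_less)
  have "?c1 \<pi> * a \<pi> = r1 \<pi>" if p: "\<pi> \<in> X" for \<pi>
  proof (rule rowhom[OF sheaf_hom_comp[OF sh(1,3) sheaf_on_labeled_sum a c1] r1 p sh(1)])
    fix j assume j: "j < length bs"
    let ?b = "bs ! j"
    have "row (?c1 ?b * a ?b) (idx {?b..} bs j) = row (s1 ?b * a ?b) (idx {?b..} bs j)"
      using cohom_label[where s = s1, OF sh(3) lab(1)[OF j] s(1)[OF lab(1)[OF j]] j refl]
        sheaf_homD(1)[OF c1 lab(1)[OF j]] s(1)[OF lab(1)[OF j]] sheaf_homD(1)[OF a lab(1)[OF j]] lab(2)[OF j]
      by (intro row_mult) auto
    then show "row (?c1 ?b * a ?b) (idx {?b..} bs j) = row (r1 ?b) (idx {?b..} bs j)"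
      using eq(1)[OF lab(1)[OF j]] by simp
  qed
  moreover have "?c1 \<pi> * q \<pi> + ?c2 \<pi> * e \<pi> = r2 \<pi>" if p: "\<pi> \<in> X" for \<pi>
  proof (rule rowhom[OF sheaf_hom_add[OF sh(2) sheaf_on_labeled_sum
        sheaf_hom_comp[OF sh(2,3) sheaf_on_labeled_sum q c1]
        sheaf_hom_comp[OF sh(2,4) sheaf_on_labeled_sum e c2]] r2 p sh(2)])
    fix j assume j: "j < length bs"
    let ?b = "bs ! j"
    note b = lab(1)[OF j]
    note c = sheaf_homD(1)[OF c1 b] sheaf_homD(1)[OF c2 b] s(1)[OF b] s(2)[OF b] sheaf_homD(1)[OF q b] sheaf_homD(1)[OF e b]
    have "row (?c1 ?b * q ?b) (idx {?b..} bs j) = row (s1 ?b * q ?b) (idx {?b..} bs j)"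
      using cohom_label[where s = s1, OF sh(3) b s(1)[OF b] j refl] c lab(2)[OF j] by (intro row_mult) auto
    moreover have "row (?c2 ?b * e ?b) (idx {?b..} bs j) = row (s2 ?b * e ?b) (idx {?b..} bs j)"
      using cohom_label[where s = s2, OF sh(4) b s(2)[OF b] j refl] c lab(2)[OF j] by (intro row_mult) auto
    ultimately have "row (?c1 ?b * q ?b + ?c2 ?b * e ?b) (idx {?b..} bs j) =
        row (s1 ?b * q ?b + s2 ?b * e ?b) (idx {?b..} bs j)"
      using c lab(2)[OF j] by simp
    then show "row (?c1 ?b * q ?b + ?c2 ?b * e ?b) (idx {?b..} bs j) = row (r2 ?b) (idx {?b..} bs j)"
      using eq(2)[OF b] by simp
  qed
  ultimately show ?thesis using that c1 c2 by blast
qed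

text \<open>Targets of liftings: the objects are literally labeled sums, whereas
  \<open>injective_complex\<close> provides this only up to isomorphism in each degree.\<close>

definition labeled_complex_on :: "'p::order set \<Rightarrow> (int \<Rightarrow> 'p list) \<Rightarrow> ('p, 'k::field) sheaf_complex \<Rightarrow> bool" where
  "labeled_complex_on X Ls J \<longleftrightarrow> bounded_complex X J \<and> (\<forall>d. obj J d = labeled_sum (Ls d)) \<and> (\<forall>d. set (Ls d) \<subseteq> X)"

lemma labeled_complex_onD:
  assumes "labeled_complex_on X Ls J"
  shows "bounded_complex X J" "obj J d = labeled_sum (Ls d)" "set (Ls d) \<subseteq> X"
  using assms unfolding labeled_complex_on_def by blast+

lemma mat_no_cols: "A \<in> carrier_mat m 0 \<Longrightarrow> B \<in> carrier_mat m 0 \<Longrightarrow> A = B"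
  by (intro eq_matI) auto

text \<open>The mapping cone of a quasi-isomorphism is exact: \<open>(y, x)\<close> is a cycle of it
  and, up to sign, \<open>(y', x')\<close> bounds it. The image of \<open>x\<close> under
  \<open>q\<close> is a boundary, so \<open>x = d x''\<close>. Then \<open>y + q x''\<close> is a
  cycle, hence homologous to \<open>q v\<close> for a cycle \<open>v\<close>, and
  \<open>x'' - v\<close> is the corrected choice.\<close>

lemma quasi_iso_kernel:
  assumes C: "bounded_complex X C" and C': "bounded_complex X C'"
    and q: "chain_map X C C' q" and bq: "bijective_on_cohomology X C C' q"
    and p: "\<pi> \<in> X" and y: "y \<in> stalk C' d \<pi>" and x: "x \<in> stalk C (d + 1) \<pi>"
    and dy: "diff C' d \<pi> *\<^sub>v y + q (d + 1) \<pi> *\<^sub>v x = 0\<^sub>v (sdim (obj C' (d + 1)) \<pi>)"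
    and dx: "diff C (d + 1) \<pi> *\<^sub>v x = 0\<^sub>v (sdim (obj C (d + 2)) \<pi>)"
  obtains x' y' where "x' \<in> stalk C d \<pi>" "y' \<in> stalk C' (d - 1) \<pi>" "x = diff C d \<pi> *\<^sub>v x'"
    "y = diff C' (d - 1) \<pi> *\<^sub>v y' - q d \<pi> *\<^sub>v x'"
proof -
  note cd = diff_carrier[OF C p, of d] and cd' = diff_carrier[OF C' p, of d]
  note cq = chain_mapD(2)[OF q p, of d] and cq1 = chain_mapD(2)[OF q p, of "d + 1"]
  have "q (d + 1) \<pi> *\<^sub>v x = diff C' d \<pi> *\<^sub>v (- y)"
  proof (rule eq_vecI)
    fix i assume "i < dim_vec (diff C' d \<pi> *\<^sub>v - y)"
    then have i: "i < sdim (obj C' (d + 1)) \<pi>" using cd' by auto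
    have "(diff C' d \<pi> *\<^sub>v y + q (d + 1) \<pi> *\<^sub>v x) $ i = 0" unfolding dy using i by simp
    then show "(q (d + 1) \<pi> *\<^sub>v x) $ i = (diff C' d \<pi> *\<^sub>v - y) $ i"
      using i cd' cq1 y x by (simp add: add_eq_0_iff)
  qed (use cd' cq1 in auto)
  then have "is_boundary C' (d + 1) \<pi> (q (d + 1) \<pi> *\<^sub>v x)"
    using y unfolding is_boundary_def by (intro bexI[of _ "- y"]) auto
  moreover have "is_cycle C (d + 1) \<pi> x" using x dx unfolding is_cycle_def by (simp add: add.assoc)
  ultimately have "is_boundary C (d + 1) \<pi> x" using bq p unfolding bijective_on_cohomology_def by blast
  then obtain x'' where x'': "x'' \<in> stalk C d \<pi>" "x = diff C d \<pi> *\<^sub>v x''"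
    unfolding is_boundary_def by auto
  have qx: "q (d + 1) \<pi> *\<^sub>v x = diff C' d \<pi> *\<^sub>v (q d \<pi> *\<^sub>v x'')"
    unfolding x''(2) by (rule chain_map_vec(1)[OF C C' q p x''(1)])
  have "is_cycle C' d \<pi> (y + q d \<pi> *\<^sub>v x'')"
    unfolding is_cycle_def using dy qx y x'' cq cd' by (simp add: mult_add_distrib_mat_vec[OF cd'(1)])
  then obtain v b where v: "is_cycle C d \<pi> v" "is_boundary C' d \<pi> b" "y + q d \<pi> *\<^sub>v x'' = q d \<pi> *\<^sub>v v + b"
    using bq p unfolding bijective_on_cohomology_def by blast
  obtain y' where y': "y' \<in> stalk C' (d - 1) \<pi>" "b = diff C' (d - 1) \<pi> *\<^sub>v y'"
    using v(2) unfolding is_boundary_def by blast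
  have vc: "v \<in> stalk C d \<pi>" "diff C d \<pi> *\<^sub>v v = 0\<^sub>v (sdim (obj C (d + 1)) \<pi>)"
    using v(1) unfolding is_cycle_def by auto
  have bc: "b \<in> stalk C' d \<pi>" using y' cd' by simp
  show thesis
  proof
    show "x'' - v \<in> stalk C d \<pi>" using x'' vc by simp
    show "x = diff C d \<pi> *\<^sub>v (x'' - v)"
      using x'' vc cd by (simp add: mult_minus_distrib_mat_vec[OF cd(1)])
    show "y = diff C' (d - 1) \<pi> *\<^sub>v y' - q d \<pi> *\<^sub>v (x'' - v)"
    proof (rule eq_vecI)
      fix i assume "i < dim_vec (diff C' (d - 1) \<pi> *\<^sub>v y' - q d \<pi> *\<^sub>v (x'' - v))"
      then have i: "i < sdim (obj C' d) \<pi>" using cq by auto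
      have "(y + q d \<pi> *\<^sub>v x'') $ i = (q d \<pi> *\<^sub>v v + b) $ i" using v(3) by simp
      then have "y $ i + (q d \<pi> *\<^sub>v x'') $ i = (q d \<pi> *\<^sub>v v) $ i + b $ i"
        using i y cq x'' vc bc by simp
      then show "y $ i = (diff C' (d - 1) \<pi> *\<^sub>v y' - q d \<pi> *\<^sub>v (x'' - v)) $ i"
        using i y cq x'' vc bc y'(2)[symmetric]
        by (simp add: mult_minus_distrib_mat_vec[OF cq x''(1) vc(1)] del: index_mult_mat_vec) (simp add: algebra_simps)
    qed (use y cq in auto)
    show "y' \<in> stalk C' (d - 1) \<pi>" by fact
  qed
qed

text \<open>The new pair has to become a prescribed map when composed with the cone differential
  \<open>(y, x) \<mapsto> (d y + q x, d x)\<close>. Into a labeled sum this extension exists if the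
  prescribed map kills the kernel. By \<open>quasi_iso_kernel\<close> the kernel comes from the
  preceding degree, and there \<open>dFd\<close> and \<open>dFq\<close> give zero.\<close>

lemma lift_step:
  fixes J :: "('p::order, 'k::field) sheaf_complex"
  assumes C: "bounded_complex X C" and C': "bounded_complex X C'" and J: "labeled_complex_on X Ls J"
    and q: "chain_map X C C' q" and bq: "bijective_on_cohomology X C C' q" and f: "chain_map X C J f"
    and F: "sheaf_hom X (obj C' d) (obj J d) F" and H: "sheaf_hom X (obj C (d + 1)) (obj J d) H"
    and dFd: "\<And>\<pi> y. \<pi> \<in> X \<Longrightarrow> y \<in> stalk C' (d - 1) \<pi> \<Longrightarrow>
       diff J d \<pi> *\<^sub>v (F \<pi> *\<^sub>v (diff C' (d - 1) \<pi> *\<^sub>v y)) = 0\<^sub>v (sdim (obj J (d + 1)) \<pi>)"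
    and dFq: "\<And>\<pi> x. \<pi> \<in> X \<Longrightarrow> x \<in> stalk C d \<pi> \<Longrightarrow>
       diff J d \<pi> *\<^sub>v (F \<pi> *\<^sub>v (q d \<pi> *\<^sub>v x)) + diff J d \<pi> *\<^sub>v (H \<pi> *\<^sub>v (diff C d \<pi> *\<^sub>v x)) = diff J d \<pi> *\<^sub>v (f d \<pi> *\<^sub>v x)"
  obtains F' H' where "sheaf_hom X (obj C' (d + 1)) (obj J (d + 1)) F'" "sheaf_hom X (obj C (d + 2)) (obj J (d + 1)) H'"
    "\<And>\<pi>. \<pi> \<in> X \<Longrightarrow> F' \<pi> * diff C' d \<pi> = diff J d \<pi> * F \<pi>"
    "\<And>\<pi>. \<pi> \<in> X \<Longrightarrow> F' \<pi> * q (d + 1) \<pi> + H' \<pi> * diff C (d + 1) \<pi> = f (d + 1) \<pi> - diff J d \<pi> * H \<pi>"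
proof -
  note Jb = labeled_complex_onD(1)[OF J] and Jo = labeled_complex_onD(2)[OF J]
  have dC1: "sheaf_hom X (obj C (d + 1)) (obj C (d + 2)) (diff C (d + 1))"
    using bounded_complexD(2)[OF C, of "d + 1"] by (simp add: add.assoc)
  have r1: "sheaf_hom X (obj C' d) (obj J (d + 1)) (\<lambda>\<pi>. diff J d \<pi> * F \<pi>)"
    by (rule sheaf_hom_comp[OF bounded_complexD(1)[OF C'] bounded_complexD(1)[OF Jb] bounded_complexD(1)[OF Jb]
          F bounded_complexD(2)[OF Jb]])
  have r2: "sheaf_hom X (obj C (d + 1)) (obj J (d + 1)) (\<lambda>\<pi>. f (d + 1) \<pi> - diff J d \<pi> * H \<pi>)"
    by (rule sheaf_hom_minus[OF bounded_complexD(1)[OF C] bounded_complexD(1)[OF Jb] chain_mapD(1)[OF f]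
        sheaf_hom_comp[OF bounded_complexD(1)[OF C] bounded_complexD(1)[OF Jb] bounded_complexD(1)[OF Jb]
          H bounded_complexD(2)[OF Jb]]])
  have ker: "(diff J d \<pi> * F \<pi>) *\<^sub>v y + (f (d + 1) \<pi> - diff J d \<pi> * H \<pi>) *\<^sub>v x = 0\<^sub>v (sdim (obj J (d + 1)) \<pi>)"
    if p: "\<pi> \<in> X" and y: "y \<in> stalk C' d \<pi>" and x: "x \<in> stalk C (d + 1) \<pi>"
      and dy: "diff C' d \<pi> *\<^sub>v y + q (d + 1) \<pi> *\<^sub>v x = 0\<^sub>v (sdim (obj C' (d + 1)) \<pi>)"
      and dx: "diff C (d + 1) \<pi> *\<^sub>v x = 0\<^sub>v (sdim (obj C (d + 2)) \<pi>)" for \<pi> y x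
  proof -
    obtain x' y' where x': "x' \<in> stalk C d \<pi>" and y': "y' \<in> stalk C' (d - 1) \<pi>" and xe: "x = diff C d \<pi> *\<^sub>v x'"
      and ye: "y = diff C' (d - 1) \<pi> *\<^sub>v y' - q d \<pi> *\<^sub>v x'"
      by (rule quasi_iso_kernel[OF C C' q bq p y x dy dx])
    note cJ = diff_carrier(1)[OF Jb p, of d] and cC' = diff_carrier(2)[OF C' p, of d]
    note cF = sheaf_homD(1)[OF F p] and cH = sheaf_homD(1)[OF H p]
    note cf = chain_mapD(2)[OF f p, of "d + 1"] and cq = chain_mapD(2)[OF q p, of d]
    let ?A = "diff J d \<pi> *\<^sub>v (F \<pi> *\<^sub>v (q d \<pi> *\<^sub>v x'))"
    let ?B = "diff J d \<pi> *\<^sub>v (H \<pi> *\<^sub>v x)"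
    let ?n = "sdim (obj J (d + 1)) \<pi>"
    have A: "?A \<in> carrier_vec ?n" and B: "?B \<in> carrier_vec ?n"
      by (rule mult_mat_vec_carrier[OF cJ mult_mat_vec_carrier[OF cF mult_mat_vec_carrier[OF cq x']]])
        (rule mult_mat_vec_carrier[OF cJ mult_mat_vec_carrier[OF cH x]])
    have "(diff J d \<pi> * F \<pi>) *\<^sub>v y = diff J d \<pi> *\<^sub>v (F \<pi> *\<^sub>v y)"
      using y cJ cF by simp
    also have "\<dots> = diff J d \<pi> *\<^sub>v (F \<pi> *\<^sub>v (diff C' (d - 1) \<pi> *\<^sub>v y')) - ?A"
      unfolding ye using cC' y' cq x' cF cJ
      by (simp add: mult_minus_distrib_mat_vec[OF cF] mult_minus_distrib_mat_vec[OF cJ])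
    also have "\<dots> = 0\<^sub>v ?n - ?A" using dFd[OF p y'] by simp
    finally have 1: "(diff J d \<pi> * F \<pi>) *\<^sub>v y = 0\<^sub>v ?n - ?A" .
    have "(f (d + 1) \<pi> - diff J d \<pi> * H \<pi>) *\<^sub>v x = f (d + 1) \<pi> *\<^sub>v x - (diff J d \<pi> * H \<pi>) *\<^sub>v x"
      using cf cH cJ x by (intro minus_mult_distrib_mat_vec) auto
    also have "(diff J d \<pi> * H \<pi>) *\<^sub>v x = ?B" using cJ cH x by simp
    also have "f (d + 1) \<pi> *\<^sub>v x = ?A + ?B"
      using chain_map_vec(1)[OF C Jb f p x'] dFq[OF p x'] unfolding xe by simp
    finally have 2: "(f (d + 1) \<pi> - diff J d \<pi> * H \<pi>) *\<^sub>v x = (?A + ?B) - ?B" .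
    have z: "(0\<^sub>v n - a) + ((a + b) - b) = 0\<^sub>v n" if "a \<in> carrier_vec n" "b \<in> carrier_vec n" for a b :: "'k vec" and n
      using that by (intro eq_vecI) auto
    show ?thesis unfolding 1 2 by (rule z[OF A B])
  qed
  show thesis
    using injective_extension[OF bounded_complexD(1)[OF C', of d] bounded_complexD(1)[OF C, of "d + 1"]
        bounded_complexD(1)[OF C', of "d + 1"] bounded_complexD(1)[OF C, of "d + 2"]
        labeled_complex_onD(3)[OF J, of "d + 1"] bounded_complexD(2)[OF C', of d] chain_mapD(1)[OF q, of "d + 1"] dC1
        r1[unfolded Jo[of "d + 1"]] r2[unfolded Jo[of "d + 1"]] ker[unfolded Jo[of "d + 1"]]] that
    unfolding Jo[of "d + 1"] by blast
qed

lemma lift_along_quasi_iso: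
  fixes J :: "('p::order, 'k::field) sheaf_complex"
  assumes C: "bounded_complex X C" and C': "bounded_complex X C'" and J: "labeled_complex_on X Ls J"
    and q: "chain_map X C C' q" and bq: "bijective_on_cohomology X C C' q" and f: "chain_map X C J f"
  obtains f' h where "chain_map X C' J f'" "homotopic X C J f (\<lambda>d \<pi>. f' d \<pi> * q d \<pi>) h"
proof -
  note Jb = labeled_complex_onD(1)[OF J] and shJ = bounded_complexD(1)[OF labeled_complex_onD(1)[OF J]]
  note shC = bounded_complexD(1)[OF C] and shC' = bounded_complexD(1)[OF C']
  obtain a1 b1 where a1: "\<forall>d. d < a1 \<or> b1 < d \<longrightarrow> (\<forall>\<pi>\<in>X. sdim (obj C d) \<pi> = 0)"
    using bounded_complexD(4)[OF C] by blast
  obtain a2 b2 where a2: "\<forall>d. d < a2 \<or> b2 < d \<longrightarrow> (\<forall>\<pi>\<in>X. sdim (obj C' d) \<pi> = 0)"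
    using bounded_complexD(4)[OF C'] by blast
  \<comment> \<open>Both complexes vanish up to and including degree \<open>a\<close>, so the
    construction can start with zero maps. The bounds \<open>a1\<close> and \<open>a2\<close> are
    strict, hence the \<open>- 1\<close>.\<close>
  define a where "a = min a1 a2 - 1"
  have zC: "sdim (obj C d) \<pi> = 0" if "d \<le> a" "\<pi> \<in> X" for d \<pi> using a1 that by (simp add: a_def)
  have zC': "sdim (obj C' d) \<pi> = 0" if "d \<le> a" "\<pi> \<in> X" for d \<pi> using a2 that by (simp add: a_def)
  \<comment> \<open>A state in degree \<open>d\<close> is a pair: the lift in degree
    \<open>d\<close>, and the homotopy that starts at degree \<open>d + 1\<close> of
    \<open>C\<close>. \<open>P\<close> is the invariant from which \<open>lift_step\<close>
    continues, and \<open>Q\<close> collects the equations it yields between consecutive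
    states.\<close>
  define P where "P d S \<longleftrightarrow> sheaf_hom X (obj C' d) (obj J d) (fst S) \<and> sheaf_hom X (obj C (d + 1)) (obj J d) (snd S) \<and>
     (\<forall>\<pi>\<in>X. (\<forall>y\<in>stalk C' (d - 1) \<pi>. diff J d \<pi> *\<^sub>v (fst S \<pi> *\<^sub>v (diff C' (d - 1) \<pi> *\<^sub>v y)) = 0\<^sub>v (sdim (obj J (d + 1)) \<pi>)) \<and>
      (\<forall>x\<in>stalk C d \<pi>. diff J d \<pi> *\<^sub>v (fst S \<pi> *\<^sub>v (q d \<pi> *\<^sub>v x)) + diff J d \<pi> *\<^sub>v (snd S \<pi> *\<^sub>v (diff C d \<pi> *\<^sub>v x)) = diff J d \<pi> *\<^sub>v (f d \<pi> *\<^sub>v x)))"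
    for d :: int and S :: "('p \<Rightarrow> 'k mat) \<times> ('p \<Rightarrow> 'k mat)"
  define Q where "Q d S S' \<longleftrightarrow> (\<forall>\<pi>\<in>X. fst S' \<pi> * diff C' d \<pi> = diff J d \<pi> * fst S \<pi> \<and>
     fst S' \<pi> * q (d + 1) \<pi> + snd S' \<pi> * diff C (d + 1) \<pi> = f (d + 1) \<pi> - diff J d \<pi> * snd S \<pi>)"
    for d :: int and S S' :: "('p \<Rightarrow> 'k mat) \<times> ('p \<Rightarrow> 'k mat)"
  define z1 where "z1 d = (\<lambda>\<pi>. 0\<^sub>m (sdim (obj J d) \<pi>) (sdim (obj C' d) \<pi>) :: 'k mat)" for d
  define z2 where "z2 d = (\<lambda>\<pi>. 0\<^sub>m (sdim (obj J d) \<pi>) (sdim (obj C (d + 1)) \<pi>) :: 'k mat)" for d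
  have z1: "sheaf_hom X (obj C' d) (obj J d) (z1 d)" for d unfolding z1_def by (rule sheaf_hom_zero[OF shC' shJ])
  have z2: "sheaf_hom X (obj C (d + 1)) (obj J d) (z2 d)" for d unfolding z2_def by (rule sheaf_hom_zero[OF shC shJ])
  have P0: "P a (z1 a, z2 a)"
    unfolding P_def fst_conv snd_conv
  proof (intro conjI ballI z1 z2)
    fix \<pi> assume p: "\<pi> \<in> X"
    note cJ = diff_carrier(1)[OF Jb p, of a] and cC' = diff_carrier(2)[OF C' p, of a] and cC = diff_carrier(1)[OF C p, of a]
    note cq = chain_mapD(2)[OF q p, of a] and cf = chain_mapD(2)[OF f p, of a]
    show "diff J a \<pi> *\<^sub>v (z1 a \<pi> *\<^sub>v (diff C' (a - 1) \<pi> *\<^sub>v y)) = 0\<^sub>v (sdim (obj J (a + 1)) \<pi>)"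
      if y: "y \<in> stalk C' (a - 1) \<pi>" for y
      using mult_mat_vec_carrier[OF cC' y] unfolding z1_def by (simp add: zero_mat_mult_vec mult_mat_zero_vec[OF cJ])
    show "diff J a \<pi> *\<^sub>v (z1 a \<pi> *\<^sub>v (q a \<pi> *\<^sub>v x)) + diff J a \<pi> *\<^sub>v (z2 a \<pi> *\<^sub>v (diff C a \<pi> *\<^sub>v x)) = diff J a \<pi> *\<^sub>v (f a \<pi> *\<^sub>v x)"
      if x: "x \<in> stalk C a \<pi>" for x
    proof -
      have "x = 0\<^sub>v (sdim (obj C a) \<pi>)" using x zC[of a \<pi>] p by (intro eq_vecI) auto
      then have "f a \<pi> *\<^sub>v x = 0\<^sub>v (sdim (obj J a) \<pi>)" by (simp add: mult_mat_zero_vec[OF cf])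
      then show ?thesis
        using mult_mat_vec_carrier[OF cq x] mult_mat_vec_carrier[OF cC x]
        unfolding z1_def z2_def by (simp add: zero_mat_mult_vec mult_mat_zero_vec[OF cJ])
    qed
  qed
  have step: "\<exists>S'. P (d + 1) S' \<and> Q d S S'" if S: "P d S" for d S
  proof -
    obtain F' H' where F': "sheaf_hom X (obj C' (d + 1)) (obj J (d + 1)) F'" and H': "sheaf_hom X (obj C (d + 2)) (obj J (d + 1)) H'"
      and e1: "\<And>\<pi>. \<pi> \<in> X \<Longrightarrow> F' \<pi> * diff C' d \<pi> = diff J d \<pi> * fst S \<pi>"
      and e2: "\<And>\<pi>. \<pi> \<in> X \<Longrightarrow> F' \<pi> * q (d + 1) \<pi> + H' \<pi> * diff C (d + 1) \<pi> = f (d + 1) \<pi> - diff J d \<pi> * snd S \<pi>"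
      by (rule lift_step[OF C C' J q bq f, of d "fst S" "snd S"]) (use S in \<open>auto simp: P_def\<close>)
    \<comment> \<open>The next differential of \<open>J\<close> is applied to both equations of
      \<open>lift_step\<close>. Terms with two consecutive differentials vanish, and the invariant
      one degree higher remains.\<close>
    have "P (d + 1) (F', H')"
      unfolding P_def fst_conv snd_conv
    proof (intro conjI ballI)
      show "sheaf_hom X (obj C' (d + 1)) (obj J (d + 1)) F'" by fact
      show "sheaf_hom X (obj C (d + 1 + 1)) (obj J (d + 1)) H'" using H' by (simp add: add.assoc)
      fix \<pi> assume p: "\<pi> \<in> X"
      have F: "sheaf_hom X (obj C' d) (obj J d) (fst S)" and H: "sheaf_hom X (obj C (d + 1)) (obj J d) (snd S)"
        using S unfolding P_def by auto
      note cJ = diff_carrier[OF Jb p, of d] and cC' = diff_carrier[OF C' p, of d] and cC = diff_carrier[OF C p, of d]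
      note cF = sheaf_homD(1)[OF F p] and cH = sheaf_homD(1)[OF H p] and cF' = sheaf_homD(1)[OF F' p] and cH' = sheaf_homD(1)[OF H' p]
      note cq = chain_mapD(2)[OF q p, of "d + 1"] and cf = chain_mapD(2)[OF f p, of "d + 1"]
      show "diff J (d + 1) \<pi> *\<^sub>v (F' \<pi> *\<^sub>v (diff C' (d + 1 - 1) \<pi> *\<^sub>v y)) = 0\<^sub>v (sdim (obj J (d + 1 + 1)) \<pi>)"
        if y: "y \<in> stalk C' (d + 1 - 1) \<pi>" for y
      proof -
        have y': "y \<in> stalk C' d \<pi>" using y by simp
        have "F' \<pi> *\<^sub>v (diff C' d \<pi> *\<^sub>v y) = diff J d \<pi> *\<^sub>v (fst S \<pi> *\<^sub>v y)"
          by (rule mult_eq_mult_vec[OF e1[OF p] cF' cC'(1) cJ(1) cF y'])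
        then show ?thesis using diff_diff(1)[OF Jb p mult_mat_vec_carrier[OF cF y']] by (simp add: add.assoc)
      qed
      show "diff J (d + 1) \<pi> *\<^sub>v (F' \<pi> *\<^sub>v (q (d + 1) \<pi> *\<^sub>v x)) + diff J (d + 1) \<pi> *\<^sub>v (H' \<pi> *\<^sub>v (diff C (d + 1) \<pi> *\<^sub>v x)) =
         diff J (d + 1) \<pi> *\<^sub>v (f (d + 1) \<pi> *\<^sub>v x)" if x: "x \<in> stalk C (d + 1) \<pi>" for x
      proof -
        let ?n = "sdim (obj J (d + 2)) \<pi>"
        have "diff J (d + 1) \<pi> *\<^sub>v (F' \<pi> *\<^sub>v (q (d + 1) \<pi> *\<^sub>v x)) + diff J (d + 1) \<pi> *\<^sub>v (H' \<pi> *\<^sub>v (diff C (d + 1) \<pi> *\<^sub>v x)) =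
          diff J (d + 1) \<pi> *\<^sub>v (F' \<pi> *\<^sub>v (q (d + 1) \<pi> *\<^sub>v x) + H' \<pi> *\<^sub>v (diff C (d + 1) \<pi> *\<^sub>v x))"
          using mult_mat_vec_carrier[OF cF' mult_mat_vec_carrier[OF cq x]]
             mult_mat_vec_carrier[OF cH' mult_mat_vec_carrier[OF cC(3) x]]
          by (rule mult_add_distrib_mat_vec[OF cJ(3), symmetric])
        also have "F' \<pi> *\<^sub>v (q (d + 1) \<pi> *\<^sub>v x) + H' \<pi> *\<^sub>v (diff C (d + 1) \<pi> *\<^sub>v x) =
           (F' \<pi> * q (d + 1) \<pi> + H' \<pi> * diff C (d + 1) \<pi>) *\<^sub>v x"
          by (simp add: add_mult_distrib_mat_vec[OF mult_carrier_mat[OF cF' cq] mult_carrier_mat[OF cH' cC(3)] x]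
              assoc_mult_mat_vec[OF cF' cq x] assoc_mult_mat_vec[OF cH' cC(3) x])
        also have "\<dots> = f (d + 1) \<pi> *\<^sub>v x - diff J d \<pi> *\<^sub>v (snd S \<pi> *\<^sub>v x)"
          unfolding e2[OF p] by (simp add: minus_mult_distrib_mat_vec[OF cf mult_carrier_mat[OF cJ(1) cH] x]
              assoc_mult_mat_vec[OF cJ(1) cH x])
        also have "diff J (d + 1) \<pi> *\<^sub>v \<dots> = diff J (d + 1) \<pi> *\<^sub>v (f (d + 1) \<pi> *\<^sub>v x) -
           diff J (d + 1) \<pi> *\<^sub>v (diff J d \<pi> *\<^sub>v (snd S \<pi> *\<^sub>v x))"
          using mult_mat_vec_carrier[OF cf x] mult_mat_vec_carrier[OF cJ(1) mult_mat_vec_carrier[OF cH x]]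
          by (rule mult_minus_distrib_mat_vec[OF cJ(3)])
        also have "\<dots> = diff J (d + 1) \<pi> *\<^sub>v (f (d + 1) \<pi> *\<^sub>v x)"
          unfolding diff_diff(1)[OF Jb p mult_mat_vec_carrier[OF cH x]]
          using mult_mat_vec_carrier[OF cJ(3) mult_mat_vec_carrier[OF cf x]] by simp
        finally show ?thesis .
      qed
    qed
    then show ?thesis using e1 e2 by (intro exI[of _ "(F', H')"]) (simp add: Q_def)
  qed
  obtain s where s: "\<And>n. P (a + int n) (s n)" "\<And>n. Q (a + int n) (s n) (s (Suc n))"
  proof -
    have "\<exists>s. \<forall>n. P (a + int n) (s n) \<and> Q (a + int n) (s n) (s (Suc n))"
    proof (rule dependent_nat_choice)
      show "\<exists>S. P (a + int 0) S" using P0 by (intro exI) simp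
      fix S n assume "P (a + int n) S"
      then show "\<exists>S'. P (a + int (Suc n)) S' \<and> Q (a + int n) S S'" using step[of "a + int n" S] by (simp add: add_ac)
    qed
    then show ?thesis using that by blast
  qed
  define f' where "f' d = (if d < a then z1 d else fst (s (nat (d - a))))" for d
  define H where "H d = (if d < a then z2 d else snd (s (nat (d - a))))" for d
  have f'h: "sheaf_hom X (obj C' d) (obj J d) (f' d)" and Hh: "sheaf_hom X (obj C (d + 1)) (obj J d) (H d)" for d
    using z1[of d] z2[of d] s(1)[of "nat (d - a)"] by (auto simp: f'_def H_def P_def)
  have Qd: "Q d (f' d, H d) (f' (d + 1), H (d + 1))" if "a \<le> d" for d
  proof -
    have "nat (d + 1 - a) = Suc (nat (d - a))" using that by simp
    then show ?thesis using s(2)[of "nat (d - a)"] that by (simp add: f'_def H_def)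
  qed
  have "chain_map X C' J f'"
    unfolding chain_map_def
  proof (intro conjI allI ballI f'h)
    fix d \<pi> assume p: "\<pi> \<in> X"
    show "f' (d + 1) \<pi> * diff C' d \<pi> = diff J d \<pi> * f' d \<pi>"
    proof (cases "a \<le> d")
      case True
      then show ?thesis using Qd[OF True] p by (simp add: Q_def)
    next
      case False
      have "sdim (obj C' d) \<pi> = 0" using False p by (intro zC') auto
      then show ?thesis
        using mult_carrier_mat[OF sheaf_homD(1)[OF f'h p] diff_carrier(1)[OF C' p, of d]]
          mult_carrier_mat[OF diff_carrier(1)[OF Jb p, of d] sheaf_homD(1)[OF f'h p]]
        by (intro mat_no_cols[of _ "sdim (obj J (d + 1)) \<pi>"]) auto
    qed
  qed
  \<comment> \<open>\<open>H d\<close> starts at degree \<open>d + 1\<close>, so the homotopy in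
    degree \<open>d\<close> is \<open>H (d - 1)\<close>. Up to degree \<open>a\<close> all matrices
    in the equation have no columns.\<close>
  moreover have "homotopic X C J f (\<lambda>d \<pi>. f' d \<pi> * q d \<pi>) (\<lambda>d. H (d - 1))"
    unfolding homotopic_def
  proof (intro conjI allI ballI)
    fix d
    show "sheaf_hom X (obj C d) (obj J (d - 1)) (H (d - 1))" using Hh[of "d - 1"] by simp
    fix \<pi> assume p: "\<pi> \<in> X"
    note cJ = diff_carrier(2)[OF Jb p, of d] and cC = diff_carrier(1)[OF C p, of d]
    have cH: "H (d - 1) \<pi> \<in> carrier_mat (sdim (obj J (d - 1)) \<pi>) (sdim (obj C d) \<pi>)"
      using sheaf_homD(1)[OF Hh[of "d - 1"] p] by simp
    note cH1 = sheaf_homD(1)[OF Hh[of d] p] and cf' = sheaf_homD(1)[OF f'h[of d] p]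
    note cq = chain_mapD(2)[OF q p, of d] and cf = chain_mapD(2)[OF f p, of d]
    note M = mult_carrier_mat[OF cf' cq] mult_carrier_mat[OF cJ cH] mult_carrier_mat[OF cH1 cC]
    have "f d \<pi> = f' d \<pi> * q d \<pi> + (diff J (d - 1) \<pi> * H (d - 1) \<pi> + H d \<pi> * diff C d \<pi>)"
    proof (cases "a \<le> d - 1")
      case True
      have e: "f' d \<pi> * q d \<pi> + H d \<pi> * diff C d \<pi> = f d \<pi> - diff J (d - 1) \<pi> * H (d - 1) \<pi>"
        using Qd[OF True] p by (simp add: Q_def)
      show ?thesis
      proof (rule eq_matI)
        fix i j assume "i < dim_row (f' d \<pi> * q d \<pi> + (diff J (d - 1) \<pi> * H (d - 1) \<pi> + H d \<pi> * diff C d \<pi>))"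
          "j < dim_col (f' d \<pi> * q d \<pi> + (diff J (d - 1) \<pi> * H (d - 1) \<pi> + H d \<pi> * diff C d \<pi>))"
        then have ij: "i < sdim (obj J d) \<pi>" "j < sdim (obj C d) \<pi>" using M by auto
        have "(f' d \<pi> * q d \<pi> + H d \<pi> * diff C d \<pi>) $$ (i, j) = (f d \<pi> - diff J (d - 1) \<pi> * H (d - 1) \<pi>) $$ (i, j)"
          unfolding e ..
        then have "(f' d \<pi> * q d \<pi>) $$ (i, j) + (H d \<pi> * diff C d \<pi>) $$ (i, j) =
            f d \<pi> $$ (i, j) - (diff J (d - 1) \<pi> * H (d - 1) \<pi>) $$ (i, j)"
          using ij M cf by (metis carrier_matD index_add_mat(1) index_minus_mat(1))
        moreover have "(f' d \<pi> * q d \<pi> + (diff J (d - 1) \<pi> * H (d - 1) \<pi> + H d \<pi> * diff C d \<pi>)) $$ (i, j) =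
           (f' d \<pi> * q d \<pi>) $$ (i, j) + ((diff J (d - 1) \<pi> * H (d - 1) \<pi>) $$ (i, j) + (H d \<pi> * diff C d \<pi>) $$ (i, j))"
          using ij M by (metis carrier_matD index_add_mat)
        ultimately show "f d \<pi> $$ (i, j) = (f' d \<pi> * q d \<pi> + (diff J (d - 1) \<pi> * H (d - 1) \<pi> + H d \<pi> * diff C d \<pi>)) $$ (i, j)"
          by (simp add: algebra_simps)
      qed (use M cf in auto)
    next
      case False
      have "sdim (obj C d) \<pi> = 0" using False p by (intro zC) auto
      then show ?thesis using M cf by (intro mat_no_cols[of _ "sdim (obj J d) \<pi>"]) auto
    qed
    then show "f d \<pi> = f' d \<pi> * q d \<pi> + (diff J (d - 1) \<pi> * H (d - 1) \<pi> + H (d + 1 - 1) \<pi> * diff C d \<pi>)" by simp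
  qed
  ultimately show thesis by (rule that)
qed

section \<open>From zigzags to homotopy equivalences\<close>

abbreviation identity_map :: "('p, 'k::field) sheaf_complex \<Rightarrow> int \<Rightarrow> 'p \<Rightarrow> 'k mat" where
  "identity_map C \<equiv> \<lambda>d \<pi>. 1\<^sub>m (sdim (obj C d) \<pi>)"

lemma chain_map_identity:
  assumes C: "bounded_complex X C"
  shows "chain_map X C C (identity_map C)"
  unfolding chain_map_def sheaf_hom_def
proof (intro conjI allI ballI impI)
  fix d \<sigma> assume s: "\<sigma> \<in> X"
  show "1\<^sub>m (sdim (obj C (d + 1)) \<sigma>) * diff C d \<sigma> = diff C d \<sigma> * 1\<^sub>m (sdim (obj C d) \<sigma>)"
    using diff_carrier(1)[OF C s, of d] by simp
  fix \<tau> assume t: "\<tau> \<in> X" "\<sigma> \<le> \<tau>"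
  show "1\<^sub>m (sdim (obj C d) \<tau>) * res (obj C d) \<sigma> \<tau> = res (obj C d) \<sigma> \<tau> * 1\<^sub>m (sdim (obj C d) \<sigma>)"
    using sheaf_onD(1)[OF bounded_complexD(1)[OF C, of d] s t] by simp
qed simp

lemma bijective_on_cohomology_identity:
  assumes C: "bounded_complex X C"
  shows "bijective_on_cohomology X C C (identity_map C)"
  unfolding bijective_on_cohomology_def
proof (intro allI ballI conjI impI)
  fix d \<pi> v assume "is_cycle C d \<pi> v" "is_boundary C d \<pi> (1\<^sub>m (sdim (obj C d) \<pi>) *\<^sub>v v)"
  then show "is_boundary C d \<pi> v" by (simp add: is_cycle_def)
next
  fix d \<pi> w assume p: "\<pi> \<in> X" and w: "is_cycle C d \<pi> w"
  have "is_boundary C d \<pi> (0\<^sub>v (sdim (obj C d) \<pi>))"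
    unfolding is_boundary_def using mult_mat_zero_vec[OF diff_carrier(2)[OF C p, of d]]
    by (intro bexI[of _ "0\<^sub>v (sdim (obj C (d - 1)) \<pi>)"]) auto
  then show "\<exists>v u. is_cycle C d \<pi> v \<and> is_boundary C d \<pi> u \<and> w = 1\<^sub>m (sdim (obj C d) \<pi>) *\<^sub>v v + u"
    using w by (intro exI[of _ w] exI[of _ "0\<^sub>v (sdim (obj C d) \<pi>)"]) (simp add: is_cycle_def)
qed

text \<open>Along the zigzag a quasi-isomorphism from the current complex to \<open>J\<close> is
  maintained, starting with the identity. An arrow into the current complex is composed with it.
  Along an arrow out of the current complex it is lifted, and cancellation up to homotopy shows that
  the lift is a quasi-isomorphism again.\<close>

lemma quasi_isomorphic_quasi_iso:
  assumes J: "labeled_complex_on X Ls J" and qi: "quasi_isomorphic X J C"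
  shows "bounded_complex X C \<and> (\<exists>f. quasi_iso X C J f)"
  using qi unfolding quasi_isomorphic_def
proof (induction rule: equivclp_induct)
  case base
  note Jb = labeled_complex_onD(1)[OF J]
  then show ?case
    using quasi_iso_iff[OF Jb Jb] chain_map_identity[OF Jb] bijective_on_cohomology_identity[OF Jb] by blast
next
  case (step C D)
  note Jb = labeled_complex_onD(1)[OF J]
  obtain f where C: "bounded_complex X C" and "quasi_iso X C J f" using step.IH by blast
  then have f: "chain_map X C J f" "bijective_on_cohomology X C J f" using quasi_iso_iff[OF C Jb] by blast+
  have D: "bounded_complex X D" using step.hyps by blast
  from step.hyps(2) show ?case
  proof (elim disjE conjE exE)
    fix q assume "quasi_iso X C D q"
    then have q: "chain_map X C D q" "bijective_on_cohomology X C D q" using quasi_iso_iff[OF C D] by blast+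
    obtain f' h where f': "chain_map X D J f'" "homotopic X C J f (\<lambda>d \<pi>. f' d \<pi> * q d \<pi>) h"
      by (rule lift_along_quasi_iso[OF C D J q f(1)])
    have "bijective_on_cohomology X D J f'"
      by (rule bijective_on_cohomology_cancel_right[OF C D Jb q(1) f'(1) f(1) f'(2) q(2) f(2)])
    then show ?thesis using D f' quasi_iso_iff[OF D Jb] by blast
  next
    fix q assume "quasi_iso X D C q"
    then have q: "chain_map X D C q" "bijective_on_cohomology X D C q" using quasi_iso_iff[OF D C] by blast+
    show ?thesis using bijective_on_cohomology_comp[OF D C Jb q(1) f(1) q(2) f(2)] D by blast
  qed
qed

text \<open>The zigzag gives \<open>g'\<close> from \<open>L\<close> to \<open>J\<close>. Lifting
  the identity of \<open>L\<close> along \<open>g'\<close> gives \<open>g\<close>, which is again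
  bijective on cohomology, so the identity of \<open>J\<close> can be lifted along \<open>g\<close>
  to \<open>g''\<close>. Thus \<open>g'\<close> is a right and \<open>g''\<close> a left homotopy
  inverse of \<open>g\<close>.\<close>

lemma homotopy_equivalence:
  assumes J: "labeled_complex_on X Js J" and L: "labeled_complex_on X Ls L" and qi: "quasi_isomorphic X J L"
  obtains g g' g'' h h' where "chain_map X J L g" "chain_map X L J g'" "chain_map X L J g''"
    "homotopic X L L (identity_map L) (\<lambda>d \<pi>. g d \<pi> * g' d \<pi>) h"
    "homotopic X J J (identity_map J) (\<lambda>d \<pi>. g'' d \<pi> * g d \<pi>) h'"
proof -
  note Jb = labeled_complex_onD(1)[OF J] and Lb = labeled_complex_onD(1)[OF L]
  obtain g' where "quasi_iso X L J g'" using quasi_isomorphic_quasi_iso[OF J qi] by blast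
  then have g': "chain_map X L J g'" "bijective_on_cohomology X L J g'" using quasi_iso_iff[OF Lb Jb] by blast+
  note idL = chain_map_identity[OF Lb] and idJ = chain_map_identity[OF Jb]
  obtain g h where g: "chain_map X J L g" and h: "homotopic X L L (identity_map L) (\<lambda>d \<pi>. g d \<pi> * g' d \<pi>) h"
    by (rule lift_along_quasi_iso[OF Lb Jb L g' idL])
  have gb: "bijective_on_cohomology X J L g"
    by (rule bijective_on_cohomology_cancel_right[OF Lb Jb Lb g'(1) g idL h g'(2) bijective_on_cohomology_identity[OF Lb]])
  obtain g'' h' where "chain_map X L J g''" "homotopic X J J (identity_map J) (\<lambda>d \<pi>. g'' d \<pi> * g d \<pi>) h'"
    by (rule lift_along_quasi_iso[OF Jb Lb J g gb idJ])
  then show thesis using that g g' h by blast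
qed

section \<open>A criterion for minimality\<close>

definition label_complex :: "(int \<Rightarrow> 'p::order list) \<Rightarrow> (int \<Rightarrow> 'k::field mat) \<Rightarrow> ('p, 'k) sheaf_complex" where
  "label_complex Ls Ms = \<lparr> obj = (\<lambda>d. labeled_sum (Ls d)),
     diff = (\<lambda>d \<tau>. block {\<tau>..} (Ls (d + 1)) (Ls d) (Ms d)) \<rparr>"

definition matrix_complex :: "'p::order set \<Rightarrow> (int \<Rightarrow> 'p list) \<Rightarrow> (int \<Rightarrow> 'k::field mat) \<Rightarrow> bool" where
  "matrix_complex X Ls Ms \<longleftrightarrow> (\<forall>d. set (Ls d) \<subseteq> X) \<and> (\<forall>d. lmat (Ls (d + 1)) (Ls d) (Ms d)) \<and>
     (\<forall>d. Ms (d + 1) * Ms d = 0\<^sub>m (length (Ls (d + 2))) (length (Ls d))) \<and>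
     (\<exists>a b. \<forall>d. d < a \<or> b < d \<longrightarrow> Ls d = [])"

lemma matrix_complexD:
  assumes "matrix_complex X Ls Ms"
  shows "set (Ls d) \<subseteq> X" "lmat (Ls (d + 1)) (Ls d) (Ms d)" "lmat (Ls d) (Ls (d - 1)) (Ms (d - 1))"
    "lmat (Ls (d + 2)) (Ls (d + 1)) (Ms (d + 1))"
    "Ms (d + 1) * Ms d = 0\<^sub>m (length (Ls (d + 2))) (length (Ls d))"
    "\<exists>a b. \<forall>d. d < a \<or> b < d \<longrightarrow> Ls d = []"
proof -
  have *: "lmat (Ls (d + 1)) (Ls d) (Ms d)" for d using assms unfolding matrix_complex_def by blast
  show "lmat (Ls (d + 1)) (Ls d) (Ms d)" by (rule *)
  show "lmat (Ls d) (Ls (d - 1)) (Ms (d - 1))" using *[of "d - 1"] by simp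
  show "lmat (Ls (d + 2)) (Ls (d + 1)) (Ms (d + 1))" using *[of "d + 1"] by (simp add: add.assoc)
qed (use assms in \<open>unfold matrix_complex_def, blast+\<close>)

lemma obj_label_complex[simp]: "obj (label_complex Ls Ms) d = labeled_sum (Ls d)"
  by (simp add: label_complex_def)

lemma diff_label_complex: "diff (label_complex Ls Ms) d \<tau> = block {\<tau>..} (Ls (d + 1)) (Ls d) (Ms d)"
  by (simp add: label_complex_def)

lemma labeled_complex_on_label_complex:
  assumes M: "matrix_complex X Ls Ms"
  shows "labeled_complex_on X Ls (label_complex Ls Ms :: ('p::order, 'k::field) sheaf_complex)"
  unfolding labeled_complex_on_def
proof (intro conjI allI)
  let ?J = "label_complex Ls Ms"
  show "bounded_complex X ?J"
    unfolding bounded_complex_def obj_label_complex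
  proof (intro conjI allI ballI)
    fix d
    show "sheaf_on X (labeled_sum (Ls d) :: ('p, 'k) sheaf)" by (rule sheaf_on_labeled_sum)
    show "sheaf_hom X (labeled_sum (Ls d)) (labeled_sum (Ls (d + 1))) (diff ?J d)"
      using sheaf_hom_block[OF matrix_complexD(2)[OF M, of d], of X] by (simp add: label_complex_def)
    fix \<pi> assume "\<pi> \<in> X"
    have "block {\<pi>..} (Ls (d + 2)) (Ls (d + 1)) (Ms (d + 1)) * block {\<pi>..} (Ls (d + 1)) (Ls d) (Ms d) =
       block {\<pi>..} (Ls (d + 2)) (Ls d) (Ms (d + 1) * Ms d)"
      using matrix_complexD(1,2,4)[OF M] by (intro block_mult_lmat[symmetric, of _ _ _ _ _ X]) auto
    then show "diff ?J (d + 1) \<pi> * diff ?J d \<pi> = 0\<^sub>m (sdim (labeled_sum (Ls (d + 2)) :: ('p, 'k) sheaf) \<pi>)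
       (sdim (labeled_sum (Ls d) :: ('p, 'k) sheaf) \<pi>)"
      by (simp add: diff_label_complex add.assoc matrix_complexD(5)[OF M])
  next
    obtain a b where "\<forall>d. d < a \<or> b < d \<longrightarrow> Ls d = []" using matrix_complexD(6)[OF M] by blast
    then show "\<exists>a b. \<forall>d. d < a \<or> b < d \<longrightarrow> (\<forall>\<pi>\<in>X. sdim (labeled_sum (Ls d) :: ('p, 'k) sheaf) \<pi> = 0)"
      by (intro exI[of _ a] exI[of _ b]) simp
  qed
qed (use matrix_complexD(1)[OF M] in simp_all)

abbreviation sub :: "'p set \<Rightarrow> 'p list \<Rightarrow> 'p list" where
  "sub S ls \<equiv> nths ls (positions S ls)"

text \<open>By \<open>block_mult_lmat\<close> the products of the blocks are blocks of the products.
  In general this is not the restriction of the sheaves to \<open>Z\<close>, since a summand with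
  label outside \<open>Z\<close> may be nonzero at points of \<open>Z\<close>.\<close>

lemma matrix_complex_block:
  assumes M: "matrix_complex X Ls Ms" and Z: "convex_in X Z"
  shows "matrix_complex Z (\<lambda>d. sub Z (Ls d)) (\<lambda>d. block Z (Ls (d + 1)) (Ls d) (Ms d))"
  unfolding matrix_complex_def
proof (intro conjI allI)
  fix d
  show "set (sub Z (Ls d)) \<subseteq> Z" by (simp add: set_nths_positions)
  show "lmat (sub Z (Ls (d + 1))) (sub Z (Ls d)) (block Z (Ls (d + 1)) (Ls d) (Ms d))"
    by (rule lmat_block[OF matrix_complexD(2)[OF M]])
  have "block Z (Ls (d + 2)) (Ls (d + 1)) (Ms (d + 1)) * block Z (Ls (d + 1)) (Ls d) (Ms d) =
       block Z (Ls (d + 2)) (Ls d) (Ms (d + 1) * Ms d)"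
    using matrix_complexD(1)[OF M]
    by (intro block_mult_lmat[OF matrix_complexD(4)[OF M] matrix_complexD(2)[OF M] Z, symmetric]) auto
  then show "block Z (Ls (d + 1 + 1)) (Ls (d + 1)) (Ms (d + 1)) * block Z (Ls (d + 1)) (Ls d) (Ms d) =
     0\<^sub>m (length (sub Z (Ls (d + 2)))) (length (sub Z (Ls d)))"
    by (simp add: add.assoc matrix_complexD(5)[OF M] length_nths_positions)
next
  obtain a b where "\<forall>d. d < a \<or> b < d \<longrightarrow> Ls d = []" using matrix_complexD(6)[OF M] by blast
  then show "\<exists>a b. \<forall>d. d < a \<or> b < d \<longrightarrow> sub Z (Ls d) = []"
    by (intro exI[of _ a] exI[of _ b]) simp
qed

lemma block_mult_star:
  assumes "lmat as cs M" "lmat cs bs N"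
  shows "block {\<tau>..} as bs (M * N) = block {\<tau>..} as cs M * block {\<tau>..} cs bs N"
  by (rule block_mult_lmat[OF assms convex_in_simps(1) subset_UNIV])

text \<open>Here, and in \<open>homotopic_lmat\<close> for homotopies, stalkwise equations become
  matrix equations. Only in this form can blocks over \<open>Z\<close> or over a single label be
  taken, as these are not stalks.\<close>

lemma chain_map_lmat:
  assumes M: "matrix_complex X Ls Ms" and N: "matrix_complex X Ks Ns"
    and g: "chain_map X (label_complex Ls Ms) (label_complex Ks Ns) g"
  obtains G where "\<And>d. lmat (Ks d) (Ls d) (G d)" "\<And>d \<tau>. \<tau> \<in> X \<Longrightarrow> g d \<tau> = block {\<tau>..} (Ks d) (Ls d) (G d)"
    "\<And>d. G (d + 1) * Ms d = Ns d * G d"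
proof -
  have "\<exists>G. lmat (Ks d) (Ls d) G \<and> (\<forall>\<tau>\<in>X. g d \<tau> = block {\<tau>..} (Ks d) (Ls d) G)" for d
    using hom_labeled_sum_lmat[OF chain_mapD(1)[OF g, of d, unfolded obj_label_complex] matrix_complexD(1)[OF N]]
    by metis
  then obtain G where G: "\<And>d. lmat (Ks d) (Ls d) (G d)"
    "\<And>d \<tau>. \<tau> \<in> X \<Longrightarrow> g d \<tau> = block {\<tau>..} (Ks d) (Ls d) (G d)" by metis
  have "G (d + 1) * Ms d = Ns d * G d" for d
  proof (rule lmat_eqI[OF _ _ matrix_complexD(1)[OF N]])
    show "lmat (Ks (d + 1)) (Ls d) (G (d + 1) * Ms d)" by (rule lmat_mult[OF G(1) matrix_complexD(2)[OF M]])
    show "lmat (Ks (d + 1)) (Ls d) (Ns d * G d)" by (rule lmat_mult[OF matrix_complexD(2)[OF N] G(1)])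
    fix \<tau> assume t: "\<tau> \<in> X"
    show "block {\<tau>..} (Ks (d + 1)) (Ls d) (G (d + 1) * Ms d) = block {\<tau>..} (Ks (d + 1)) (Ls d) (Ns d * G d)"
      using chain_mapD(3)[OF g t, of d]
      by (simp add: block_mult_star[OF G(1) matrix_complexD(2)[OF M]] block_mult_star[OF matrix_complexD(2)[OF N] G(1)]
          G(2)[OF t] diff_label_complex)
  qed
  then show thesis using that G by blast
qed

lemma homotopic_lmat:
  assumes M: "matrix_complex X Ls Ms"
    and h: "homotopic X (label_complex Ls Ms) (label_complex Ls Ms) (identity_map (label_complex Ls Ms)) (\<lambda>d \<pi>. f d \<pi> * g d \<pi>) h"
    and F: "\<And>d. lmat (Ls d) (Ks d) (F d)" "\<And>d \<tau>. \<tau> \<in> X \<Longrightarrow> f d \<tau> = block {\<tau>..} (Ls d) (Ks d) (F d)"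
    and G: "\<And>d. lmat (Ks d) (Ls d) (G d)" "\<And>d \<tau>. \<tau> \<in> X \<Longrightarrow> g d \<tau> = block {\<tau>..} (Ks d) (Ls d) (G d)"
  obtains H where "\<And>d. lmat (Ls (d - 1)) (Ls d) (H d)"
    "\<And>d. 1\<^sub>m (length (Ls d)) = F d * G d + (Ms (d - 1) * H d + H (d + 1) * Ms d)"
proof -
  have hh: "sheaf_hom X (labeled_sum (Ls d)) (labeled_sum (Ls (d - 1))) (h d)" for d
    using h unfolding homotopic_def by simp
  have "\<exists>H. lmat (Ls (d - 1)) (Ls d) H \<and> (\<forall>\<tau>\<in>X. h d \<tau> = block {\<tau>..} (Ls (d - 1)) (Ls d) H)" for d
    using hom_labeled_sum_lmat[OF hh matrix_complexD(1)[OF M]] by metis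
  then obtain H where H: "\<And>d. lmat (Ls (d - 1)) (Ls d) (H d)"
    "\<And>d \<tau>. \<tau> \<in> X \<Longrightarrow> h d \<tau> = block {\<tau>..} (Ls (d - 1)) (Ls d) (H d)" by metis
  have H1: "lmat (Ls d) (Ls (d + 1)) (H (d + 1))" for d using H(1)[of "d + 1"] by simp
  have "1\<^sub>m (length (Ls d)) = F d * G d + (Ms (d - 1) * H d + H (d + 1) * Ms d)" for d
  proof (rule lmat_eqI[OF lmat_one _ matrix_complexD(1)[OF M]])
    note L = lmat_mult[OF F(1) G(1), of d] lmat_mult[OF matrix_complexD(3)[OF M] H(1), of d] lmat_mult[OF H1 matrix_complexD(2)[OF M], of d]
    show "lmat (Ls d) (Ls d) (F d * G d + (Ms (d - 1) * H d + H (d + 1) * Ms d))"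
      by (intro lmat_add L)
    fix \<tau> assume t: "\<tau> \<in> X"
    have e: "1\<^sub>m (sdim (labeled_sum (Ls d) :: ('a, 'b) sheaf) \<tau>) = f d \<tau> * g d \<tau> +
       (diff (label_complex Ls Ms) (d - 1) \<tau> * h d \<tau> + h (d + 1) \<tau> * diff (label_complex Ls Ms) d \<tau>)"
      using h t unfolding homotopic_def by simp
    have "block {\<tau>..} (Ls d) (Ls d) (F d * G d + (Ms (d - 1) * H d + H (d + 1) * Ms d)) =
      f d \<tau> * g d \<tau> +
       (diff (label_complex Ls Ms) (d - 1) \<tau> * h d \<tau> + h (d + 1) \<tau> * diff (label_complex Ls Ms) d \<tau>)"
      using H(2)[OF t, of "d + 1"]
      by (simp add: block_add lmatD(1)[OF L(1)] lmatD(1)[OF L(2)] lmatD(1)[OF L(3)]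
         block_mult_star[OF F(1) G(1)] block_mult_star[OF matrix_complexD(3)[OF M] H(1)] block_mult_star[OF H1 matrix_complexD(2)[OF M]]
         F(2)[OF t] G(2)[OF t] H(2)[OF t] diff_label_complex)
    then show "block {\<tau>..} (Ls d) (Ls d) (1\<^sub>m (length (Ls d))) =
       block {\<tau>..} (Ls d) (Ls d) (F d * G d + (Ms (d - 1) * H d + H (d + 1) * Ms d))"
      using e by simp
  qed
  then show thesis using that H by blast
qed

text \<open>Used twice: with a singleton, where the differentials vanish and a plain one-sided
  inverse is left, and with \<open>Z\<close>, where it makes the complexes cut down to
  \<open>Z\<close> homotopy equivalent.\<close>

lemma block_homotopic:
  assumes M: "matrix_complex X Ls Ms" and N: "matrix_complex X Ks Ns" and Z: "convex_in X Z"
    and F: "\<And>d. lmat (Ls d) (Ks d) (F d)" and G: "\<And>d. lmat (Ks d) (Ls d) (G d)" and H: "\<And>d. lmat (Ls (d - 1)) (Ls d) (H d)"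
    and e: "\<And>d. 1\<^sub>m (length (Ls d)) = F d * G d + (Ms (d - 1) * H d + H (d + 1) * Ms d)"
  shows "1\<^sub>m (card (positions Z (Ls d))) = block Z (Ls d) (Ks d) (F d) * block Z (Ks d) (Ls d) (G d) +
     (block Z (Ls d) (Ls (d - 1)) (Ms (d - 1)) * block Z (Ls (d - 1)) (Ls d) (H d) +
      block Z (Ls d) (Ls (d + 1)) (H (d + 1)) * block Z (Ls (d + 1)) (Ls d) (Ms d))"
proof -
  have H1: "lmat (Ls d) (Ls (d + 1)) (H (d + 1))" for d using H[of "d + 1"] by simp
  note L = lmat_mult[OF F G, of d] lmat_mult[OF matrix_complexD(3)[OF M] H, of d] lmat_mult[OF H1 matrix_complexD(2)[OF M], of d]
  note s = matrix_complexD(1)[OF M] matrix_complexD(1)[OF N]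
  have "1\<^sub>m (card (positions Z (Ls d))) = block Z (Ls d) (Ls d) (F d * G d + (Ms (d - 1) * H d + H (d + 1) * Ms d))"
    unfolding e[symmetric] by simp
  also have "\<dots> = block Z (Ls d) (Ls d) (F d * G d) + (block Z (Ls d) (Ls d) (Ms (d - 1) * H d) + block Z (Ls d) (Ls d) (H (d + 1) * Ms d))"
    by (simp add: block_add lmatD(1)[OF L(1)] lmatD(1)[OF L(2)] lmatD(1)[OF L(3)])
  finally show ?thesis
    by (simp add: block_mult_lmat[OF F G Z s(2)] block_mult_lmat[OF matrix_complexD(3)[OF M] H Z s(1)]
        block_mult_lmat[OF H1 matrix_complexD(2)[OF M] Z s(1)])
qed

lemma homotopic_block:
  assumes M: "matrix_complex X Ls Ms" and N: "matrix_complex X Ks Ns" and Z: "convex_in X Z"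
    and F: "\<And>d. lmat (Ls d) (Ks d) (F d)" and G: "\<And>d. lmat (Ks d) (Ls d) (G d)" and H: "\<And>d. lmat (Ls (d - 1)) (Ls d) (H d)"
    and e: "\<And>d. 1\<^sub>m (length (Ls d)) = F d * G d + (Ms (d - 1) * H d + H (d + 1) * Ms d)"
  defines "MZ \<equiv> label_complex (\<lambda>d. sub Z (Ls d)) (\<lambda>d. block Z (Ls (d + 1)) (Ls d) (Ms d))"
  shows "homotopic Z MZ MZ (identity_map MZ)
     (\<lambda>d \<tau>. block {\<tau>..} (sub Z (Ls d)) (sub Z (Ks d)) (block Z (Ls d) (Ks d) (F d)) *
        block {\<tau>..} (sub Z (Ks d)) (sub Z (Ls d)) (block Z (Ks d) (Ls d) (G d)))
     (\<lambda>d \<tau>. block {\<tau>..} (sub Z (Ls (d - 1))) (sub Z (Ls d)) (block Z (Ls (d - 1)) (Ls d) (H d)))"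
  unfolding homotopic_def
proof (intro conjI allI ballI)
  fix d
  show "sheaf_hom Z (obj MZ d) (obj MZ (d - 1))
     (\<lambda>\<tau>. block {\<tau>..} (sub Z (Ls (d - 1))) (sub Z (Ls d)) (block Z (Ls (d - 1)) (Ls d) (H d)))"
    using sheaf_hom_block[OF lmat_block[OF H[of d], of Z], of Z] by (simp add: MZ_def)
  fix \<tau>
  have H1: "lmat (Ls d) (Ls (d + 1)) (H (d + 1))" for d using H[of "d + 1"] by simp
  note bF = lmat_block[OF F, where S=Z] and bG = lmat_block[OF G, where S=Z] and bH = lmat_block[OF H, where S=Z] and bH1 = lmat_block[OF H1, where S=Z]
    and bM = lmat_block[OF matrix_complexD(2)[OF M], where S=Z] and bM1 = lmat_block[OF matrix_complexD(3)[OF M], where S=Z]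
  let ?B = "block {\<tau>..} (sub Z (Ls d)) (sub Z (Ls d))"
  have "1\<^sub>m (sdim (obj MZ d) \<tau>) = ?B (1\<^sub>m (card (positions Z (Ls d))))"
    by (simp add: MZ_def block_one[where ls = "sub Z (Ls d)", unfolded length_nths_positions])
  also have "\<dots> = ?B (block Z (Ls d) (Ks d) (F d) * block Z (Ks d) (Ls d) (G d)) +
     (?B (block Z (Ls d) (Ls (d - 1)) (Ms (d - 1)) * block Z (Ls (d - 1)) (Ls d) (H d)) +
      ?B (block Z (Ls d) (Ls (d + 1)) (H (d + 1)) * block Z (Ls (d + 1)) (Ls d) (Ms d)))"
    unfolding block_homotopic[OF M N Z F G H e]
    by (simp add: block_add lmatD(1)[OF lmat_mult[OF bF bG]] lmatD(1)[OF lmat_mult[OF bM1 bH]] lmatD(1)[OF lmat_mult[OF bH1 bM]])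
  finally show "1\<^sub>m (sdim (obj MZ d) \<tau>) =
     block {\<tau>..} (sub Z (Ls d)) (sub Z (Ks d)) (block Z (Ls d) (Ks d) (F d)) *
        block {\<tau>..} (sub Z (Ks d)) (sub Z (Ls d)) (block Z (Ks d) (Ls d) (G d)) +
     (diff MZ (d - 1) \<tau> * block {\<tau>..} (sub Z (Ls (d - 1))) (sub Z (Ls d)) (block Z (Ls (d - 1)) (Ls d) (H d)) +
      block {\<tau>..} (sub Z (Ls (d + 1 - 1))) (sub Z (Ls (d + 1))) (block Z (Ls (d + 1 - 1)) (Ls (d + 1)) (H (d + 1))) * diff MZ d \<tau>)"
    by (simp add: block_mult_star[OF bF bG] block_mult_star[OF bM1 bH] block_mult_star[OF bH1 bM] MZ_def diff_label_complex)
qed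

lemma chain_map_block:
  assumes M: "matrix_complex X Ls Ms" and N: "matrix_complex X Ks Ns" and Z: "convex_in X Z"
    and G: "\<And>d. lmat (Ks d) (Ls d) (G d)" and e: "\<And>d. G (d + 1) * Ms d = Ns d * G d"
  shows "chain_map Z (label_complex (\<lambda>d. sub Z (Ls d)) (\<lambda>d. block Z (Ls (d + 1)) (Ls d) (Ms d)))
     (label_complex (\<lambda>d. sub Z (Ks d)) (\<lambda>d. block Z (Ks (d + 1)) (Ks d) (Ns d)))
     (\<lambda>d \<tau>. block {\<tau>..} (sub Z (Ks d)) (sub Z (Ls d)) (block Z (Ks d) (Ls d) (G d)))"
  unfolding chain_map_def
proof (intro conjI allI ballI)
  fix d
  show "sheaf_hom Z (obj (label_complex (\<lambda>d. sub Z (Ls d)) (\<lambda>d. block Z (Ls (d + 1)) (Ls d) (Ms d))) d)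
     (obj (label_complex (\<lambda>d. sub Z (Ks d)) (\<lambda>d. block Z (Ks (d + 1)) (Ks d) (Ns d))) d)
     (\<lambda>\<tau>. block {\<tau>..} (sub Z (Ks d)) (sub Z (Ls d)) (block Z (Ks d) (Ls d) (G d)))"
    using sheaf_hom_block[OF lmat_block[OF G[of d], of Z], of Z] by simp
  fix \<tau>
  note bG = lmat_block[OF G, where S=Z] and bM = lmat_block[OF matrix_complexD(2)[OF M], where S=Z] and bN = lmat_block[OF matrix_complexD(2)[OF N], where S=Z]
  have "block Z (Ks (d + 1)) (Ls (d + 1)) (G (d + 1)) * block Z (Ls (d + 1)) (Ls d) (Ms d) =
     block Z (Ks (d + 1)) (Ks d) (Ns d) * block Z (Ks d) (Ls d) (G d)"
    unfolding block_mult_lmat[OF G matrix_complexD(2)[OF M] Z matrix_complexD(1)[OF M], symmetric]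
      block_mult_lmat[OF matrix_complexD(2)[OF N] G Z matrix_complexD(1)[OF N], symmetric] e ..
  then show "block {\<tau>..} (sub Z (Ks (d + 1))) (sub Z (Ls (d + 1))) (block Z (Ks (d + 1)) (Ls (d + 1)) (G (d + 1))) *
     diff (label_complex (\<lambda>d. sub Z (Ls d)) (\<lambda>d. block Z (Ls (d + 1)) (Ls d) (Ms d))) d \<tau> =
     diff (label_complex (\<lambda>d. sub Z (Ks d)) (\<lambda>d. block Z (Ks (d + 1)) (Ks d) (Ns d))) d \<tau> *
     block {\<tau>..} (sub Z (Ks d)) (sub Z (Ls d)) (block Z (Ks d) (Ls d) (G d))"
    unfolding diff_label_complex block_mult_star[OF bG bM, symmetric] block_mult_star[OF bN bG, symmetric] by simp
qed

text \<open>The left homotopy inverse \<open>g''\<close> gives injectivity on cohomology, the right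
  homotopy inverse \<open>g'\<close> surjectivity.\<close>

lemma homotopy_equivalence_quasi_iso:
  assumes J: "bounded_complex X J" and L: "bounded_complex X L"
    and g: "chain_map X J L g" and g': "chain_map X L J g'" and g'': "chain_map X L J g''"
    and h: "homotopic X L L (identity_map L) (\<lambda>d \<pi>. g d \<pi> * g' d \<pi>) h"
    and h': "homotopic X J J (identity_map J) (\<lambda>d \<pi>. g'' d \<pi> * g d \<pi>) h'"
  shows "quasi_iso X J L g"
  unfolding quasi_iso_iff[OF J L] bijective_on_cohomology_def
proof (intro conjI allI ballI impI)
  show "chain_map X J L g" by fact
  fix d \<pi> v assume p: "\<pi> \<in> X" and v: "is_cycle J d \<pi> v" and b: "is_boundary L d \<pi> (g d \<pi> *\<^sub>v v)"
  note c = chain_mapD(2)[OF g'' p, of d] chain_mapD(2)[OF g p, of d]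
  obtain u where u: "is_boundary J d \<pi> u" "1\<^sub>m (sdim (obj J d) \<pi>) *\<^sub>v v = (g'' d \<pi> * g d \<pi>) *\<^sub>v v + u"
    by (rule homotopic_cycle[OF J J h' mult_carrier_mat[OF c] p v])
  then have "v = g'' d \<pi> *\<^sub>v (g d \<pi> *\<^sub>v v) + u"
    using v c unfolding is_cycle_def by simp
  then show "is_boundary J d \<pi> v"
    using boundary_add[OF J p chain_map_boundary[OF L J g'' p b] u(1)] by simp
next
  fix d \<pi> w assume p: "\<pi> \<in> X" and w: "is_cycle L d \<pi> w"
  note c = chain_mapD(2)[OF g p, of d] chain_mapD(2)[OF g' p, of d]
  obtain u where u: "is_boundary L d \<pi> u" "1\<^sub>m (sdim (obj L d) \<pi>) *\<^sub>v w = (g d \<pi> * g' d \<pi>) *\<^sub>v w + u"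
    by (rule homotopic_cycle[OF L L h mult_carrier_mat[OF c] p w])
  then have "w = g d \<pi> *\<^sub>v (g' d \<pi> *\<^sub>v w) + u"
    using w c unfolding is_cycle_def by simp
  then show "\<exists>v u. is_cycle J d \<pi> v \<and> is_boundary L d \<pi> u \<and> w = g d \<pi> *\<^sub>v v + u"
    using chain_map_cycle[OF L J g' p w] u(1) by blast
qed

lemma mult_cancel_middle:
  fixes A B C D :: "'k::field mat"
  assumes "A \<in> carrier_mat m n" "B \<in> carrier_mat n p" "C \<in> carrier_mat p n" "D \<in> carrier_mat n q" "B * C = 1\<^sub>m n"
  shows "(A * B) * (C * D) = A * D"
proof -
  have "(A * B) * (C * D) = A * (B * (C * D))" using assms by (intro assoc_mult_mat) auto
  also have "B * (C * D) = (B * C) * D" using assms(2-4) by (intro assoc_mult_mat[symmetric]) auto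
  finally show ?thesis using assms by simp
qed

section \<open>Numbers of summands\<close>

lemma sheaf_isomorphic_refl: "sheaf_on X F \<Longrightarrow> sheaf_isomorphic X F F"
  unfolding sheaf_isomorphic_def
  by (intro exI[of _ "\<lambda>\<sigma>. 1\<^sub>m (sdim F \<sigma>)"])
     (auto simp: sheaf_hom_def dest: sheaf_onD(1) intro: left_mult_one_mat[THEN trans] right_mult_one_mat[symmetric])

lemma sheaf_isomorphic_sym: "sheaf_isomorphic X F G \<Longrightarrow> sheaf_isomorphic X G F"
  unfolding sheaf_isomorphic_def by blast

lemma sheaf_isomorphic_trans:
  assumes F: "sheaf_on X F" and G: "sheaf_on X G" and H: "sheaf_on X H"
    and 1: "sheaf_isomorphic X F G" and 2: "sheaf_isomorphic X G H"
  shows "sheaf_isomorphic X F H"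
proof -
  obtain a b where a: "sheaf_hom X F G a" and b: "sheaf_hom X G F b"
    and ab: "\<And>\<sigma>. \<sigma> \<in> X \<Longrightarrow> b \<sigma> * a \<sigma> = 1\<^sub>m (sdim F \<sigma>)" "\<And>\<sigma>. \<sigma> \<in> X \<Longrightarrow> a \<sigma> * b \<sigma> = 1\<^sub>m (sdim G \<sigma>)"
    using 1 unfolding sheaf_isomorphic_def by blast
  obtain c e where c: "sheaf_hom X G H c" and e: "sheaf_hom X H G e"
    and ce: "\<And>\<sigma>. \<sigma> \<in> X \<Longrightarrow> e \<sigma> * c \<sigma> = 1\<^sub>m (sdim G \<sigma>)" "\<And>\<sigma>. \<sigma> \<in> X \<Longrightarrow> c \<sigma> * e \<sigma> = 1\<^sub>m (sdim H \<sigma>)"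
    using 2 unfolding sheaf_isomorphic_def by blast
  show ?thesis
    unfolding sheaf_isomorphic_def
  proof (intro exI conjI ballI)
    show "sheaf_hom X F H (\<lambda>\<sigma>. c \<sigma> * a \<sigma>)" by (rule sheaf_hom_comp[OF F G H a c])
    show "sheaf_hom X H F (\<lambda>\<sigma>. b \<sigma> * e \<sigma>)" by (rule sheaf_hom_comp[OF H G F e b])
    fix \<sigma> assume s: "\<sigma> \<in> X"
    note ca = sheaf_homD(1)[OF a s] and cb = sheaf_homD(1)[OF b s] and cc = sheaf_homD(1)[OF c s] and cd = sheaf_homD(1)[OF e s]
    show "b \<sigma> * e \<sigma> * (c \<sigma> * a \<sigma>) = 1\<^sub>m (sdim F \<sigma>)"
      using mult_cancel_middle[OF cb cd cc ca ce(1)[OF s]] ab(1)[OF s] by simp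
    show "c \<sigma> * a \<sigma> * (b \<sigma> * e \<sigma>) = 1\<^sub>m (sdim H \<sigma>)"
      using mult_cancel_middle[OF cc ca cb cd ab(2)[OF s]] ce(2)[OF s] by simp
  qed
qed

text \<open>An isomorphism becomes two labeled matrices with \<open>N * M = 1\<close>, so the sizes
  can be compared. It follows that \<open>LEAST\<close> in \<open>num_summands\<close> may be
  evaluated at any decomposition.\<close>

lemma labeled_sum_isomorphic_length_le:
  assumes "set as \<subseteq> X" "set bs \<subseteq> X"
    and "sheaf_isomorphic X (labeled_sum as) (labeled_sum bs :: ('p::order, 'k::field) sheaf)"
  shows "length as \<le> length bs"
proof -
  obtain \<phi> \<psi> where p: "sheaf_hom X (labeled_sum as) (labeled_sum bs) \<phi>"
    and q: "sheaf_hom X (labeled_sum bs :: ('p, 'k) sheaf) (labeled_sum as) \<psi>"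
    and pq: "\<And>\<sigma>. \<sigma> \<in> X \<Longrightarrow> \<psi> \<sigma> * \<phi> \<sigma> = 1\<^sub>m (sdim (labeled_sum as :: ('p, 'k) sheaf) \<sigma>)"
    using assms(3) unfolding sheaf_isomorphic_def by blast
  obtain M where M: "lmat bs as M" "\<And>\<tau>. \<tau> \<in> X \<Longrightarrow> \<phi> \<tau> = block {\<tau>..} bs as M"
    using hom_labeled_sum_lmat[OF p assms(2)] by blast
  obtain N where N: "lmat as bs N" "\<And>\<tau>. \<tau> \<in> X \<Longrightarrow> \<psi> \<tau> = block {\<tau>..} as bs N"
    using hom_labeled_sum_lmat[OF q assms(1)] by blast
  have "N * M = 1\<^sub>m (length as)"
  proof (rule lmat_eqI[OF lmat_mult[OF N(1) M(1)] lmat_one assms(1)])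
    fix \<tau> assume "\<tau> \<in> X"
    then show "block {\<tau>..} as as (N * M) = block {\<tau>..} as as (1\<^sub>m (length as))"
      using pq M(2) N(2) by (simp add: block_mult_star[OF N(1) M(1)])
  qed
  then show ?thesis by (rule right_inverse_dim_le[OF lmatD(1)[OF N(1)] lmatD(1)[OF M(1)]])
qed

lemma num_summands_labeled_sum:
  fixes F :: "('p::order, 'k::field) sheaf"
  assumes "set ls \<subseteq> X" "sheaf_on X F" "sheaf_isomorphic X F (labeled_sum ls)"
  shows "num_summands X F = length ls"
  unfolding num_summands_def
proof (rule Least_equality)
  show "\<exists>\<pi>s. set \<pi>s \<subseteq> X \<and> length \<pi>s = length ls \<and> sheaf_isomorphic X F (labeled_sum \<pi>s)" using assms by blast
next
  fix n assume "\<exists>\<pi>s. set \<pi>s \<subseteq> X \<and> length \<pi>s = n \<and> sheaf_isomorphic X F (labeled_sum \<pi>s)"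
  then obtain \<pi>s where p: "set \<pi>s \<subseteq> X" "length \<pi>s = n" "sheaf_isomorphic X F (labeled_sum \<pi>s)" by blast
  have "sheaf_isomorphic X (labeled_sum ls :: ('p, 'k) sheaf) (labeled_sum \<pi>s)"
    by (rule sheaf_isomorphic_trans[OF sheaf_on_labeled_sum assms(2) sheaf_on_labeled_sum sheaf_isomorphic_sym[OF assms(3)] p(3)])
  then show "length ls \<le> n" using labeled_sum_isomorphic_length_le[OF assms(1) p(1)] p(2) by simp
qed

lemma complex_isomorphic_quasi_iso:
  assumes C: "bounded_complex X C" and D: "bounded_complex X D"
    and f: "chain_map X C D f" and g: "chain_map X D C g"
    and gf: "\<And>d \<pi>. \<pi> \<in> X \<Longrightarrow> g d \<pi> * f d \<pi> = 1\<^sub>m (sdim (obj C d) \<pi>)"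
    and fg: "\<And>d \<pi>. \<pi> \<in> X \<Longrightarrow> f d \<pi> * g d \<pi> = 1\<^sub>m (sdim (obj D d) \<pi>)"
  shows "quasi_iso X C D f"
  unfolding quasi_iso_iff[OF C D] bijective_on_cohomology_def
proof (intro conjI allI ballI impI)
  show "chain_map X C D f" by fact
  fix d \<pi> assume p: "\<pi> \<in> X"
  note cf = chain_mapD(2)[OF f p, of d] and cg = chain_mapD(2)[OF g p, of d]
  show "is_boundary C d \<pi> v" if v: "is_cycle C d \<pi> v" and b: "is_boundary D d \<pi> (f d \<pi> *\<^sub>v v)" for v
  proof -
    have vc: "v \<in> stalk C d \<pi>" using v by (simp add: is_cycle_def)
    have "g d \<pi> *\<^sub>v (f d \<pi> *\<^sub>v v) = v"
      using assoc_mult_mat_vec[OF cg cf vc] gf[OF p] vc by simp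
    then show ?thesis using chain_map_boundary[OF D C g p b] by simp
  qed
  show "\<exists>v u. is_cycle C d \<pi> v \<and> is_boundary D d \<pi> u \<and> w = f d \<pi> *\<^sub>v v + u" if w: "is_cycle D d \<pi> w" for w
  proof -
    have wc: "w \<in> stalk D d \<pi>" using w by (simp add: is_cycle_def)
    have "f d \<pi> *\<^sub>v (g d \<pi> *\<^sub>v w) = w"
      using assoc_mult_mat_vec[OF cf cg wc] fg[OF p] wc by simp
    moreover have "is_boundary D d \<pi> (0\<^sub>v (sdim (obj D d) \<pi>))"
      unfolding is_boundary_def using mult_mat_zero_vec[OF diff_carrier(2)[OF D p, of d]]
      by (intro bexI[of _ "0\<^sub>v (sdim (obj D (d - 1)) \<pi>)"]) auto
    ultimately show ?thesis using chain_map_cycle[OF D C g p w] wc by (metis right_zero_vec)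
  qed
qed

lemma quasi_isomorphicI:
  "bounded_complex X C \<Longrightarrow> bounded_complex X D \<Longrightarrow> quasi_iso X C D f \<Longrightarrow> quasi_isomorphic X C D"
  unfolding quasi_isomorphic_def by (intro r_into_equivclp) blast

lemma quasi_isomorphic_trans: "quasi_isomorphic X C D \<Longrightarrow> quasi_isomorphic X D E \<Longrightarrow> quasi_isomorphic X C E"
  unfolding quasi_isomorphic_def by (rule equivclp_trans)

lemma injective_complex_label_complex:
  assumes "matrix_complex X Ls Ms"
  shows "injective_complex X (label_complex Ls Ms :: ('p::order, 'k::field) sheaf_complex)"
proof -
  have "injective_sheaf X (labeled_sum (Ls d) :: ('p, 'k) sheaf)" for d
    unfolding injective_sheaf_def
    using sheaf_on_labeled_sum[of X "Ls d", where 'k='k] matrix_complexD(1)[OF assms, of d] sheaf_isomorphic_refl by blast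
  then show ?thesis
    unfolding injective_complex_def
    using labeled_complex_onD(1)[OF labeled_complex_on_label_complex[OF assms]] by simp
qed

text \<open>Injectivity gives an isomorphism with a labeled sum in each degree separately.
  Conjugating the differentials with these isomorphisms turns them into chain maps, inverse to each
  other.\<close>

lemma injective_complex_as_label_complex:
  fixes D :: "('p::order, 'k::field) sheaf_complex"
  assumes D: "injective_complex X D"
  obtains Ks Ns where "matrix_complex X Ks Ns" "\<And>d. length (Ks d) = num_summands X (obj D d)"
    "quasi_isomorphic X D (label_complex Ks Ns)"
proof -
  have Db: "bounded_complex X D" and inj: "\<And>d. injective_sheaf X (obj D d)" using D unfolding injective_complex_def by auto
  note shD = bounded_complexD(1)[OF Db]
  have "\<exists>ks \<phi> \<psi>. set ks \<subseteq> X \<and> length ks = num_summands X (obj D d) \<and> sheaf_hom X (obj D d) (labeled_sum ks) \<phi> \<and>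
     sheaf_hom X (labeled_sum ks) (obj D d) \<psi> \<and>
     (\<forall>\<sigma>\<in>X. \<psi> \<sigma> * \<phi> \<sigma> = 1\<^sub>m (sdim (obj D d) \<sigma>) \<and> \<phi> \<sigma> * \<psi> \<sigma> = 1\<^sub>m (sdim (labeled_sum ks :: ('p, 'k) sheaf) \<sigma>))" for d
  proof -
    obtain ks where k: "set ks \<subseteq> X" "sheaf_isomorphic X (obj D d) (labeled_sum ks)"
      using inj[of d] unfolding injective_sheaf_def by blast
    then show ?thesis using num_summands_labeled_sum[OF k(1) shD k(2)] unfolding sheaf_isomorphic_def by metis
  qed
  then obtain Ks \<phi> \<psi> where Ks: "\<And>d. set (Ks d) \<subseteq> X" "\<And>d. length (Ks d) = num_summands X (obj D d)"
    and \<phi>: "\<And>d. sheaf_hom X (obj D d) (labeled_sum (Ks d)) (\<phi> d)" and \<psi>: "\<And>d. sheaf_hom X (labeled_sum (Ks d)) (obj D d) (\<psi> d)"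
    and i: "\<And>d \<sigma>. \<sigma> \<in> X \<Longrightarrow> \<psi> d \<sigma> * \<phi> d \<sigma> = 1\<^sub>m (sdim (obj D d) \<sigma>)"
      "\<And>d \<sigma>. \<sigma> \<in> X \<Longrightarrow> \<phi> d \<sigma> * \<psi> d \<sigma> = 1\<^sub>m (sdim (labeled_sum (Ks d) :: ('p, 'k) sheaf) \<sigma>)"
    by metis
  let ?S = "\<lambda>d. labeled_sum (Ks d) :: ('p, 'k) sheaf"
  note shL = sheaf_on_labeled_sum
  have dh: "sheaf_hom X (?S d) (?S (d + 1)) (\<lambda>\<tau>. \<phi> (d + 1) \<tau> * (diff D d \<tau> * \<psi> d \<tau>))" for d
    by (rule sheaf_hom_comp[OF shL shD shL sheaf_hom_comp[OF shL shD shD \<psi> bounded_complexD(2)[OF Db]] \<phi>])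
  have "\<exists>N. lmat (Ks (d + 1)) (Ks d) N \<and> (\<forall>\<tau>\<in>X. \<phi> (d + 1) \<tau> * (diff D d \<tau> * \<psi> d \<tau>) = block {\<tau>..} (Ks (d + 1)) (Ks d) N)" for d
    using hom_labeled_sum_lmat[OF dh Ks(1)] by metis
  then obtain Ns where Ns: "\<And>d. lmat (Ks (d + 1)) (Ks d) (Ns d)"
    "\<And>d \<tau>. \<tau> \<in> X \<Longrightarrow> \<phi> (d + 1) \<tau> * (diff D d \<tau> * \<psi> d \<tau>) = block {\<tau>..} (Ks (d + 1)) (Ks d) (Ns d)" by metis
  have Ns1: "lmat (Ks (d + 2)) (Ks (d + 1)) (Ns (d + 1))" for d using Ns(1)[of "d + 1"] by (simp add: add.assoc)
  have c: "\<tau> \<in> X \<Longrightarrow> \<phi> d \<tau> \<in> carrier_mat (sdim (?S d) \<tau>) (sdim (obj D d) \<tau>)"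
    "\<tau> \<in> X \<Longrightarrow> \<psi> d \<tau> \<in> carrier_mat (sdim (obj D d) \<tau>) (sdim (?S d) \<tau>)" for d \<tau>
    using sheaf_homD(1)[OF \<phi>] sheaf_homD(1)[OF \<psi>] by auto
  have MC: "matrix_complex X Ks Ns"
    unfolding matrix_complex_def
  proof (intro conjI allI)
    fix d
    show "set (Ks d) \<subseteq> X" by (rule Ks(1))
    show "lmat (Ks (d + 1)) (Ks d) (Ns d)" by (rule Ns(1))
    show "Ns (d + 1) * Ns d = 0\<^sub>m (length (Ks (d + 2))) (length (Ks d))"
    proof (rule lmat_eqI[OF lmat_mult[OF Ns1 Ns(1)] lmat_zero Ks(1)])
      fix \<tau> assume t: "\<tau> \<in> X"
      note cd = diff_carrier[OF Db t, of d]
      have p2: "\<phi> (d + 2) \<tau> \<in> carrier_mat (sdim (?S (d + 2)) \<tau>) (sdim (obj D (d + 2)) \<tau>)" using c(1)[OF t] .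
      have "block {\<tau>..} (Ks (d + 2)) (Ks d) (Ns (d + 1) * Ns d) =
        (\<phi> (d + 2) \<tau> * (diff D (d + 1) \<tau> * \<psi> (d + 1) \<tau>)) * (\<phi> (d + 1) \<tau> * (diff D d \<tau> * \<psi> d \<tau>))"
        using Ns(2)[OF t, of "d + 1"] by (simp add: block_mult_star[OF Ns1 Ns(1)] Ns(2)[OF t] add.assoc)
      also have "\<phi> (d + 2) \<tau> * (diff D (d + 1) \<tau> * \<psi> (d + 1) \<tau>) = (\<phi> (d + 2) \<tau> * diff D (d + 1) \<tau>) * \<psi> (d + 1) \<tau>"
        by (rule assoc_mult_mat[OF p2 cd(3) c(2)[OF t], symmetric])
      also have "\<dots> * (\<phi> (d + 1) \<tau> * (diff D d \<tau> * \<psi> d \<tau>)) = (\<phi> (d + 2) \<tau> * diff D (d + 1) \<tau>) * (diff D d \<tau> * \<psi> d \<tau>)"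
        by (rule mult_cancel_middle[OF mult_carrier_mat[OF p2 cd(3)] c(2)[OF t] c(1)[OF t] mult_carrier_mat[OF cd(1) c(2)[OF t]] i(1)[OF t]])
      also have "\<dots> = \<phi> (d + 2) \<tau> * (diff D (d + 1) \<tau> * (diff D d \<tau> * \<psi> d \<tau>))"
        by (rule assoc_mult_mat[OF p2 cd(3) mult_carrier_mat[OF cd(1) c(2)[OF t]]])
      also have "diff D (d + 1) \<tau> * (diff D d \<tau> * \<psi> d \<tau>) = diff D (d + 1) \<tau> * diff D d \<tau> * \<psi> d \<tau>"
        by (rule assoc_mult_mat[OF cd(3) cd(1) c(2)[OF t], symmetric])
      also have "\<dots> = 0\<^sub>m (sdim (obj D (d + 2)) \<tau>) (sdim (?S d) \<tau>)"
        unfolding bounded_complexD(3)[OF Db t] by (rule left_mult_zero_mat[OF c(2)[OF t]])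
      also have "\<phi> (d + 2) \<tau> * \<dots> = 0\<^sub>m (sdim (?S (d + 2)) \<tau>) (sdim (?S d) \<tau>)"
        by (rule right_mult_zero_mat[OF p2])
      finally show "block {\<tau>..} (Ks (d + 2)) (Ks d) (Ns (d + 1) * Ns d) =
        block {\<tau>..} (Ks (d + 2)) (Ks d) (0\<^sub>m (length (Ks (d + 2))) (length (Ks d)))" by simp
    qed
  next
    obtain a b where ab: "\<And>d \<pi>. d < a \<or> b < d \<Longrightarrow> \<pi> \<in> X \<Longrightarrow> sdim (obj D d) \<pi> = 0"
      using bounded_complexD(4)[OF Db] by blast
    have "Ks d = []" if "d < a \<or> b < d" for d
    proof (rule ccontr)
      assume "Ks d \<noteq> []"
      \<comment> \<open>A summand is nonzero at its own label, so a degree with a summand has a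
        nonzero stalk there.\<close>
      let ?\<pi> = "hd (Ks d)"
      have p: "?\<pi> \<in> X" using \<open>Ks d \<noteq> []\<close> Ks(1)[of d] by (meson hd_in_set subsetD)
      have z: "sdim (obj D d) ?\<pi> = 0" using ab[OF that p] .
      have "0 \<in> positions {?\<pi>..} (Ks d)" using \<open>Ks d \<noteq> []\<close> by (simp add: positions_def hd_conv_nth)
      then have "card (positions {?\<pi>..} (Ks d)) \<noteq> 0" by auto
      moreover have "card (positions {?\<pi>..} (Ks d)) \<le> sdim (obj D d) ?\<pi>"
        using right_inverse_dim_le[OF c(1)[OF p] c(2)[OF p] i(2)[OF p]] by simp
      ultimately show False using z by simp
    qed
    then show "\<exists>a b. \<forall>d. d < a \<or> b < d \<longrightarrow> Ks d = []" by blast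
  qed
  let ?L = "label_complex Ks Ns"
  note Lb = labeled_complex_onD(1)[OF labeled_complex_on_label_complex[OF MC]]
  have dL: "diff ?L d \<tau> = \<phi> (d + 1) \<tau> * (diff D d \<tau> * \<psi> d \<tau>)" if "\<tau> \<in> X" for d \<tau>
    using Ns(2)[OF that] by (simp add: diff_label_complex)
  have f: "chain_map X D ?L \<phi>"
    unfolding chain_map_def obj_label_complex
  proof (intro conjI allI ballI \<phi>)
    fix d \<pi> assume p: "\<pi> \<in> X"
    note cd = diff_carrier(1)[OF Db p, of d]
    have "diff ?L d \<pi> * \<phi> d \<pi> = \<phi> (d + 1) \<pi> * (diff D d \<pi> * \<psi> d \<pi> * \<phi> d \<pi>)"
      unfolding dL[OF p] by (rule assoc_mult_mat[OF c(1)[OF p] mult_carrier_mat[OF cd c(2)[OF p]] c(1)[OF p]])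
    also have "diff D d \<pi> * \<psi> d \<pi> * \<phi> d \<pi> = diff D d \<pi>"
      using cd unfolding assoc_mult_mat[OF cd c(2)[OF p] c(1)[OF p]] i(1)[OF p] by simp
    finally show "\<phi> (d + 1) \<pi> * diff D d \<pi> = diff ?L d \<pi> * \<phi> d \<pi>" by simp
  qed
  have g: "chain_map X ?L D \<psi>"
    unfolding chain_map_def obj_label_complex
  proof (intro conjI allI ballI \<psi>)
    fix d \<pi> assume p: "\<pi> \<in> X"
    note cd = mult_carrier_mat[OF diff_carrier(1)[OF Db p, of d] c(2)[OF p]]
    have "\<psi> (d + 1) \<pi> * diff ?L d \<pi> = \<psi> (d + 1) \<pi> * \<phi> (d + 1) \<pi> * (diff D d \<pi> * \<psi> d \<pi>)"
      unfolding dL[OF p] by (rule assoc_mult_mat[OF c(2)[OF p] c(1)[OF p] cd, symmetric])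
    then show "\<psi> (d + 1) \<pi> * diff ?L d \<pi> = diff D d \<pi> * \<psi> d \<pi>" unfolding i(1)[OF p] left_mult_one_mat[OF cd] .
  qed
  have "quasi_iso X D ?L \<phi>"
    using i by (intro complex_isomorphic_quasi_iso[OF Db Lb f g]) auto
  then show thesis using that[OF MC Ks(2)] quasi_isomorphicI[OF Db Lb] by blast
qed

lemma length_eq_sum_positions:
  assumes "finite X" "set ls \<subseteq> X" "Z \<subseteq> X"
  shows "length ls = card (positions Z ls) + (\<Sum>\<pi>\<in>X - Z. card (positions {\<pi>} ls))"
proof -
  have "{..<length ls} = positions Z ls \<union> (\<Union>\<pi>\<in>X - Z. positions {\<pi>} ls)"
    using assms(2) by (auto simp: positions_def subset_iff)
  then have "length ls = card (positions Z ls \<union> (\<Union>\<pi>\<in>X - Z. positions {\<pi>} ls))" by (metis card_lessThan)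
  also have "\<dots> = card (positions Z ls) + card (\<Union>\<pi>\<in>X - Z. positions {\<pi>} ls)"
    using assms(1) by (intro card_Un_disjoint) (auto simp: positions_def)
  also have "card (\<Union>\<pi>\<in>X - Z. positions {\<pi>} ls) = (\<Sum>\<pi>\<in>X - Z. card (positions {\<pi>} ls))"
    using assms(1) by (intro card_UN_disjoint) (auto simp: positions_def)
  finally show ?thesis .
qed

text \<open>If \<open>D\<close> is another injective complex in the class, there is \<open>g: J \<rightarrow> D\<close> with a left homotopy inverse.
  A zero \<open>{\<pi>}\<close> block makes this homotopy vanish on the summands \<open>[\<pi>]\<close>, so \<open>g\<close> is injective
  there; the summands with labels in \<open>Z\<close> are compared as a whole.\<close>

theorem minimal_label_complex:
  fixes Ms :: "int \<Rightarrow> 'k::field mat" and Ls :: "int \<Rightarrow> 'p::order list"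
  assumes fin: "finite X" and M: "matrix_complex X Ls Ms" and Z: "convex_in X Z" "Z \<subseteq> X"
    and diag: "\<And>\<pi> d. \<pi> \<in> X - Z \<Longrightarrow> block {\<pi>} (Ls (d + 1)) (Ls d) (Ms d) =
        0\<^sub>m (card (positions {\<pi>} (Ls (d + 1)))) (card (positions {\<pi>} (Ls d)))"
    and min: "minimal_injective_complex Z (label_complex (\<lambda>d. sub Z (Ls d)) (\<lambda>d. block Z (Ls (d + 1)) (Ls d) (Ms d)))"
  shows "minimal_injective_complex X (label_complex Ls Ms)"
  unfolding minimal_injective_complex_def
proof (intro conjI allI impI)
  let ?J = "label_complex Ls Ms"
  let ?JZ = "label_complex (\<lambda>d. sub Z (Ls d)) (\<lambda>d. block Z (Ls (d + 1)) (Ls d) (Ms d))"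
  show "injective_complex X ?J" by (rule injective_complex_label_complex[OF M])
  fix D d assume D: "injective_complex X D" and JD: "quasi_isomorphic X ?J D"
  obtain Ks Ns where N: "matrix_complex X Ks Ns" and len: "\<And>d. length (Ks d) = num_summands X (obj D d)"
    and DL: "quasi_isomorphic X D (label_complex Ks Ns)"
    using injective_complex_as_label_complex[OF D] by blast
  let ?L = "label_complex Ks Ns"
  let ?LZ = "label_complex (\<lambda>d. sub Z (Ks d)) (\<lambda>d. block Z (Ks (d + 1)) (Ks d) (Ns d))"
  note Jl = labeled_complex_on_label_complex[OF M] and Ll = labeled_complex_on_label_complex[OF N]
  obtain g g' g'' h h' where g: "chain_map X ?J ?L g" "chain_map X ?L ?J g'" "chain_map X ?L ?J g''"
    and h: "homotopic X ?L ?L (identity_map ?L) (\<lambda>d \<pi>. g d \<pi> * g' d \<pi>) h"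
      "homotopic X ?J ?J (identity_map ?J) (\<lambda>d \<pi>. g'' d \<pi> * g d \<pi>) h'"
    by (rule homotopy_equivalence[OF Jl Ll quasi_isomorphic_trans[OF JD DL]])
  obtain G where G: "\<And>d. lmat (Ks d) (Ls d) (G d)" "\<And>d \<tau>. \<tau> \<in> X \<Longrightarrow> g d \<tau> = block {\<tau>..} (Ks d) (Ls d) (G d)"
    and Ge: "\<And>d. G (d + 1) * Ms d = Ns d * G d" using chain_map_lmat[OF M N g(1)] by blast
  obtain G' where G': "\<And>d. lmat (Ls d) (Ks d) (G' d)" "\<And>d \<tau>. \<tau> \<in> X \<Longrightarrow> g' d \<tau> = block {\<tau>..} (Ls d) (Ks d) (G' d)"
    and G'e: "\<And>d. G' (d + 1) * Ns d = Ms d * G' d" using chain_map_lmat[OF N M g(2)] by blast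
  obtain G'' where G'': "\<And>d. lmat (Ls d) (Ks d) (G'' d)" "\<And>d \<tau>. \<tau> \<in> X \<Longrightarrow> g'' d \<tau> = block {\<tau>..} (Ls d) (Ks d) (G'' d)"
    and G''e: "\<And>d. G'' (d + 1) * Ns d = Ms d * G'' d" using chain_map_lmat[OF N M g(3)] by blast
  obtain H where H: "\<And>d. lmat (Ks (d - 1)) (Ks d) (H d)"
    "\<And>d. 1\<^sub>m (length (Ks d)) = G d * G' d + (Ns (d - 1) * H d + H (d + 1) * Ns d)"
    using homotopic_lmat[OF N h(1) G G'] by blast
  obtain H' where H': "\<And>d. lmat (Ls (d - 1)) (Ls d) (H' d)"
    "\<And>d. 1\<^sub>m (length (Ls d)) = G'' d * G d + (Ms (d - 1) * H' d + H' (d + 1) * Ms d)"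
    using homotopic_lmat[OF M h(2) G'' G] by blast
  have cnt: "card (positions {\<pi>} (Ls d)) \<le> card (positions {\<pi>} (Ks d))" if p: "\<pi> \<in> X - Z" for \<pi>
  proof -
    let ?n = "card (positions {\<pi>} (Ls d))"
    have H1: "lmat (Ls d) (Ls (d + 1)) (H' (d + 1))" using H'(1)[of "d + 1"] by simp
    \<comment> \<open>In the two homotopy terms the differential of \<open>J\<close> occurs in
      degree \<open>d - 1\<close> on the left and in degree \<open>d\<close> on the right. Both of
      its blocks vanish, so on the summands \<open>[\<pi>]\<close> the block of \<open>g''\<close>
      is a left inverse of that of \<open>g\<close>.\<close>
    have d0: "block {\<pi>} (Ls d) (Ls (d - 1)) (Ms (d - 1)) = 0\<^sub>m ?n (card (positions {\<pi>} (Ls (d - 1))))"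
      using diag[OF p, of "d - 1"] by simp
    have c: "block {\<pi>} (Ls d) (Ks d) (G'' d) \<in> carrier_mat ?n (card (positions {\<pi>} (Ks d)))"
      "block {\<pi>} (Ks d) (Ls d) (G d) \<in> carrier_mat (card (positions {\<pi>} (Ks d))) ?n"
      using lmatD(1)[OF G''(1)] lmatD(1)[OF G(1)] by auto
    have "1\<^sub>m ?n = block {\<pi>} (Ls d) (Ks d) (G'' d) * block {\<pi>} (Ks d) (Ls d) (G d) + (0\<^sub>m ?n ?n + 0\<^sub>m ?n ?n)"
      using block_homotopic[OF M N convex_in_simps(2) G''(1) G(1) H'(1) H'(2), of \<pi> d]
        left_mult_zero_mat[OF dim_block(1)[OF lmatD(1)[OF H'(1)[of d]]], of _ "{\<pi>}"]
        right_mult_zero_mat[OF dim_block(1)[OF lmatD(1)[OF H1]], of "{\<pi>}"]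
      unfolding d0 diag[OF p, of d] by simp
    then have "block {\<pi>} (Ls d) (Ks d) (G'' d) * block {\<pi>} (Ks d) (Ls d) (G d) = 1\<^sub>m ?n"
      using mult_carrier_mat[OF c] by simp
    then show ?thesis by (rule right_inverse_dim_le[OF c])
  qed
  note MZ = matrix_complex_block[OF M Z(1)] and NZ = matrix_complex_block[OF N Z(1)]
  note JZb = labeled_complex_onD(1)[OF labeled_complex_on_label_complex[OF MZ]]
    and LZb = labeled_complex_onD(1)[OF labeled_complex_on_label_complex[OF NZ]]
  \<comment> \<open>Over \<open>Z\<close> no vanishing of blocks is known. All maps and both
    homotopies are cut down to \<open>Z\<close> instead, and minimality of \<open>?JZ\<close> gives
    the inequality for the labels in \<open>Z\<close> taken together.\<close>
  have "quasi_iso Z ?JZ ?LZ (\<lambda>d \<tau>. block {\<tau>..} (sub Z (Ks d)) (sub Z (Ls d)) (block Z (Ks d) (Ls d) (G d)))"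
    by (rule homotopy_equivalence_quasi_iso[OF JZb LZb chain_map_block[OF M N Z(1) G(1) Ge]
        chain_map_block[OF N M Z(1) G'(1) G'e] chain_map_block[OF N M Z(1) G''(1) G''e]
        homotopic_block[OF N M Z(1) G(1) G'(1) H] homotopic_block[OF M N Z(1) G''(1) G(1) H']])
  then have "quasi_isomorphic Z ?JZ ?LZ" by (rule quasi_isomorphicI[OF JZb LZb])
  then have "num_summands Z (obj ?JZ d) \<le> num_summands Z (obj ?LZ d)"
    using min injective_complex_label_complex[OF NZ] unfolding minimal_injective_complex_def by blast
  then have cZ: "card (positions Z (Ls d)) \<le> card (positions Z (Ks d))"
    using num_summands_labeled_sum[OF matrix_complexD(1)[OF MZ] sheaf_on_labeled_sum sheaf_isomorphic_refl[OF sheaf_on_labeled_sum], where 'k='k, of d]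
      num_summands_labeled_sum[OF matrix_complexD(1)[OF NZ] sheaf_on_labeled_sum sheaf_isomorphic_refl[OF sheaf_on_labeled_sum], where 'k='k, of d]
    by (simp add: length_nths_positions)
  have "num_summands X (obj ?J d) = length (Ls d)"
    using num_summands_labeled_sum[OF matrix_complexD(1)[OF M] sheaf_on_labeled_sum sheaf_isomorphic_refl[OF sheaf_on_labeled_sum], where 'k='k, of d]
    by simp
  also have "\<dots> \<le> length (Ks d)"
    unfolding length_eq_sum_positions[OF fin matrix_complexD(1)[OF M] Z(2), of d] length_eq_sum_positions[OF fin matrix_complexD(1)[OF N] Z(2), of d]
    using cnt cZ by (intro add_mono sum_mono) auto
  finally show "num_summands X (obj ?J d) \<le> num_summands X (obj D d)" unfolding len .
qed

text \<open>The labeled matrices represent \<open>I\<close> only up to isomorphism. The numbers of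
  summands and the class under quasi-isomorphism are invariant, so minimality passes to the labeled
  form.\<close>

lemma minimal_injective_complex_isomorphic:
  assumes I: "minimal_injective_complex X I" and iso: "complex_isomorphic X (label_complex Ls Ms) I"
    and M: "matrix_complex X Ls Ms"
  shows "minimal_injective_complex X (label_complex Ls Ms)" "\<exists>f. quasi_iso X I (label_complex Ls Ms) f"
proof -
  let ?J = "label_complex Ls Ms"
  have Ib: "bounded_complex X I" using I unfolding minimal_injective_complex_def injective_complex_def by blast
  note Jb = labeled_complex_onD(1)[OF labeled_complex_on_label_complex[OF M]]
  obtain f g where f: "chain_map X ?J I f" and g: "chain_map X I ?J g"
    and fg: "\<And>d \<pi>. \<pi> \<in> X \<Longrightarrow> g d \<pi> * f d \<pi> = 1\<^sub>m (sdim (obj ?J d) \<pi>)"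
      "\<And>d \<pi>. \<pi> \<in> X \<Longrightarrow> f d \<pi> * g d \<pi> = 1\<^sub>m (sdim (obj I d) \<pi>)"
    using iso unfolding complex_isomorphic_def by blast
  show ex: "\<exists>f. quasi_iso X I ?J f" using complex_isomorphic_quasi_iso[OF Ib Jb g f fg(2,1)] by blast
  then have qi: "quasi_isomorphic X I ?J" using quasi_isomorphicI[OF Ib Jb] by blast
  have n: "num_summands X (obj ?J d) = num_summands X (obj I d)" for d
  proof -
    have "sheaf_isomorphic X (obj I d) (labeled_sum (Ls d))"
      unfolding sheaf_isomorphic_def
      using chain_mapD(1)[OF f, of d] chain_mapD(1)[OF g, of d] fg[of _ d] by (intro exI[of _ "g d"] exI[of _ "f d"]) simp
    from num_summands_labeled_sum[OF matrix_complexD(1)[OF M] bounded_complexD(1)[OF Ib] this]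
      num_summands_labeled_sum[OF matrix_complexD(1)[OF M] sheaf_on_labeled_sum sheaf_isomorphic_refl[OF sheaf_on_labeled_sum]]
    show ?thesis by simp
  qed
  show "minimal_injective_complex X ?J"
    unfolding minimal_injective_complex_def n
    using I injective_complex_label_complex[OF M] quasi_isomorphic_trans[OF qi]
    unfolding minimal_injective_complex_def by blast
qed

section \<open>The exactness step of the algorithm\<close>

text \<open>The row space in terms of the coefficient vector \<open>c\<close>, which the arguments
  on independence manipulate; \<open>row_space_iff\<close> connects it with the test in
  \<open>try_row\<close>.\<close>

definition in_row_space :: "'k::field mat \<Rightarrow> 'k vec \<Rightarrow> bool" where
  "in_row_space A b \<longleftrightarrow> (\<exists>c\<in>carrier_vec (dim_row A). b = transpose_mat A *\<^sub>v c)"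

lemma row_space_iff: "b \<in> vec_space.row_space (dim_col A) A \<longleftrightarrow> in_row_space A b"
proof -
  have "A \<in> carrier_mat (dim_row A) (dim_col A)" by simp
  from vec_space.row_space_eq[OF this] show ?thesis
    unfolding in_row_space_def by (auto intro!: carrier_vecI)
qed

definition labeled :: "('p::order, 'k::field) labeled_mat \<Rightarrow> bool" where
  "labeled M \<longleftrightarrow> lmat (row_labels M) (col_labels M) (entries M)"

abbreviation rowdim :: "('p::order, 'k::field) labeled_mat \<Rightarrow> 'p \<Rightarrow> nat" where
  "rowdim M \<pi> \<equiv> card (positions {\<pi>..} (row_labels M))"

abbreviation coldim :: "('p::order, 'k::field) labeled_mat \<Rightarrow> 'p \<Rightarrow> nat" where
  "coldim M \<pi> \<equiv> card (positions {\<pi>..} (col_labels M))"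

lemma at_star_carrier: "labeled M \<Longrightarrow> at_star M \<pi> \<in> carrier_mat (rowdim M \<pi>) (coldim M \<pi>)"
  unfolding labeled_def at_star_eq_block by (intro dim_block(1) lmatD(1))

text \<open>No relation among the rows of \<open>M(\<pi>)\<close> involves a row labeled \<open>\<pi>\<close>.\<close>

definition independent_at :: "('p::order, 'k::field) labeled_mat \<Rightarrow> 'p \<Rightarrow> bool" where
  "independent_at M \<pi> \<longleftrightarrow> (\<forall>c\<in>carrier_vec (rowdim M \<pi>). transpose_mat (at_star M \<pi>) *\<^sub>v c = 0\<^sub>v (coldim M \<pi>) \<longrightarrow>
     (\<forall>k<rowdim M \<pi>. row_labels M ! pick (positions {\<pi>..} (row_labels M)) k = \<pi> \<longrightarrow> c $ k = 0))"

text \<open>Dual form of exactness: a functional that kills the image of \<open>A(\<pi>)\<close> is a combination of rows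
  of \<open>B(\<pi>)\<close>.\<close>

definition exact_at :: "('p::order, 'k::field) labeled_mat \<Rightarrow> ('p, 'k) labeled_mat \<Rightarrow> 'p \<Rightarrow> bool" where
  "exact_at A B \<pi> \<longleftrightarrow> (\<forall>b\<in>carrier_vec (rowdim A \<pi>). transpose_mat (at_star A \<pi>) *\<^sub>v b = 0\<^sub>v (coldim A \<pi>) \<longrightarrow>
     in_row_space (at_star B \<pi>) b)"

text \<open>Records what MakeExact may change while leaving open which rows it adds, as the bases
  are arbitrary. Old rows keep their positions, so row indices stay valid.\<close>

definition row_extension :: "'p set \<Rightarrow> ('p::order, 'k::field) labeled_mat \<Rightarrow> ('p, 'k) labeled_mat \<Rightarrow> bool" where
  "row_extension D B B' \<longleftrightarrow> labeled B' \<and> col_labels B' = col_labels B \<and>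
     (\<exists>rest. row_labels B' = row_labels B @ rest \<and> set rest \<subseteq> D) \<and>
     (\<forall>i<length (row_labels B). \<forall>j<length (col_labels B). entries B' $$ (i, j) = entries B $$ (i, j))"

lemma row_extension_refl: "labeled B \<Longrightarrow> row_extension D B B"
  by (auto simp: row_extension_def)

lemma row_extension_trans:
  assumes "row_extension D B B'" "row_extension D B' B''"
  shows "row_extension D B B''"
proof -
  obtain r r' where r: "row_labels B' = row_labels B @ r" "set r \<subseteq> D" "row_labels B'' = row_labels B' @ r'" "set r' \<subseteq> D"
    using assms unfolding row_extension_def by blast
  have "entries B'' $$ (i, j) = entries B $$ (i, j)" if "i < length (row_labels B)" "j < length (col_labels B)" for i j
    using assms that r(1) unfolding row_extension_def by simp
  then show ?thesis using assms r unfolding row_extension_def by auto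
qed

lemma row_extension_mono: "row_extension D B B' \<Longrightarrow> D \<subseteq> E \<Longrightarrow> row_extension E B B'"
  unfolding row_extension_def by blast

lemma positions_append_subset: "positions S ls \<subseteq> positions S (ls @ ys)"
  by (auto simp: positions_def nth_append)

lemma pick_append:
  assumes k: "k < card (positions S ls)"
  shows "pick (positions S (ls @ ys)) k = pick (positions S ls) k"
proof (rule pick_eqI)
  let ?i = "pick (positions S ls) k"
  have i: "?i < length ls" "ls ! ?i \<in> S" using pick_positions[OF k] by auto
  show "?i \<in> positions S (ls @ ys)" using i by (simp add: positions_def nth_append)
  have "{a \<in> positions S (ls @ ys). a < ?i} = {a \<in> positions S ls. a < ?i}"
    using i(1) by (auto simp: positions_def nth_append)
  then show "card {a \<in> positions S (ls @ ys). a < ?i} = k" using card_pick_le[OF k] by simp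
qed

lemma positions_append_disjoint:
  assumes "set ys \<inter> S = {}"
  shows "positions S (ls @ ys) = positions S ls"
proof -
  have "i < length ls" if "i < length (ls @ ys)" "(ls @ ys) ! i \<in> S" for i
  proof (rule ccontr)
    assume "\<not> i < length ls"
    then have "(ls @ ys) ! i \<in> set ys" using that(1) by (simp add: nth_append)
    then show False using assms that(2) by blast
  qed
  then have "positions S (ls @ ys) \<subseteq> positions S ls" by (fastforce simp: positions_def nth_append)
  then show ?thesis using positions_append_subset by blast
qed

text \<open>A row labeled \<open>\<pi>\<close> enters the matrix at \<open>\<tau>\<close> only if
  \<open>\<tau> \<le> \<pi>\<close>. This protects what has been achieved at \<open>\<tau>\<close>
  against rows added later.\<close>

lemma at_star_row_extension:
  assumes "labeled B" "row_extension D B B'" and D: "\<And>\<pi>. \<pi> \<in> D \<Longrightarrow> \<not> \<tau> \<le> \<pi>"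
  shows "at_star B' \<tau> = at_star B \<tau>" "positions {\<tau>..} (row_labels B') = positions {\<tau>..} (row_labels B)"
proof -
  obtain r where r: "row_labels B' = row_labels B @ r" "set r \<subseteq> D" and c: "col_labels B' = col_labels B"
    and e: "\<And>i j. i < length (row_labels B) \<Longrightarrow> j < length (col_labels B) \<Longrightarrow> entries B' $$ (i, j) = entries B $$ (i, j)"
    and L: "labeled B'"
    using assms(2) unfolding row_extension_def by blast
  have "set r \<inter> {\<tau>..} = {}" using r(2) D by auto
  then show p: "positions {\<tau>..} (row_labels B') = positions {\<tau>..} (row_labels B)"
    unfolding r(1) by (rule positions_append_disjoint)
  note cB = lmatD(1)[OF assms(1)[unfolded labeled_def]] and cB' = lmatD(1)[OF L[unfolded labeled_def]]
  show "at_star B' \<tau> = at_star B \<tau>"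
    unfolding at_star_eq_block
  proof (rule block_eqI[OF cB'])
    show "block {\<tau>..} (row_labels B) (col_labels B) (entries B) \<in>
      carrier_mat (card (positions {\<tau>..} (row_labels B'))) (card (positions {\<tau>..} (col_labels B')))"
      using dim_block(1)[OF cB] unfolding p c .
    fix i j assume ij: "i < card (positions {\<tau>..} (row_labels B'))" "j < card (positions {\<tau>..} (col_labels B'))"
    then show "block {\<tau>..} (row_labels B) (col_labels B) (entries B) $$ (i, j) =
       entries B' $$ (pick (positions {\<tau>..} (row_labels B')) i, pick (positions {\<tau>..} (col_labels B')) j)"
      unfolding p c using e cB by (simp add: block_index pick_positions)
  qed
qed

section \<open>Appending a single row\<close>

lemma row_labels_append_row[simp]: "row_labels (append_row B \<pi> v) = row_labels B @ [\<pi>]"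
  and col_labels_append_row[simp]: "col_labels (append_row B \<pi> v) = col_labels B"
  by (simp_all add: append_row_def)

lemma entries_append_row:
  assumes "labeled B"
  shows "entries (append_row B \<pi> v) \<in> carrier_mat (Suc (length (row_labels B))) (length (col_labels B))"
    and "i < Suc (length (row_labels B)) \<Longrightarrow> j < length (col_labels B) \<Longrightarrow> entries (append_row B \<pi> v) $$ (i, j) =
      (if i < length (row_labels B) then entries B $$ (i, j) else v $ j)"
  using lmatD(1)[OF assms[unfolded labeled_def]]
  by (auto simp: append_row_def append_rows_def mat_of_rows_index intro!: carrier_matI)

lemma spread_index: "j < length ls \<Longrightarrow> spread S ls v $ j = (if ls ! j \<in> S then v $ idx S ls j else 0)"
  by (simp add: spread_def idx_def)

lemma labeled_append_row:
  assumes "labeled B"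
  shows "labeled (append_row B \<pi> (spread {\<pi>..} (col_labels B) b))"
  unfolding labeled_def lmat_def
proof (intro conjI allI impI)
  let ?v = "spread {\<pi>..} (col_labels B) b"
  let ?B = "append_row B \<pi> ?v"
  show "entries ?B \<in> carrier_mat (length (row_labels ?B)) (length (col_labels ?B))"
    using entries_append_row(1)[OF assms] by simp
  fix i j assume ij: "i < length (row_labels ?B)" "j < length (col_labels ?B)" and nz: "entries ?B $$ (i, j) \<noteq> 0"
  show "row_labels ?B ! i \<le> col_labels ?B ! j"
  proof (cases "i < length (row_labels B)")
    case True
    then show ?thesis using lmatD(2)[OF assms[unfolded labeled_def], of i j] ij nz
      by (simp add: entries_append_row(2)[OF assms] nth_append)
  next
    case False
    then show ?thesis using ij nz
      by (simp add: entries_append_row(2)[OF assms] nth_append spread_index split: if_splits)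
  qed
qed

lemma row_extension_append_row:
  "labeled B \<Longrightarrow> row_extension {\<pi>} B (append_row B \<pi> (spread {\<pi>..} (col_labels B) b))"
  unfolding row_extension_def using labeled_append_row entries_append_row(2) by fastforce

lemma positions_snoc: "x \<in> S \<Longrightarrow> positions S (ls @ [x]) = insert (length ls) (positions S ls)"
  by (auto simp: positions_def nth_append less_Suc_eq)

lemma pick_snoc:
  assumes "x \<in> S"
  shows "pick (positions S (ls @ [x])) (card (positions S ls)) = length ls"
proof (rule pick_eqI)
  have "{a \<in> positions S (ls @ [x]). a < length ls} = positions S ls"
    by (auto simp: positions_def nth_append)
  then show "card {a \<in> positions S (ls @ [x]). a < length ls} = card (positions S ls)" by simp
qed (use assms in \<open>simp add: positions_snoc\<close>)

lemma card_positions_snoc: "x \<in> S \<Longrightarrow> card (positions S (ls @ [x])) = Suc (card (positions S ls))"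
  unfolding positions_snoc by (subst card_insert_disjoint) (auto simp: positions_def)

lemma transpose_mult_vec_index:
  fixes A :: "'k::field mat"
  assumes "A \<in> carrier_mat m n" "c \<in> carrier_vec m" "l < n"
  shows "(transpose_mat A *\<^sub>v c) $ l = (\<Sum>k<m. A $$ (k, l) * c $ k)"
  using assms by (auto simp: scalar_prod_def lessThan_atLeast0 intro!: sum.cong)

text \<open>As \<open>\<pi>\<close> lies in its own star, the appended row is the last one at
  \<open>\<pi>\<close>, and \<open>spread\<close> reads back as \<open>b\<close>. A combination of
  rows thus splits into one of the old rows and the last coefficient times \<open>b\<close>.\<close>

lemma at_star_append_row:
  assumes B: "labeled B" and b: "b \<in> carrier_vec (coldim B \<pi>)" and c: "c \<in> carrier_vec (Suc (rowdim B \<pi>))"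
  defines "B' \<equiv> append_row B \<pi> (spread {\<pi>..} (col_labels B) b)"
  shows "transpose_mat (at_star B' \<pi>) *\<^sub>v c =
    transpose_mat (at_star B \<pi>) *\<^sub>v vec (rowdim B \<pi>) (\<lambda>k. c $ k) + c $ rowdim B \<pi> \<cdot>\<^sub>v b"
proof (rule eq_vecI)
  have B': "labeled B'" unfolding B'_def by (rule labeled_append_row[OF B])
  have rd: "rowdim B' \<pi> = Suc (rowdim B \<pi>)" by (simp add: B'_def card_positions_snoc)
  note cs = at_star_carrier[OF B, of \<pi>]
  have cs': "at_star B' \<pi> \<in> carrier_mat (Suc (rowdim B \<pi>)) (coldim B \<pi>)"
    using at_star_carrier[OF B', of \<pi>] rd by (simp add: B'_def)
  note eB = lmatD(1)[OF B[unfolded labeled_def]] and eB' = lmatD(1)[OF B'[unfolded labeled_def]]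
  fix l assume "l < dim_vec (transpose_mat (at_star B \<pi>) *\<^sub>v vec (rowdim B \<pi>) (\<lambda>k. c $ k) + c $ rowdim B \<pi> \<cdot>\<^sub>v b)"
  then have l: "l < coldim B \<pi>" using b by simp
  let ?j = "pick (positions {\<pi>..} (col_labels B)) l"
  have j: "?j < length (col_labels B)" "col_labels B ! ?j \<in> {\<pi>..}" using pick_positions[OF l] by auto
  have 1: "at_star B' \<pi> $$ (k, l) = at_star B \<pi> $$ (k, l)" if k: "k < rowdim B \<pi>" for k
  proof -
    have "at_star B' \<pi> $$ (k, l) = entries B' $$ (pick (positions {\<pi>..} (row_labels B')) k, pick (positions {\<pi>..} (col_labels B')) l)"
      unfolding at_star_eq_block using k l by (intro block_index[OF eB']) (simp_all add: rd, simp add: B'_def)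
    also have "\<dots> = entries B $$ (pick (positions {\<pi>..} (row_labels B)) k, ?j)"
      using pick_positions[OF k] j by (simp add: B'_def pick_append[OF k] entries_append_row(2)[OF B] less_Suc_eq)
    also have "\<dots> = at_star B \<pi> $$ (k, l)"
      unfolding at_star_eq_block by (rule block_index[OF eB k l, symmetric])
    finally show ?thesis .
  qed
  have 2: "at_star B' \<pi> $$ (rowdim B \<pi>, l) = b $ l"
  proof -
    have "at_star B' \<pi> $$ (rowdim B \<pi>, l) =
      entries B' $$ (pick (positions {\<pi>..} (row_labels B')) (rowdim B \<pi>), pick (positions {\<pi>..} (col_labels B')) l)"
      unfolding at_star_eq_block using l by (intro block_index[OF eB']) (simp_all add: rd, simp add: B'_def)
    also have "\<dots> = b $ l"
      using j by (simp add: B'_def pick_snoc entries_append_row(2)[OF B] spread_index idx_pick[OF l])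
    finally show ?thesis .
  qed
  have "(transpose_mat (at_star B' \<pi>) *\<^sub>v c) $ l = (\<Sum>k<rowdim B \<pi>. at_star B \<pi> $$ (k, l) * c $ k) + b $ l * c $ rowdim B \<pi>"
    unfolding transpose_mult_vec_index[OF cs' c l] using 1 2 by simp
  also have "(\<Sum>k<rowdim B \<pi>. at_star B \<pi> $$ (k, l) * c $ k) = (transpose_mat (at_star B \<pi>) *\<^sub>v vec (rowdim B \<pi>) (\<lambda>k. c $ k)) $ l"
    by (subst transpose_mult_vec_index[OF cs _ l]) (auto intro!: sum.cong)
  finally show "(transpose_mat (at_star B' \<pi>) *\<^sub>v c) $ l =
     (transpose_mat (at_star B \<pi>) *\<^sub>v vec (rowdim B \<pi>) (\<lambda>k. c $ k) + c $ rowdim B \<pi> \<cdot>\<^sub>v b) $ l"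
    using l b cs by simp
qed (use b at_star_carrier[OF labeled_append_row[OF B, of \<pi> b], of \<pi>] in \<open>simp add: B'_def\<close>)

text \<open>Orthogonality is known for the columns at the star of \<open>\<pi>\<close>. In a column
  whose label is not above \<open>\<pi>\<close>, the rows with labels in the star have zero entries.
  Hence the new row is orthogonal to every column of \<open>A\<close>, not only to those at
  \<open>\<pi>\<close>.\<close>

lemma spread_mult_zero:
  assumes A: "labeled A" and b: "b \<in> carrier_vec (rowdim A \<pi>)"
    and orth: "transpose_mat (at_star A \<pi>) *\<^sub>v b = 0\<^sub>v (coldim A \<pi>)" and j: "j < length (col_labels A)"
  shows "(\<Sum>i<length (row_labels A). spread {\<pi>..} (row_labels A) b $ i * entries A $$ (i, j)) = 0"
proof -
  note eA = lmatD[OF A[unfolded labeled_def]]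
  have "(\<Sum>i<length (row_labels A). spread {\<pi>..} (row_labels A) b $ i * entries A $$ (i, j)) =
     (\<Sum>i\<in>positions {\<pi>..} (row_labels A). spread {\<pi>..} (row_labels A) b $ i * entries A $$ (i, j))"
    by (intro sum.mono_neutral_cong_right) (auto simp: positions_def spread_index)
  also have "\<dots> = (\<Sum>k<rowdim A \<pi>. b $ k * entries A $$ (pick (positions {\<pi>..} (row_labels A)) k, j))"
    unfolding sum_positions using pick_positions(2)[of _ "{\<pi>..}" "row_labels A"]
    by (intro sum.cong) (auto simp: spread_index pick_positions idx_pick)
  also have "\<dots> = 0"
  proof (cases "\<pi> \<le> col_labels A ! j")
    case True
    then obtain l where l: "l < coldim A \<pi>" "pick (positions {\<pi>..} (col_labels A)) l = j"
      using obtain_pick[OF j, of "{\<pi>..}"] by auto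
    have "(\<Sum>k<rowdim A \<pi>. b $ k * entries A $$ (pick (positions {\<pi>..} (row_labels A)) k, j)) =
      (\<Sum>k<rowdim A \<pi>. at_star A \<pi> $$ (k, l) * b $ k)"
      using l by (intro sum.cong) (auto simp: at_star_eq_block block_index[OF eA(1)])
    also have "\<dots> = (transpose_mat (at_star A \<pi>) *\<^sub>v b) $ l"
      by (rule transpose_mult_vec_index[OF at_star_carrier[OF A] b l(1), symmetric])
    finally show ?thesis using orth l by simp
  next
    case False
    have "entries A $$ (pick (positions {\<pi>..} (row_labels A)) k, j) = 0" if k: "k < rowdim A \<pi>" for k
    proof (rule ccontr)
      assume "entries A $$ (pick (positions {\<pi>..} (row_labels A)) k, j) \<noteq> 0"
      then have "row_labels A ! pick (positions {\<pi>..} (row_labels A)) k \<le> col_labels A ! j"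
        using eA(2) pick_positions(1)[OF k] j by blast
      then show False using False pick_positions(2)[OF k] by (metis atLeast_iff order_trans)
    qed
    then show ?thesis by simp
  qed
  finally show ?thesis .
qed

definition composes_to_zero :: "('p::order, 'k::field) labeled_mat \<Rightarrow> ('p, 'k) labeled_mat \<Rightarrow> bool" where
  "composes_to_zero B A \<longleftrightarrow> col_labels B = row_labels A \<and>
     entries B * entries A = 0\<^sub>m (length (row_labels B)) (length (col_labels A))"

lemma composes_to_zero_append_row:
  assumes A: "labeled A" and B: "labeled B" and BA: "composes_to_zero B A" and b: "b \<in> carrier_vec (rowdim A \<pi>)"
    and orth: "transpose_mat (at_star A \<pi>) *\<^sub>v b = 0\<^sub>v (coldim A \<pi>)"
  shows "composes_to_zero (append_row B \<pi> (spread {\<pi>..} (col_labels B) b)) A"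
proof -
  have cr: "col_labels B = row_labels A" and z: "entries B * entries A = 0\<^sub>m (length (row_labels B)) (length (col_labels A))"
    using BA unfolding composes_to_zero_def by auto
  let ?B = "append_row B \<pi> (spread {\<pi>..} (col_labels B) b)"
  note eA = lmatD(1)[OF A[unfolded labeled_def]] and eB = lmatD(1)[OF B[unfolded labeled_def], unfolded cr]
  note eB' = entries_append_row(1)[OF B, of \<pi> "spread {\<pi>..} (col_labels B) b", unfolded cr]
  have "entries ?B * entries A = 0\<^sub>m (length (row_labels ?B)) (length (col_labels A))"
  proof (rule eq_matI)
    fix i j assume "i < dim_row (0\<^sub>m (length (row_labels ?B)) (length (col_labels A)) :: 'b mat)"
      "j < dim_col (0\<^sub>m (length (row_labels ?B)) (length (col_labels A)) :: 'b mat)"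
    then have ij: "i < Suc (length (row_labels B))" "j < length (col_labels A)" by auto
    have e: "(entries ?B * entries A) $$ (i, j) = (\<Sum>l<length (row_labels A). entries ?B $$ (i, l) * entries A $$ (l, j))"
      using mult_mat_index[OF eB' eA ij] cr by simp
    have "(entries ?B * entries A) $$ (i, j) = 0"
    proof (cases "i < length (row_labels B)")
      case True
      then have "(entries ?B * entries A) $$ (i, j) = (\<Sum>l<length (row_labels A). entries B $$ (i, l) * entries A $$ (l, j))"
        unfolding e using ij cr by (intro sum.cong) (auto simp: entries_append_row(2)[OF B])
      also have "\<dots> = (entries B * entries A) $$ (i, j)" by (rule mult_mat_index[OF eB eA True ij(2), symmetric])
      finally show ?thesis using z True ij by simp
    next
      case False
      then have "(entries ?B * entries A) $$ (i, j) = (\<Sum>l<length (row_labels A). spread {\<pi>..} (row_labels A) b $ l * entries A $$ (l, j))"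
        unfolding e using ij cr by (intro sum.cong) (auto simp: entries_append_row(2)[OF B])
      then show ?thesis using spread_mult_zero[OF A b orth ij(2)] by simp
    qed
    then show "(entries ?B * entries A) $$ (i, j) = 0\<^sub>m (length (row_labels ?B)) (length (col_labels A)) $$ (i, j)"
      using ij by simp
  qed (use eB' eA cr in auto)
  then show ?thesis unfolding composes_to_zero_def using cr by simp
qed

text \<open>The test in \<open>try_row\<close> is what keeps independence. If a relation involved
  the new row with a nonzero coefficient, dividing by it would put \<open>b\<close> into the row
  space, and nothing would have been appended. What remains is a relation among the old
  rows.\<close>

lemma try_row_step:
  assumes A: "labeled A" and B: "labeled B" and BA: "composes_to_zero B A" and b: "b \<in> carrier_vec (rowdim A \<pi>)"
    and orth: "transpose_mat (at_star A \<pi>) *\<^sub>v b = 0\<^sub>v (coldim A \<pi>)"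
  shows "row_extension {\<pi>} B (try_row \<pi> b B)" "composes_to_zero (try_row \<pi> b B) A"
    "in_row_space (at_star (try_row \<pi> b B) \<pi>) b"
    "in_row_space (at_star B \<pi>) v \<Longrightarrow> in_row_space (at_star (try_row \<pi> b B) \<pi>) v"
    "independent_at B \<pi> \<Longrightarrow> independent_at (try_row \<pi> b B) \<pi>"
proof -
  have cr: "col_labels B = row_labels A" using BA unfolding composes_to_zero_def by auto
  have b': "b \<in> carrier_vec (coldim B \<pi>)" using b cr by simp
  let ?B = "append_row B \<pi> (spread {\<pi>..} (col_labels B) b)"
  have t: "try_row \<pi> b B = (if in_row_space (at_star B \<pi>) b then B else ?B)"
    unfolding try_row_def row_space_iff ..
  note cs = at_star_carrier[OF B, of \<pi>]
  have rd: "rowdim ?B \<pi> = Suc (rowdim B \<pi>)" by (simp add: card_positions_snoc)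
  have dr: "dim_row (at_star ?B \<pi>) = Suc (rowdim B \<pi>)"
    using at_star_carrier[OF labeled_append_row[OF B], of \<pi> b \<pi>] rd by simp
  show "row_extension {\<pi>} B (try_row \<pi> b B)"
    unfolding t using row_extension_append_row[OF B] row_extension_refl[OF B] by simp
  show "composes_to_zero (try_row \<pi> b B) A"
    unfolding t using BA composes_to_zero_append_row[OF A B BA b orth] by simp
  have new: "in_row_space (at_star ?B \<pi>) b"
    unfolding in_row_space_def dr
  proof (intro bexI)
    have "vec (rowdim B \<pi>) (\<lambda>k. (unit_vec (Suc (rowdim B \<pi>)) (rowdim B \<pi>)) $ k) = (0\<^sub>v (rowdim B \<pi>) :: 'b vec)"
      by (intro eq_vecI) auto
    then show "b = transpose_mat (at_star ?B \<pi>) *\<^sub>v unit_vec (Suc (rowdim B \<pi>)) (rowdim B \<pi>)"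
      using cs b' by (subst at_star_append_row[OF B b']) (auto simp: mult_mat_zero_vec[OF transpose_carrier_mat[THEN iffD2, OF cs]])
  qed simp
  then show "in_row_space (at_star (try_row \<pi> b B) \<pi>) b" unfolding t by simp
  show "in_row_space (at_star (try_row \<pi> b B) \<pi>) v" if v: "in_row_space (at_star B \<pi>) v"
  proof -
    obtain c where c: "c \<in> carrier_vec (rowdim B \<pi>)" "v = transpose_mat (at_star B \<pi>) *\<^sub>v c"
      using v cs unfolding in_row_space_def by auto
    let ?c = "vec (Suc (rowdim B \<pi>)) (\<lambda>k. if k < rowdim B \<pi> then c $ k else 0)"
    have "vec (rowdim B \<pi>) (\<lambda>k. ?c $ k) = c" using c(1) by (intro eq_vecI) auto
    then have "v = transpose_mat (at_star ?B \<pi>) *\<^sub>v ?c"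
      using c cs b' by (subst at_star_append_row[OF B b']) auto
    then have "in_row_space (at_star ?B \<pi>) v" unfolding in_row_space_def dr by (intro bexI[of _ ?c]) auto
    then show ?thesis using v unfolding t by simp
  qed
  show "independent_at (try_row \<pi> b B) \<pi>" if ind: "independent_at B \<pi>"
  proof (cases "in_row_space (at_star B \<pi>) b")
    case True
    then show ?thesis using ind unfolding t by simp
  next
    case False
    have "independent_at ?B \<pi>"
      unfolding independent_at_def rd
    proof (intro ballI impI allI)
      fix c k assume c: "c \<in> carrier_vec (Suc (rowdim B \<pi>))" and z: "transpose_mat (at_star ?B \<pi>) *\<^sub>v c = 0\<^sub>v (coldim ?B \<pi>)"
        and k: "k < Suc (rowdim B \<pi>)" and lab: "row_labels ?B ! pick (positions {\<pi>..} (row_labels ?B)) k = \<pi>"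
      let ?c = "vec (rowdim B \<pi>) (\<lambda>k. c $ k)" and ?m = "rowdim B \<pi>"
      have e: "transpose_mat (at_star B \<pi>) *\<^sub>v ?c + c $ ?m \<cdot>\<^sub>v b = 0\<^sub>v (coldim B \<pi>)"
        using z unfolding at_star_append_row[OF B b' c] by simp
      have cm: "c $ ?m = 0"
      proof (rule ccontr)
        assume nz: "c $ ?m \<noteq> 0"
        have "b = transpose_mat (at_star B \<pi>) *\<^sub>v (- (1 / c $ ?m) \<cdot>\<^sub>v ?c)"
        proof (rule eq_vecI)
          fix l assume "l < dim_vec (transpose_mat (at_star B \<pi>) *\<^sub>v (- (1 / c $ ?m) \<cdot>\<^sub>v ?c))"
          then have l: "l < coldim B \<pi>" using cs by simp
          have "(transpose_mat (at_star B \<pi>) *\<^sub>v ?c + c $ ?m \<cdot>\<^sub>v b) $ l = 0" unfolding e using l by simp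
          then have "(transpose_mat (at_star B \<pi>) *\<^sub>v ?c) $ l + c $ ?m * b $ l = 0"
            using l b' cs by simp
          then have bl: "b $ l = - (1 / c $ ?m) * (transpose_mat (at_star B \<pi>) *\<^sub>v ?c) $ l"
            using nz by (simp add: field_simps add_eq_0_iff)
          have "(transpose_mat (at_star B \<pi>) *\<^sub>v (- (1 / c $ ?m) \<cdot>\<^sub>v ?c)) = - (1 / c $ ?m) \<cdot>\<^sub>v (transpose_mat (at_star B \<pi>) *\<^sub>v ?c)"
            by (rule mult_mat_vec[OF transpose_carrier_mat[THEN iffD2, OF cs]]) simp
          then show "b $ l = (transpose_mat (at_star B \<pi>) *\<^sub>v (- (1 / c $ ?m) \<cdot>\<^sub>v ?c)) $ l"
            using bl l cs by simp
        qed (use b' cs in simp)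
        then have "in_row_space (at_star B \<pi>) b" unfolding in_row_space_def
          using cs by (intro bexI[of _ "- (1 / c $ ?m) \<cdot>\<^sub>v ?c"]) auto
        then show False using False by simp
      qed
      have "transpose_mat (at_star B \<pi>) *\<^sub>v ?c = 0\<^sub>v (coldim B \<pi>)"
      proof (rule eq_vecI)
        fix l assume "l < dim_vec (0\<^sub>v (coldim B \<pi>) :: 'b vec)"
        then have l: "l < coldim B \<pi>" by simp
        have "(transpose_mat (at_star B \<pi>) *\<^sub>v ?c + c $ ?m \<cdot>\<^sub>v b) $ l = 0" unfolding e using l by simp
        then show "(transpose_mat (at_star B \<pi>) *\<^sub>v ?c) $ l = 0\<^sub>v (coldim B \<pi>) $ l"
          using l b' cs cm by simp
      qed (use cs in simp)
      then have i: "\<forall>k<?m. row_labels B ! pick (positions {\<pi>..} (row_labels B)) k = \<pi> \<longrightarrow> ?c $ k = 0"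
        using ind unfolding independent_at_def by simp
      show "c $ k = 0"
      proof (cases "k < ?m")
        case True
        then have "row_labels B ! pick (positions {\<pi>..} (row_labels B)) k = \<pi>"
          using lab pick_positions(1)[OF True] by (simp add: pick_append[OF True] nth_append)
        then show ?thesis using i True by simp
      next
        case False
        then show ?thesis using k cm by (simp add: less_Suc_eq)
      qed
    qed
    then show ?thesis using False unfolding t by simp
  qed
qed

section \<open>MakeExact at one point and along an enumeration\<close>

lemma fold_try_row:
  assumes A: "labeled A" and B: "labeled B" and BA: "composes_to_zero B A"
    and bs: "\<And>b. b \<in> set bs \<Longrightarrow> b \<in> carrier_vec (rowdim A \<pi>) \<and> transpose_mat (at_star A \<pi>) *\<^sub>v b = 0\<^sub>v (coldim A \<pi>)"
    and ind: "independent_at B \<pi>"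
  defines "B' \<equiv> fold (try_row \<pi>) bs B"
  shows "row_extension {\<pi>} B B' \<and> composes_to_zero B' A \<and> independent_at B' \<pi> \<and>
     (\<forall>b\<in>set bs. in_row_space (at_star B' \<pi>) b) \<and> (\<forall>v. in_row_space (at_star B \<pi>) v \<longrightarrow> in_row_space (at_star B' \<pi>) v)"
  using B BA bs ind unfolding B'_def
proof (induction bs arbitrary: B)
  case Nil
  then show ?case using row_extension_refl by auto
next
  case (Cons b bs)
  let ?B = "try_row \<pi> b B"
  have b: "b \<in> carrier_vec (rowdim A \<pi>)" "transpose_mat (at_star A \<pi>) *\<^sub>v b = 0\<^sub>v (coldim A \<pi>)" using Cons.prems(3) by auto
  note s = try_row_step[OF A Cons.prems(1,2) b]
  have "labeled ?B" using s(1) unfolding row_extension_def by blast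
  note IH = Cons.IH[OF this s(2) Cons.prems(3) s(5)[OF Cons.prems(4)]]
  show ?case using IH s(3,4) row_extension_trans[OF s(1)] by auto
qed

text \<open>Adjunction of \<open>M\<close> and its transpose, tested on unit vectors. It lets bases
  of the complement be treated as bases of a kernel.\<close>

lemma orthogonal_complement_image:
  fixes M :: "'k::field mat"
  assumes M: "M \<in> carrier_mat n a"
  shows "vec_module.orthogonal_complement n (mat_image M) = mat_kernel (transpose_mat M)"
proof -
  have "b \<in> carrier_vec n \<and> (\<forall>y\<in>mat_image M. b \<bullet> y = 0) \<longleftrightarrow> b \<in> carrier_vec n \<and> transpose_mat M *\<^sub>v b = 0\<^sub>v a" for b
  proof (cases "b \<in> carrier_vec n")
    case b: True
    have *: "b \<bullet> (M *\<^sub>v u) = (transpose_mat M *\<^sub>v b) \<bullet> u" if "u \<in> carrier_vec a" for u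
      using transpose_vec_mult_scalar[OF M that b] by simp
    show ?thesis
    proof
      assume l: "b \<in> carrier_vec n \<and> (\<forall>y\<in>mat_image M. b \<bullet> y = 0)"
      have "transpose_mat M *\<^sub>v b = 0\<^sub>v a"
      proof (rule eq_vecI)
        fix j assume "j < dim_vec (0\<^sub>v a :: 'k vec)"
        then have j: "j < a" by simp
        have "M *\<^sub>v unit_vec a j \<in> mat_image M" using M unfolding mat_image_def by (intro CollectI exI[of _ "unit_vec a j"]) auto
        then have "(transpose_mat M *\<^sub>v b) \<bullet> unit_vec a j = 0" using l * by force
        then show "(transpose_mat M *\<^sub>v b) $ j = 0\<^sub>v a $ j" using j M by simp
      qed (use M in simp)
      then show "b \<in> carrier_vec n \<and> transpose_mat M *\<^sub>v b = 0\<^sub>v a" using b by simp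
    next
      assume "b \<in> carrier_vec n \<and> transpose_mat M *\<^sub>v b = 0\<^sub>v a"
      then show "b \<in> carrier_vec n \<and> (\<forall>y\<in>mat_image M. b \<bullet> y = 0)" using * M by (auto simp: mat_image_def)
    qed
  qed simp
  then show ?thesis
    using M unfolding vec_module.orthogonal_complement_def by (auto simp: mat_kernel)
qed

text \<open>The basis spans the kernel viewed as a vector space of its own, while the row space
  lives in the full coordinate space; \<open>span_same\<close> identifies the two spans. A row space
  that contains the basis therefore contains the kernel.\<close>

lemma basis_list_spans:
  fixes M A :: "'k::field mat"
  assumes M: "M \<in> carrier_mat n a"
    and bs: "basis_list n (mat_kernel (transpose_mat M)) bs"
  shows "b \<in> set bs \<Longrightarrow> b \<in> mat_kernel (transpose_mat M)"
    and "A \<in> carrier_mat m n \<Longrightarrow> (\<And>b. b \<in> set bs \<Longrightarrow> in_row_space A b) \<Longrightarrow>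
       b \<in> mat_kernel (transpose_mat M) \<Longrightarrow> in_row_space A b"
proof -
  have MT: "transpose_mat M \<in> carrier_mat a n" using M by simp
  interpret kernel a n "transpose_mat M" by unfold_locales (rule MT)
  have B: "Ker.basis (set bs)" using bs unfolding basis_list_def by simp
  then have sub: "set bs \<subseteq> mat_kernel (transpose_mat M)" and gen: "span (set bs) = mat_kernel (transpose_mat M)"
    unfolding Ker.basis_def by auto
  show "b \<in> set bs \<Longrightarrow> b \<in> mat_kernel (transpose_mat M)" using sub by blast
  assume A: "A \<in> carrier_mat m n" and in_A: "\<And>b. b \<in> set bs \<Longrightarrow> in_row_space A b"
    and b: "b \<in> mat_kernel (transpose_mat M)"
  have dA: "dim_col A = n" using A by simp
  have "set (rows A) \<subseteq> carrier_vec n" using A by (auto simp: rows_def)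
  then have "submodule class_ring (NC.span (set (rows A))) NC.V" by (intro NC.span_is_submodule) auto
  moreover have "set bs \<subseteq> NC.span (set (rows A))"
    using in_A row_space_iff[of _ A] unfolding dA NC.row_space_def by auto
  ultimately have "NC.span (set bs) \<subseteq> NC.span (set (rows A))" by (intro NC.span_is_subset)
  then have "b \<in> vec_space.row_space (dim_col A) A"
    using b gen span_same[OF sub] unfolding dA NC.row_space_def by auto
  then show "in_row_space A b" unfolding row_space_iff .
qed

lemma make_exact_step:
  assumes A: "labeled A" and B: "labeled B" and BA: "composes_to_zero B A" and ind: "independent_at B \<pi>"
    and me: "make_exact A \<pi> B B'"
  shows "row_extension {\<pi>} B B'" "composes_to_zero B' A" "independent_at B' \<pi>" "exact_at A B' \<pi>"
proof -
  note cA = at_star_carrier[OF A, of \<pi>]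
  then have dr: "dim_row (at_star A \<pi>) = rowdim A \<pi>" by simp
  have K: "v \<in> mat_kernel (transpose_mat (at_star A \<pi>)) \<longleftrightarrow>
     v \<in> carrier_vec (rowdim A \<pi>) \<and> transpose_mat (at_star A \<pi>) *\<^sub>v v = 0\<^sub>v (coldim A \<pi>)" for v
    using cA by (simp add: mat_kernel[of _ "coldim A \<pi>" "rowdim A \<pi>"])
  obtain bs where bs: "basis_list (rowdim A \<pi>) (mat_kernel (transpose_mat (at_star A \<pi>))) bs" and B': "B' = fold (try_row \<pi>) bs B"
    using me unfolding make_exact_def Let_def dr orthogonal_complement_image[OF cA] by blast
  have f: "row_extension {\<pi>} B B' \<and> composes_to_zero B' A \<and> independent_at B' \<pi> \<and>
     (\<forall>b\<in>set bs. in_row_space (at_star B' \<pi>) b) \<and> (\<forall>v. in_row_space (at_star B \<pi>) v \<longrightarrow> in_row_space (at_star B' \<pi>) v)"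
    unfolding B' using basis_list_spans(1)[OF cA bs] K by (intro fold_try_row[OF A B BA _ ind]) blast
  then show "row_extension {\<pi>} B B'" "composes_to_zero B' A" "independent_at B' \<pi>" by auto
  have lB': "labeled B'" using f unfolding row_extension_def by blast
  have cB': "at_star B' \<pi> \<in> carrier_mat (rowdim B' \<pi>) (rowdim A \<pi>)"
    using at_star_carrier[OF lB', of \<pi>] f unfolding composes_to_zero_def by auto
  show "exact_at A B' \<pi>"
    unfolding exact_at_def using basis_list_spans(2)[OF cA bs cB'] f K by blast
qed

lemma make_exact_exists: "labeled A \<Longrightarrow> \<exists>B'. make_exact A \<pi> B B'"
proof -
  assume A: "labeled A"
  note cA = at_star_carrier[OF A, of \<pi>]
  then have dr: "dim_row (at_star A \<pi>) = rowdim A \<pi>" by simp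
  obtain S where S: "finite S" "kernel.basis (rowdim A \<pi>) (transpose_mat (at_star A \<pi>)) S"
    using kernel_basis_exists[of "transpose_mat (at_star A \<pi>)" "coldim A \<pi>" "rowdim A \<pi>"] cA by auto
  obtain bs where "set bs = S" "distinct bs" using finite_distinct_list[OF S(1)] by blast
  then have "basis_list (rowdim A \<pi>) (mat_kernel (transpose_mat (at_star A \<pi>))) bs"
    using S(2) unfolding basis_list_def by simp
  then show ?thesis
    unfolding make_exact_def Let_def dr orthogonal_complement_image[OF cA] by blast
qed

lemma make_exact_along_exists: "labeled A \<Longrightarrow> \<exists>B'. make_exact_along A \<pi>s B B'"
proof (induction \<pi>s arbitrary: B)
  case (Cons \<pi> \<pi>s)
  then show ?case using make_exact_exists[of A \<pi> B] by (metis make_exact_along.simps(2))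
qed (metis make_exact_along.simps(1))

text \<open>Before the turn of \<open>\<pi>\<close> no row is labeled \<open>\<pi>\<close>, so
  independence there is vacuous. Afterwards, by the order of the enumeration, rows are added only
  with labels not above \<open>\<pi>\<close>, so the matrix at \<open>\<pi>\<close> stays as it is,
  and with it independence and exactness.\<close>

lemma make_exact_along_step:
  assumes A: "labeled A" and B: "labeled B" and BA: "composes_to_zero B A"
    and me: "make_exact_along A \<pi>s B B'" and d: "distinct \<pi>s" and s: "sorted_wrt (\<lambda>\<sigma> \<tau>. \<not> \<sigma> < \<tau>) \<pi>s"
    and new: "set (row_labels B) \<inter> set \<pi>s = {}"
  shows "row_extension (set \<pi>s) B B' \<and> composes_to_zero B' A \<and> (\<forall>\<pi>\<in>set \<pi>s. independent_at B' \<pi> \<and> exact_at A B' \<pi>)"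
  using B BA me d s new
proof (induction \<pi>s arbitrary: B)
  case Nil
  then show ?case using row_extension_refl by auto
next
  case (Cons \<pi> \<pi>s)
  obtain B1 where B1: "make_exact A \<pi> B B1" "make_exact_along A \<pi>s B1 B'" using Cons.prems(3) by auto
  have "independent_at B \<pi>"
    unfolding independent_at_def
  proof (intro ballI impI allI)
    fix c k assume k: "k < rowdim B \<pi>" "row_labels B ! pick (positions {\<pi>..} (row_labels B)) k = \<pi>"
    then have "\<pi> \<in> set (row_labels B)" using pick_positions(1)[OF k(1)] by (metis nth_mem)
    then show "c $ k = 0" using Cons.prems(6) by simp
  qed
  note s1 = make_exact_step[OF A Cons.prems(1,2) this B1(1)]
  have lB1: "labeled B1" using s1(1) unfolding row_extension_def by blast
  have "set (row_labels B1) \<subseteq> insert \<pi> (set (row_labels B))" using s1(1) unfolding row_extension_def by auto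
  then have "set (row_labels B1) \<inter> set \<pi>s = {}" using Cons.prems(4,6) by auto
  then have IH: "row_extension (set \<pi>s) B1 B'" "composes_to_zero B' A" "\<forall>\<pi>\<in>set \<pi>s. independent_at B' \<pi> \<and> exact_at A B' \<pi>"
    using Cons.IH[OF lB1 s1(2) B1(2)] Cons.prems(4,5) by auto
  have "\<not> \<pi> \<le> \<rho>" if "\<rho> \<in> set \<pi>s" for \<rho>
    using that Cons.prems(4,5) by (auto simp: order.order_iff_strict)
  then have st: "at_star B' \<pi> = at_star B1 \<pi>" "positions {\<pi>..} (row_labels B') = positions {\<pi>..} (row_labels B1)"
    using at_star_row_extension[OF lB1 IH(1), of \<pi>] by blast+
  have "row_labels B' ! i = row_labels B1 ! i" if "i < length (row_labels B1)" for i
    using IH(1) that unfolding row_extension_def by (auto simp: nth_append)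
  then have "independent_at B' \<pi>"
    using s1(3) IH(1) pick_positions(1)[of _ "{\<pi>..}" "row_labels B1"] unfolding independent_at_def st row_extension_def by simp
  moreover have "exact_at A B' \<pi>" using s1(4) unfolding exact_at_def st(1) .
  ultimately show ?case
    using IH row_extension_trans[OF row_extension_mono[OF s1(1)] row_extension_mono[OF IH(1)], of "set (\<pi> # \<pi>s)"] by auto
qed

section \<open>Runs of the algorithm\<close>

text \<open>A minimal element is removed and placed last.\<close>

lemma non_increasing_enum_exists:
  fixes S :: "'p::order set"
  assumes "finite S" shows "\<exists>\<pi>s. non_increasing_enum S \<pi>s"
  using assms
proof (induction "card S" arbitrary: S)
  case 0
  then show ?case by (intro exI[of _ "[]"]) (simp add: non_increasing_enum_def)
next
  case (Suc n)
  then have "S \<noteq> {}" by auto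
  then obtain m where m: "m \<in> S" "\<forall>b\<in>S. b \<le> m \<longrightarrow> m = b" using finite_has_minimal[OF Suc.prems] by blast
  have "\<exists>\<pi>s. non_increasing_enum (S - {m}) \<pi>s" using Suc m by (intro Suc.hyps) auto
  then obtain \<pi>s where p: "non_increasing_enum (S - {m}) \<pi>s" by blast
  then have "non_increasing_enum S (\<pi>s @ [m])"
    using m by (auto simp: non_increasing_enum_def sorted_wrt_append less_le)
  then show ?case by blast
qed

text \<open>As the product is zero, the entries of a row of \<open>B\<close> are the coefficients of
  a relation among the rows of \<open>A\<close>. A row labeled \<open>\<pi>\<close> has nonzero
  entries only in columns with labels above \<open>\<pi>\<close>, so this is a relation at
  \<open>\<pi>\<close>, and independence kills its coefficients at rows labeled
  \<open>\<pi>\<close>.\<close>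

lemma diagonal_entry_zero:
  assumes A: "labeled A" and B: "labeled B" and BA: "composes_to_zero B A" and ind: "independent_at A \<pi>"
    and r: "r < length (row_labels B)" "row_labels B ! r = \<pi>" and j: "j < length (row_labels A)" "row_labels A ! j = \<pi>"
  shows "entries B $$ (r, j) = 0"
proof -
  have cr: "col_labels B = row_labels A" and z: "entries B * entries A = 0\<^sub>m (length (row_labels B)) (length (col_labels A))"
    using BA unfolding composes_to_zero_def by auto
  note eA = lmatD(1)[OF A[unfolded labeled_def]] and eB = lmatD[OF B[unfolded labeled_def], unfolded cr]
  let ?c = "vec (rowdim A \<pi>) (\<lambda>k. entries B $$ (r, pick (positions {\<pi>..} (row_labels A)) k))"
  have "transpose_mat (at_star A \<pi>) *\<^sub>v ?c = 0\<^sub>v (coldim A \<pi>)"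
  proof (rule eq_vecI)
    fix l assume "l < dim_vec (0\<^sub>v (coldim A \<pi>) :: 'b vec)"
    then have l: "l < coldim A \<pi>" by simp
    let ?l = "pick (positions {\<pi>..} (col_labels A)) l"
    have l': "?l < length (col_labels A)" using pick_positions[OF l] by auto
    have "(transpose_mat (at_star A \<pi>) *\<^sub>v ?c) $ l = (\<Sum>k<rowdim A \<pi>. at_star A \<pi> $$ (k, l) * ?c $ k)"
      by (rule transpose_mult_vec_index[OF at_star_carrier[OF A] _ l]) simp
    also have "\<dots> = (\<Sum>k<rowdim A \<pi>. (\<lambda>x. entries B $$ (r, x) * entries A $$ (x, ?l)) (pick (positions {\<pi>..} (row_labels A)) k))"
      using l by (intro sum.cong) (auto simp: at_star_eq_block block_index[OF eA])
    also have "\<dots> = (\<Sum>x\<in>positions {\<pi>..} (row_labels A). entries B $$ (r, x) * entries A $$ (x, ?l))"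
      by (rule sum_positions[symmetric])
    also have "\<dots> = (\<Sum>x<length (row_labels A). entries B $$ (r, x) * entries A $$ (x, ?l))"
      using eB(2)[OF r(1)] r(2) by (intro sum.mono_neutral_cong_left) (auto simp: positions_def)
    also have "\<dots> = (entries B * entries A) $$ (r, ?l)" by (rule mult_mat_index[OF eB(1) eA r(1) l', symmetric])
    finally show "(transpose_mat (at_star A \<pi>) *\<^sub>v ?c) $ l = 0\<^sub>v (coldim A \<pi>) $ l" using z r(1) l l' by simp
  qed (use at_star_carrier[OF A, of \<pi>] in simp)
  then have "\<forall>k<rowdim A \<pi>. row_labels A ! pick (positions {\<pi>..} (row_labels A)) k = \<pi> \<longrightarrow> ?c $ k = 0"
    using ind unfolding independent_at_def by (metis vec_carrier)
  moreover obtain k where "k < rowdim A \<pi>" "pick (positions {\<pi>..} (row_labels A)) k = j"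
    using obtain_pick[OF j(1), of "{\<pi>..}"] j(2) by auto
  ultimately show ?thesis using j by auto
qed

text \<open>A zero row would itself be a relation, with coefficient one at a row labeled
  \<open>\<pi>\<close>.\<close>

lemma independent_row_nonzero:
  fixes B :: "('p::order, 'k::field) labeled_mat"
  assumes B: "labeled B" and ind: "independent_at B \<pi>" and r: "r < length (row_labels B)" "row_labels B ! r = \<pi>"
  obtains j where "j < length (col_labels B)" "entries B $$ (r, j) \<noteq> 0"
proof -
  note eB = lmatD[OF B[unfolded labeled_def]]
  obtain k where k: "k < rowdim B \<pi>" "pick (positions {\<pi>..} (row_labels B)) k = r"
    using obtain_pick[OF r(1), of "{\<pi>..}"] r(2) by auto
  let ?c = "unit_vec (rowdim B \<pi>) k :: 'k vec"
  have "transpose_mat (at_star B \<pi>) *\<^sub>v ?c \<noteq> 0\<^sub>v (coldim B \<pi>)"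
  proof
    assume z: "transpose_mat (at_star B \<pi>) *\<^sub>v ?c = 0\<^sub>v (coldim B \<pi>)"
    have "?c $ k = 0"
      using ind[unfolded independent_at_def, rule_format, OF unit_vec_carrier z k(1)] k(2) r(2) by simp
    then show False using k by simp
  qed
  moreover have "dim_vec (transpose_mat (at_star B \<pi>) *\<^sub>v ?c) = coldim B \<pi>" using at_star_carrier[OF B, of \<pi>] by simp
  ultimately obtain l where l: "l < coldim B \<pi>" "(transpose_mat (at_star B \<pi>) *\<^sub>v ?c) $ l \<noteq> 0"
    by (metis eq_vecI index_zero_vec(1) index_zero_vec(2))
  have "(transpose_mat (at_star B \<pi>) *\<^sub>v ?c) $ l = at_star B \<pi> $$ (k, l)"
    using k by (simp add: transpose_mult_vec_index[OF at_star_carrier[OF B] unit_vec_carrier l(1)] if_distrib sum.delta cong: if_cong)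
  also have "\<dots> = entries B $$ (r, pick (positions {\<pi>..} (col_labels B)) l)"
    using k l by (simp add: at_star_eq_block block_index[OF eB(1)])
  finally show thesis using that l pick_positions(1)[OF l(1)] by metis
qed

section \<open>Invariants of a run, termination and truncation\<close>

locale pushforward =
  fixes P Z :: "'p::order set" and \<eta>s :: "('p, 'k::field) labeled_mat list"
  assumes finite_P: "finite P" and Z: "locally_closed P Z" and \<eta>s: "labeled_complex Z \<eta>s"
begin

definition C where "C = closure_in P Z - Z"

abbreviation input_labels :: "nat \<Rightarrow> 'p list" where
  "input_labels i \<equiv> fst (input_rows \<eta>s i)"

lemma Z_subset: "Z \<subseteq> P"
  using Z unfolding locally_closed_def by blast

lemma C_subset: "C \<subseteq> P"
  by (auto simp: C_def closure_in_def)

lemma finite_C: "finite C"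
  using finite_subset[OF C_subset finite_P] .

text \<open>Otherwise \<open>\<pi>\<close> would lie between two points of \<open>Z\<close> and
  hence in \<open>Z\<close>, by local closedness. Consequently summands labeled by \<open>C\<close>
  are invisible at points of \<open>Z\<close>.\<close>

lemma not_Z_le_C:
  assumes "\<sigma> \<in> Z" "\<pi> \<in> C" shows "\<not> \<sigma> \<le> \<pi>"
proof
  assume "\<sigma> \<le> \<pi>"
  obtain z where "z \<in> Z" "\<pi> \<le> z" "\<pi> \<in> P" "\<pi> \<notin> Z" using assms(2) by (auto simp: C_def closure_in_def)
  then show False using Z \<open>\<sigma> \<le> \<pi>\<close> assms(1) unfolding locally_closed_def by blast
qed

lemma \<eta>_labeled:
  assumes "i < length \<eta>s"
  shows "labeled (\<eta>s ! i)" "set (row_labels (\<eta>s ! i)) \<subseteq> Z" "input_labels i = row_labels (\<eta>s ! i)"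
  using \<eta>s assms nth_mem[OF assms]
  unfolding labeled_complex_def labeled_matrix_def labeled_def lmat_def input_rows_def by auto

lemma \<eta>_nonempty: "\<eta>s \<noteq> []"
  using \<eta>s by (simp add: labeled_complex_def)

lemma \<eta>_composes: "Suc i < length \<eta>s \<Longrightarrow> composes_to_zero (\<eta>s ! Suc i) (\<eta>s ! i)"
  using \<eta>s by (simp add: labeled_complex_def composes_to_zero_def)

lemma input_labels_subset: "set (input_labels i) \<subseteq> Z"
  using \<eta>_labeled[of i] by (cases "i < length \<eta>s") (auto simp: input_rows_def)

lemma input_labels_beyond: "length \<eta>s \<le> i \<Longrightarrow> input_labels i = []"
  by (simp add: input_rows_def)

text \<open>Input rows come first and added rows have labels in \<open>C\<close>, so the labels in
  \<open>Z\<close> occupy the same initial positions as in the input.\<close>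

definition node :: "nat \<Rightarrow> ('p, 'k) labeled_mat \<Rightarrow> bool" where
  "node i M \<longleftrightarrow> labeled M \<and> (\<exists>rest. row_labels M = input_labels i @ rest \<and> set rest \<subseteq> C) \<and> (\<forall>\<pi>\<in>C. independent_at M \<pi>)"

text \<open>\<open>\<eta>s ! Suc i\<close> is the differential from degree \<open>i\<close> to
  degree \<open>i + 1\<close>; the last condition says that it survives unchanged as the part of
  \<open>B\<close> with labels in \<open>Z\<close>.\<close>

definition link :: "nat \<Rightarrow> ('p, 'k) labeled_mat \<Rightarrow> ('p, 'k) labeled_mat \<Rightarrow> bool" where
  "link i A B \<longleftrightarrow> composes_to_zero B A \<and> (\<forall>\<pi>\<in>C. exact_at A B \<pi>) \<and>
     (\<forall>r<length (input_labels (Suc i)). \<forall>j<length (input_labels i). entries B $$ (r, j) = entries (\<eta>s ! Suc i) $$ (r, j))"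

definition good :: "('p, 'k) labeled_mat list \<Rightarrow> bool" where
  "good \<delta>s \<longleftrightarrow> \<delta>s \<noteq> [] \<and> col_labels (hd \<delta>s) = [] \<and> (\<forall>i<length \<delta>s. node i (\<delta>s ! i)) \<and>
     (\<forall>i. Suc i < length \<delta>s \<longrightarrow> link i (\<delta>s ! i) (\<delta>s ! Suc i))"

lemma goodD:
  assumes "good \<delta>s"
  shows "\<delta>s \<noteq> []" "col_labels (hd \<delta>s) = []" "i < length \<delta>s \<Longrightarrow> node i (\<delta>s ! i)"
    "Suc i < length \<delta>s \<Longrightarrow> link i (\<delta>s ! i) (\<delta>s ! Suc i)"
  using assms unfolding good_def by blast+

lemma good_snoc:
  assumes g: "good \<delta>s" and n: "node (length \<delta>s) B" and l: "link (length \<delta>s - 1) (last \<delta>s) B"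
  shows "good (\<delta>s @ [B])"
  unfolding good_def
proof (intro conjI allI impI)
  show "col_labels (hd (\<delta>s @ [B])) = []" using goodD(1,2)[OF g] by simp
  show "node i ((\<delta>s @ [B]) ! i)" if "i < length (\<delta>s @ [B])" for i
    using that n goodD(3)[OF g] by (cases "i < length \<delta>s") (auto simp: nth_append less_Suc_eq)
  show "link i ((\<delta>s @ [B]) ! i) ((\<delta>s @ [B]) ! Suc i)" if "Suc i < length (\<delta>s @ [B])" for i
  proof (cases "Suc i < length \<delta>s")
    case False
    then have "Suc i = length \<delta>s" using that by simp
    then show ?thesis using l goodD(1)[OF g] by (simp add: nth_append last_conv_nth flip: \<open>Suc i = length \<delta>s\<close>)
  qed (use goodD(4)[OF g] in \<open>simp add: nth_append\<close>)
qed simp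

lemma good_take: "good \<delta>s \<Longrightarrow> 0 < k \<Longrightarrow> good (take k \<delta>s)"
  unfolding good_def by (cases \<delta>s) (auto simp: hd_take)

lemma node_row_labels:
  assumes "node i M"
  shows "set (row_labels M) \<subseteq> Z \<union> C" "j < length (input_labels i) \<Longrightarrow> row_labels M ! j = input_labels i ! j"
    "j < length (input_labels i) \<Longrightarrow> row_labels M ! j \<in> Z"
    "length (input_labels i) \<le> j \<Longrightarrow> j < length (row_labels M) \<Longrightarrow> row_labels M ! j \<in> C"
    "length (input_labels i) \<le> length (row_labels M)"
proof -
  obtain rest where r: "row_labels M = input_labels i @ rest" "set rest \<subseteq> C" using assms unfolding node_def by blast
  show "set (row_labels M) \<subseteq> Z \<union> C" using r input_labels_subset[of i] by auto
  show n: "j < length (input_labels i) \<Longrightarrow> row_labels M ! j = input_labels i ! j" using r by (simp add: nth_append)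
  then show "j < length (input_labels i) \<Longrightarrow> row_labels M ! j \<in> Z"
    using input_labels_subset[of i] nth_mem by (metis subsetD)
  show "length (input_labels i) \<le> j \<Longrightarrow> j < length (row_labels M) \<Longrightarrow> row_labels M ! j \<in> C"
    using r by (simp add: nth_append subset_iff)
  show "length (input_labels i) \<le> length (row_labels M)" using r by simp
qed

lemma C_disjoint: "\<pi> \<in> C \<Longrightarrow> \<pi> \<notin> Z"
  by (simp add: C_def)

text \<open>The initial matrix has no columns, so every combination of its rows is a relation.
  Independence at \<open>C\<close> holds nevertheless, because all its row labels lie in
  \<open>Z\<close>.\<close>

lemma good_init: "good (push_init \<eta>s)"
proof -
  let ?l = "row_labels (hd \<eta>s)"
  have h: "hd \<eta>s = \<eta>s ! 0" using \<eta>_nonempty by (simp add: hd_conv_nth)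
  have i: "input_labels 0 = ?l" using \<eta>_labeled(3)[of 0] \<eta>_nonempty by (simp add: h)
  let ?M = "\<lparr>row_labels = ?l, col_labels = [], entries = 0\<^sub>m (length ?l) 0\<rparr> :: ('p, 'k) labeled_mat"
  have "labeled ?M" by (simp add: labeled_def lmat_def)
  moreover have "independent_at ?M \<pi>" if "\<pi> \<in> C" for \<pi>
    unfolding independent_at_def
  proof (intro ballI impI allI)
    fix c :: "'k vec" and k assume k: "k < rowdim ?M \<pi>" "row_labels ?M ! pick (positions {\<pi>..} (row_labels ?M)) k = \<pi>"
    then have "\<pi> \<in> set ?l" using pick_positions(1)[OF k(1)] nth_mem by force
    then show "c $ k = 0" using that C_disjoint input_labels_subset[of 0] unfolding i by blast
  qed
  ultimately have "node 0 ?M" unfolding node_def i by simp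
  then show ?thesis unfolding good_def push_init_def Let_def by simp
qed

text \<open>\<open>spread Z\<close> moves the \<open>j\<close>-th input entry to the
  \<open>j\<close>-th column labeled by \<open>Z\<close>. These columns form an initial segment, so
  the entry stays in column \<open>j\<close>, and columns labeled by \<open>C\<close> receive
  zero.\<close>

lemma start_matrix_entries:
  assumes A: "node i A" and r: "r < length (input_labels (Suc i))" and j: "j < length (row_labels A)"
  shows "entries (start_matrix Z \<eta>s (Suc i) (row_labels A)) $$ (r, j) =
    (if j < length (input_labels i) then entries (\<eta>s ! Suc i) $$ (r, j) else 0)"
proof -
  have i: "Suc i < length \<eta>s" using r input_labels_beyond[of "Suc i"] by (cases "Suc i < length \<eta>s") auto
  note e = \<eta>_labeled(1)[OF i] \<eta>_labeled(3)[OF i] \<eta>_labeled(3)[OF Suc_lessD[OF i]] \<eta>_composes[OF i]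
  have c: "entries (\<eta>s ! Suc i) \<in> carrier_mat (length (input_labels (Suc i))) (length (input_labels i))"
    using lmatD(1)[OF e(1)[unfolded labeled_def]] e unfolding composes_to_zero_def by simp
  have s: "snd (input_rows \<eta>s (Suc i)) = rows (entries (\<eta>s ! Suc i))" using i by (simp add: input_rows_def)
  have "entries (start_matrix Z \<eta>s (Suc i) (row_labels A)) $$ (r, j) =
     spread Z (row_labels A) (row (entries (\<eta>s ! Suc i)) r) $ j"
    using r j c by (simp add: start_matrix_def s mat_of_rows_index)
  also have "\<dots> = (if j < length (input_labels i) then entries (\<eta>s ! Suc i) $$ (r, j) else 0)"
  proof (cases "j < length (input_labels i)")
    case True
    have "{a \<in> positions Z (row_labels A). a < j} = {..<j}"
      using node_row_labels[OF A] True j by (auto simp: positions_def)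
    then have "idx Z (row_labels A) j = j" by (simp add: idx_def)
    then show ?thesis using True j node_row_labels(3)[OF A True] c r by (simp add: spread_index)
  next
    case False
    then show ?thesis using j node_row_labels(4)[OF A, of j] C_disjoint by (simp add: spread_index)
  qed
  finally show ?thesis .
qed

lemma start_matrix_labels[simp]:
  "row_labels (start_matrix Z \<eta>s i cs) = input_labels i" "col_labels (start_matrix Z \<eta>s i cs) = cs"
  by (simp_all add: start_matrix_def)

lemma start_matrix_labeled:
  assumes A: "node i A"
  shows "labeled (start_matrix Z \<eta>s (Suc i) (row_labels A))"
  unfolding labeled_def lmat_def start_matrix_labels
proof (intro conjI allI impI)
  have "length (snd (input_rows \<eta>s (Suc i))) = length (input_labels (Suc i))"
    using \<eta>_labeled(1)[of "Suc i"] lmatD(1) unfolding labeled_def by (auto simp: input_rows_def)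
  then show "entries (start_matrix Z \<eta>s (Suc i) (row_labels A)) \<in> carrier_mat (length (input_labels (Suc i))) (length (row_labels A))"
    using mat_of_rows_carrier(1)[of "length (row_labels A)" "map (spread Z (row_labels A)) (snd (input_rows \<eta>s (Suc i)))"]
    by (simp add: start_matrix_def)
  fix r j assume r: "r < length (input_labels (Suc i))" and j: "j < length (row_labels A)"
    and nz: "entries (start_matrix Z \<eta>s (Suc i) (row_labels A)) $$ (r, j) \<noteq> 0"
  have i: "Suc i < length \<eta>s" using r input_labels_beyond[of "Suc i"] by (cases "Suc i < length \<eta>s") auto
  note e = \<eta>_labeled(1)[OF i] \<eta>_labeled(3)[OF i] \<eta>_labeled(3)[OF Suc_lessD[OF i]] \<eta>_composes[OF i]
  have j': "j < length (input_labels i)" "entries (\<eta>s ! Suc i) $$ (r, j) \<noteq> 0"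
    using nz unfolding start_matrix_entries[OF A r j] by (auto split: if_splits)
  then have "row_labels (\<eta>s ! Suc i) ! r \<le> col_labels (\<eta>s ! Suc i) ! j"
    using lmatD(2)[OF e(1)[unfolded labeled_def]] r e unfolding composes_to_zero_def by simp
  then show "input_labels (Suc i) ! r \<le> row_labels A ! j"
    using e node_row_labels(2)[OF A j'(1)] unfolding composes_to_zero_def by simp
qed

text \<open>In the columns that come from the input the product is one of consecutive input
  matrices. In a column labeled by \<open>C\<close> the rows with labels in \<open>Z\<close> are
  zero by \<open>not_Z_le_C\<close>, and the rows of the start matrix involve no others.\<close>

lemma start_matrix_composes:
  assumes g: "good \<delta>s" and i: "length \<delta>s = Suc i"
  shows "composes_to_zero (start_matrix Z \<eta>s (Suc i) (row_labels (\<delta>s ! i))) (\<delta>s ! i)"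
proof -
  let ?A = "\<delta>s ! i" and ?S = "start_matrix Z \<eta>s (Suc i) (row_labels (\<delta>s ! i))"
  have A: "node i ?A" using goodD(3)[OF g, of i] i by simp
  then have lA: "labeled ?A" unfolding node_def by blast
  note eA = lmatD[OF lA[unfolded labeled_def]]
  note eS = lmatD(1)[OF start_matrix_labeled[OF A, unfolded labeled_def], unfolded start_matrix_labels]
  have "entries ?S * entries ?A = 0\<^sub>m (length (input_labels (Suc i))) (length (col_labels ?A))"
  proof (rule eq_matI)
    fix r j assume "r < dim_row (0\<^sub>m (length (input_labels (Suc i))) (length (col_labels ?A)) :: 'k mat)"
      "j < dim_col (0\<^sub>m (length (input_labels (Suc i))) (length (col_labels ?A)) :: 'k mat)"
    then have r: "r < length (input_labels (Suc i))" and j: "j < length (col_labels ?A)" by auto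
    have si: "Suc i < length \<eta>s" using r input_labels_beyond[of "Suc i"] by (cases "Suc i < length \<eta>s") auto
    \<comment> \<open>The first matrix of the list has no columns, so a column index exists only for
      positive \<open>i\<close>.\<close>
    obtain i' where i': "i = Suc i'"
      using j goodD(1,2)[OF g] by (cases i) (auto simp: hd_conv_nth)
    have B: "node i' (\<delta>s ! i')" and l: "link i' (\<delta>s ! i') ?A"
      using goodD(3)[OF g, of i'] goodD(4)[OF g, of i'] i i' by auto
    have cA: "col_labels ?A = row_labels (\<delta>s ! i')" using l unfolding link_def composes_to_zero_def by blast
    note e0 = \<eta>_labeled[OF Suc_lessD[OF si]] and e1 = \<eta>_labeled[OF si]
    note c1 = \<eta>_composes[OF si] and c0 = \<eta>_composes[of i', folded i', OF Suc_lessD[OF si]]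
    have m1: "entries (\<eta>s ! Suc i) \<in> carrier_mat (length (input_labels (Suc i))) (length (input_labels i))"
      using lmatD(1)[OF e1(1)[unfolded labeled_def]] e1(3) e0(3) c1 unfolding composes_to_zero_def by simp
    have m0: "entries (\<eta>s ! i) \<in> carrier_mat (length (input_labels i)) (length (input_labels i'))"
      using lmatD(1)[OF e0(1)[unfolded labeled_def]] e0(3) \<eta>_labeled(3)[of i'] c0 si i' unfolding composes_to_zero_def by simp
    have nl: "length (input_labels i) \<le> length (row_labels ?A)" by (rule node_row_labels(5)[OF A])
    have "(entries ?S * entries ?A) $$ (r, j) = (\<Sum>k<length (row_labels ?A). entries ?S $$ (r, k) * entries ?A $$ (k, j))"
      by (rule mult_mat_index[OF eS eA(1) r j])
    also have "\<dots> = (\<Sum>k<length (row_labels ?A). if k < length (input_labels i) then entries (\<eta>s ! Suc i) $$ (r, k) * entries ?A $$ (k, j) else 0)"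
      using start_matrix_entries[OF A r] by (intro sum.cong) auto
    also have "\<dots> = (\<Sum>k<length (input_labels i). entries (\<eta>s ! Suc i) $$ (r, k) * entries ?A $$ (k, j))"
      using nl by (intro sum.mono_neutral_cong_right) auto
    also have "\<dots> = 0"
    proof (cases "j < length (input_labels i')")
      case True
      have "(\<Sum>k<length (input_labels i). entries (\<eta>s ! Suc i) $$ (r, k) * entries ?A $$ (k, j)) =
         (\<Sum>k<length (input_labels i). entries (\<eta>s ! Suc i) $$ (r, k) * entries (\<eta>s ! i) $$ (k, j))"
        using l True unfolding link_def i'[symmetric] by (intro sum.cong) auto
      also have "\<dots> = (entries (\<eta>s ! Suc i) * entries (\<eta>s ! i)) $$ (r, j)"
        by (rule mult_mat_index[OF m1 m0 r True, symmetric])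
      also have "\<dots> = 0"
      proof -
        have "length (col_labels (\<eta>s ! i)) = length (input_labels i')"
          using c0 \<eta>_labeled(3)[of i'] si i' unfolding composes_to_zero_def by simp
        then show ?thesis using c1 r True e1(3) unfolding composes_to_zero_def by simp
      qed
      finally show ?thesis .
    next
      case False
      then have "col_labels ?A ! j \<in> C" using node_row_labels(4)[OF B, of j] j cA by simp
      then have "entries ?A $$ (k, j) = 0" if "k < length (input_labels i)" for k
        using not_Z_le_C[OF node_row_labels(3)[OF A that]] eA(2)[of k j] that nl j by auto
      then show ?thesis by simp
    qed
    finally show "(entries ?S * entries ?A) $$ (r, j) = 0\<^sub>m (length (input_labels (Suc i))) (length (col_labels ?A)) $$ (r, j)"
      using r j by simp
  qed (use eS eA in auto)
  then show ?thesis unfolding composes_to_zero_def by simp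
qed

lemma good_step:
  assumes g: "good \<delta>s" and s: "push_step P Z \<eta>s \<delta>s \<delta>s'"
  shows "good \<delta>s' \<and> (\<exists>B. \<delta>s' = \<delta>s @ [B])"
proof -
  obtain i where i: "length \<delta>s = Suc i" using goodD(1)[OF g] by (cases \<delta>s) auto
  have la: "last \<delta>s = \<delta>s ! i" using goodD(1)[OF g] i by (simp add: last_conv_nth)
  let ?A = "\<delta>s ! i" and ?S = "start_matrix Z \<eta>s (Suc i) (row_labels (\<delta>s ! i))"
  obtain \<pi>s B where p: "non_increasing_enum C \<pi>s" and me: "make_exact_along ?A \<pi>s ?S B" and d: "\<delta>s' = \<delta>s @ [B]"
    using s unfolding push_step_def la i C_def by blast
  have A: "node i ?A" using goodD(3)[OF g, of i] i by simp
  then have lA: "labeled ?A" unfolding node_def by blast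
  have ps: "distinct \<pi>s" "set \<pi>s = C" "sorted_wrt (\<lambda>\<sigma> \<tau>. \<not> \<sigma> < \<tau>) \<pi>s"
    using p unfolding non_increasing_enum_def by auto
  have "set (row_labels ?S) \<inter> set \<pi>s = {}"
    using input_labels_subset[of "Suc i"] C_disjoint ps(2) by auto
  note m = make_exact_along_step[OF lA start_matrix_labeled[OF A] start_matrix_composes[OF g i] me ps(1,3) this, unfolded ps(2)]
  have ext: "row_extension C ?S B" using m by blast
  have "node (Suc i) B"
    unfolding node_def using m ext unfolding row_extension_def by auto
  moreover have "link i ?A B"
    unfolding link_def
  proof (intro conjI allI impI)
    fix r j assume r: "r < length (input_labels (Suc i))" and j: "j < length (input_labels i)"
    have j': "j < length (row_labels ?A)" using j node_row_labels(5)[OF A] by simp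
    have "entries B $$ (r, j) = entries ?S $$ (r, j)"
      using ext r j' unfolding row_extension_def by simp
    then show "entries B $$ (r, j) = entries (\<eta>s ! Suc i) $$ (r, j)"
      using j unfolding start_matrix_entries[OF A r j'] by simp
  qed (use m in auto)
  ultimately show ?thesis using good_snoc[OF g, of B] i la d by simp
qed

lemma good_run:
  assumes "(push_step P Z \<eta>s)\<^sup>*\<^sup>* (push_init \<eta>s) \<delta>s" shows "good \<delta>s"
  using assms by (induction rule: rtranclp_induct) (use good_init good_step in blast)+

lemma step_exists:
  assumes g: "good \<delta>s" and c: "push_continue \<eta>s \<delta>s"
  shows "\<exists>\<delta>s'. push_step P Z \<eta>s \<delta>s \<delta>s'"
proof -
  have "node (length \<delta>s - 1) (last \<delta>s)" using goodD(1,3)[OF g] by (simp add: last_conv_nth)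
  then have "labeled (last \<delta>s)" unfolding node_def by blast
  then show ?thesis
    unfolding push_step_def using c make_exact_along_exists non_increasing_enum_exists[OF finite_C[unfolded C_def]] by blast
qed

text \<open>Past the input, a label in degree \<open>d + 1\<close> lies strictly below one in degree \<open>d\<close>, so the
  poset bounds the number of further degrees.\<close>

lemma height_bound:
  assumes g: "good \<delta>s"
  shows "length \<eta>s + k < length \<delta>s \<Longrightarrow> \<pi> \<in> set (row_labels (\<delta>s ! (length \<eta>s + k))) \<Longrightarrow> k \<le> card {\<tau> \<in> C. \<pi> < \<tau>}"
proof (induction k arbitrary: \<pi>)
  case (Suc k)
  let ?i = "length \<eta>s + k"
  let ?A = "\<delta>s ! ?i" and ?B = "\<delta>s ! Suc ?i"
  have A: "node ?i ?A" and B: "node (Suc ?i) ?B" and l: "link ?i ?A ?B"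
    using goodD(3,4)[OF g] Suc.prems(1) by auto
  have lC: "set (row_labels ?A) \<subseteq> C" "set (row_labels ?B) \<subseteq> C"
    using A B input_labels_beyond[of ?i] input_labels_beyond[of "Suc ?i"] unfolding node_def by auto
  obtain r where r: "r < length (row_labels ?B)" "row_labels ?B ! r = \<pi>" using Suc.prems(2) by (auto simp: in_set_conv_nth)
  have p: "\<pi> \<in> C" using r lC by (metis nth_mem subsetD)
  have lA: "labeled ?A" and lB: "labeled ?B" and iA: "independent_at ?A \<pi>" and iB: "independent_at ?B \<pi>"
    and BA: "composes_to_zero ?B ?A"
    using A B l p unfolding node_def link_def by blast+
  \<comment> \<open>Independence of \<open>?B\<close> at \<open>\<pi>\<close> excludes a zero row.
    Independence of \<open>?A\<close> at \<open>\<pi>\<close> will exclude that the nonzero entry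
    stands in a column labeled \<open>\<pi>\<close>.\<close>
  obtain j where j: "j < length (row_labels ?A)" "entries ?B $$ (r, j) \<noteq> 0"
    using independent_row_nonzero[OF lB iB r] BA unfolding composes_to_zero_def by metis
  let ?\<tau> = "row_labels ?A ! j"
  have "\<pi> \<le> ?\<tau>" using lmatD(2)[OF lB[unfolded labeled_def] r(1), of j] j r BA unfolding composes_to_zero_def by simp
  moreover have "?\<tau> \<noteq> \<pi>" using diagonal_entry_zero[OF lA lB BA iA r j(1)] j(2) by blast
  ultimately have lt: "\<pi> < ?\<tau>" by simp
  have t: "?\<tau> \<in> set (row_labels ?A)" "?\<tau> \<in> C" using j lC by auto
  have "k \<le> card {\<tau> \<in> C. ?\<tau> < \<tau>}" using Suc.IH[OF _ t(1)] Suc.prems(1) by simp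
  also have "\<dots> < card {\<tau> \<in> C. \<pi> < \<tau>}"
    using lt t(2) finite_C by (intro psubset_card_mono) (auto intro: less_trans)
  finally show ?case by simp
qed simp

lemma terminates: "push_terminates P Z \<eta>s"
  unfolding push_terminates_def
proof (intro conjI allI impI notI)
  show "\<exists>\<delta>s'. push_step P Z \<eta>s \<delta>s \<delta>s'"
    if "(push_step P Z \<eta>s)\<^sup>*\<^sup>* (push_init \<eta>s) \<delta>s" "push_continue \<eta>s \<delta>s" for \<delta>s
    using step_exists[OF good_run] that by blast
  assume "\<exists>run. run 0 = push_init \<eta>s \<and> (\<forall>t::nat. push_step P Z \<eta>s (run t) (run (Suc t)))"
  then obtain run where run: "run 0 = push_init \<eta>s" "\<And>t. push_step P Z \<eta>s (run t) (run (Suc t))" by blast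
  have R: "good (run t) \<and> length (run t) = Suc t" for t
  proof (induction t)
    case 0
    then show ?case using good_init by (simp add: run(1) push_init_def Let_def)
  next
    case (Suc t)
    then show ?case using good_step[OF _ run(2)] by force
  qed
  \<comment> \<open>By \<open>height_bound\<close> a label in this degree has at least
    \<open>card C\<close> elements of \<open>C\<close> strictly above it, although it belongs to
    \<open>C\<close> itself. As the input is exhausted by then, a run that continues must have such
    a label.\<close>
  let ?t = "length \<eta>s + card C"
  have g: "good (run ?t)" "length (run ?t) = Suc ?t" using R by auto
  have "push_continue \<eta>s (run ?t)" using run(2) unfolding push_step_def by blast
  then have "row_labels (run ?t ! ?t) \<noteq> []" using g goodD(1)[OF g(1)] by (simp add: push_continue_def last_conv_nth)
  then obtain \<pi> where p: "\<pi> \<in> set (row_labels (run ?t ! ?t))" by (meson ex_in_conv set_empty)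
  have "node ?t (run ?t ! ?t)" using goodD(3)[OF g(1)] g(2) by simp
  then have "\<pi> \<in> C" using p input_labels_beyond[of ?t] unfolding node_def by auto
  then have "card {\<tau> \<in> C. \<pi> < \<tau>} < card C" using finite_C by (intro psubset_card_mono) auto
  then show False using height_bound[OF g(1) _ p] g(2) by simp
qed

text \<open>Truncation removes only degrees without summands. The last claim records that the input
  is zero there as well, so that input and output can be compared in every degree.\<close>

lemma output_good:
  assumes "push_output P Z \<eta>s out"
  shows "good out" "row_labels (last out) = []" "length out \<le> i \<Longrightarrow> input_labels i = []"
proof -
  obtain \<delta>s where r: "(push_step P Z \<eta>s)\<^sup>*\<^sup>* (push_init \<eta>s) \<delta>s" and nc: "\<not> push_continue \<eta>s \<delta>s"
    and o: "out = push_result \<delta>s" using assms unfolding push_output_def by blast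
  have g: "good \<delta>s" by (rule good_run[OF r])
  have ne: "\<delta>s \<noteq> []" by (rule goodD(1)[OF g])
  have l: "row_labels (last \<delta>s) = []" "length \<eta>s \<le> length \<delta>s" using nc unfolding push_continue_def by auto
  let ?S = "{m. m < length \<delta>s \<and> row_labels (\<delta>s ! m) \<noteq> []}"
  have "\<exists>k. 0 < k \<and> k \<le> length \<delta>s \<and> out = take k \<delta>s \<and> (\<forall>i. k \<le> Suc i \<longrightarrow> i < length \<delta>s \<longrightarrow> row_labels (\<delta>s ! i) = [])"
  proof (cases "?S = {}")
    case True
    then show ?thesis using ne o by (intro exI[of _ 1]) (auto simp: push_result_def Suc_le_eq)
  next
    case False
    have f: "finite ?S" by simp
    let ?m = "Max ?S"
    have m: "?m \<in> ?S" using Max_in[OF f False] .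
    \<comment> \<open>A halted run ends in a matrix without rows, so the last nonempty degree is not
      the last index. Keeping \<open>?m + 2\<close> matrices retains one matrix without rows, the
      differential that leaves degree \<open>?m\<close>.\<close>
    have "?m \<noteq> length \<delta>s - 1" using m l(1) ne by (auto simp: last_conv_nth)
    then have "?m + 2 \<le> length \<delta>s" using m by auto
    moreover have "row_labels (\<delta>s ! i) = []" if "?m + 2 \<le> Suc i" "i < length \<delta>s" for i
    proof (rule ccontr)
      assume "row_labels (\<delta>s ! i) \<noteq> []"
      then have "i \<in> ?S" using that(2) by simp
      then show False using Max_ge[OF f, of i] that(1) by linarith
    qed
    ultimately show ?thesis using False o by (intro exI[of _ "?m + 2"]) (auto simp: push_result_def Let_def)
  qed
  then obtain k where k: "0 < k" "k \<le> length \<delta>s" "out = take k \<delta>s"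
    "\<And>i. k \<le> Suc i \<Longrightarrow> i < length \<delta>s \<Longrightarrow> row_labels (\<delta>s ! i) = []" by blast
  show "good out" unfolding k(3) by (rule good_take[OF g k(1)])
  have lk: "length out = k" using k by simp
  have "last out = \<delta>s ! (k - 1)" using k ne by (simp add: last_conv_nth)
  then show "row_labels (last out) = []" using k(4)[of "k - 1"] k(1,2) by simp
  show "input_labels i = []" if "length out \<le> i"
  proof (cases "i < length \<delta>s")
    case True
    then have "row_labels (\<delta>s ! i) = []" using k(4)[of i] that lk by simp
    then show ?thesis using goodD(3)[OF g True] unfolding node_def by auto
  next
    case False
    then show ?thesis using l(2) by (intro input_labels_beyond) simp
  qed
qed

end

section \<open>The output is a minimal resolution\<close>

text \<open>Lists are padded by empty label lists to all integer degrees, because the criterion for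
  minimality knows no end conditions. \<open>list_mats\<close> shifts the index by one: its value at
  \<open>d\<close> leaves degree \<open>d\<close>.\<close>

definition list_labels :: "('p::order, 'k::field) labeled_mat list \<Rightarrow> int \<Rightarrow> 'p list" where
  "list_labels Ms d = (if 0 \<le> d \<and> d < int (length Ms) then row_labels (Ms ! nat d) else [])"

definition list_mats :: "('p::order, 'k::field) labeled_mat list \<Rightarrow> int \<Rightarrow> 'k mat" where
  "list_mats Ms d = (if 0 \<le> d \<and> d + 1 < int (length Ms) then entries (Ms ! nat (d + 1))
     else 0\<^sub>m (length (list_labels Ms (d + 1))) (length (list_labels Ms d)))"

lemma complex_of_eq_label_complex:
  fixes Ms :: "('p::order, 'k::field) labeled_mat list"
  assumes "labeled_complex X Ms"
  shows "complex_of Ms = label_complex (list_labels Ms) (list_mats Ms)"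
proof -
  have "at_star (Ms ! nat (d + 1)) \<tau> = block {\<tau>..} (list_labels Ms (d + 1)) (list_labels Ms d) (list_mats Ms d)"
    if "0 \<le> d" "d + 1 < int (length Ms)" for d \<tau>
  proof -
    have "nat (d + 1) = Suc (nat d)" "Suc (nat d) < length Ms" using that by auto
    then have "col_labels (Ms ! nat (d + 1)) = row_labels (Ms ! nat d)" using assms unfolding labeled_complex_def by metis
    then show ?thesis using that by (simp add: at_star_eq_block list_labels_def list_mats_def)
  qed
  moreover have "0\<^sub>m (sdim (labeled_sum (list_labels Ms (d + 1)) :: ('p, 'k) sheaf) \<tau>) (sdim (labeled_sum (list_labels Ms d) :: ('p, 'k) sheaf) \<tau>) =
     block {\<tau>..} (list_labels Ms (d + 1)) (list_labels Ms d) (list_mats Ms d)"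
    if "\<not> (0 \<le> d \<and> d + 1 < int (length Ms))" for d \<tau>
  proof -
    have "list_mats Ms d = 0\<^sub>m (length (list_labels Ms (d + 1))) (length (list_labels Ms d))"
      using that unfolding list_mats_def by argo
    then show ?thesis by simp
  qed
  ultimately show ?thesis
    unfolding complex_of_def label_complex_def Let_def list_labels_def[symmetric] by (auto simp: fun_eq_iff)
qed

lemma matrix_complex_list:
  assumes C: "labeled_complex X Ms"
  shows "matrix_complex X (list_labels Ms) (list_mats Ms)"
proof -
  let ?L = "list_labels Ms" and ?M = "list_mats Ms"
  have lm: "labeled_matrix X (Ms ! i)" if "i < length Ms" for i using C that unfolding labeled_complex_def by auto
  have cr: "col_labels (Ms ! Suc i) = row_labels (Ms ! i)" "entries (Ms ! Suc i) * entries (Ms ! i) =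
          0\<^sub>m (length (row_labels (Ms ! Suc i))) (length (col_labels (Ms ! i)))" if "Suc i < length Ms" for i
    using C that unfolding labeled_complex_def by auto
  have L: "lmat (?L (d + 1)) (?L d) (?M d)" for d
  proof (cases "0 \<le> d \<and> d + 1 < int (length Ms)")
    case True
    then have i: "Suc (nat d) < length Ms" "nat (d + 1) = Suc (nat d)" by auto
    show ?thesis using lm[OF i(1)] cr(1)[OF i(1)] True i(2)
      by (simp add: list_labels_def list_mats_def lmat_def labeled_matrix_def)
  next
    case False
    then have "?M d = 0\<^sub>m (length (?L (d + 1))) (length (?L d))" unfolding list_mats_def by argo
    then show ?thesis by (simp add: lmat_zero)
  qed
  have L1: "lmat (?L (d + 2)) (?L (d + 1)) (?M (d + 1))" for d using L[of "d + 1"] by (simp add: add.assoc)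
  show ?thesis
    unfolding matrix_complex_def
  proof (intro conjI allI L)
    fix d
    show "set (?L d) \<subseteq> X"
    proof (cases "0 \<le> d \<and> d < int (length Ms)")
      case True
      then have "nat d < length Ms" by auto
      then show ?thesis using lm[of "nat d"] True unfolding list_labels_def labeled_matrix_def by simp
    qed (auto simp: list_labels_def)
    note c0 = lmatD(1)[OF L[of d]] and c1 = lmatD(1)[OF L1[of d]]
    show "?M (d + 1) * ?M d = 0\<^sub>m (length (?L (d + 2))) (length (?L d))"
    proof (cases "0 \<le> d \<and> d + 2 < int (length Ms)")
      case True
      then have i: "Suc (Suc (nat d)) < length Ms" "nat (d + 1) = Suc (nat d)" "nat (d + 2) = Suc (Suc (nat d))" by auto
      have "?M (d + 1) = entries (Ms ! Suc (Suc (nat d)))" "?M d = entries (Ms ! Suc (nat d))"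
        using True i by (auto simp: list_mats_def add.assoc)
      moreover have "?L (d + 2) = row_labels (Ms ! Suc (Suc (nat d)))" "?L d = col_labels (Ms ! Suc (nat d))"
        using True i cr(1)[OF Suc_lessD[OF i(1)]] by (auto simp: list_labels_def)
      ultimately show ?thesis using cr(2)[OF i(1)] by simp
    next
      case False
      \<comment> \<open>Where a factor is not taken from the list, one of the outer degrees is
        empty, and a product without rows or columns is zero.\<close>
      then have "?L d = [] \<or> ?L (d + 2) = []" by (auto simp: list_labels_def)
      then show ?thesis using mult_carrier_mat[OF c1 c0] by (elim disjE) (auto intro!: eq_matI)
    qed
  next
    show "\<exists>a b. \<forall>d. d < a \<or> b < d \<longrightarrow> ?L d = []"
      by (intro exI[of _ 0] exI[of _ "int (length Ms)"]) (auto simp: list_labels_def)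
  qed
qed

lemma sub_append:
  assumes "set xs \<subseteq> Z" "set ys \<inter> Z = {}"
  shows "sub Z (xs @ ys) = xs"
proof -
  have "sub Z (xs @ ys) = filter (\<lambda>x. x \<in> Z) (xs @ ys)" by (simp add: positions_def filter_eq_nths)
  moreover have "filter (\<lambda>x. x \<in> Z) xs = xs" using assms(1) by (intro filter_True) blast
  moreover have "filter (\<lambda>x. x \<in> Z) ys = []" using assms(2) by (auto simp: filter_empty_conv)
  ultimately show ?thesis by simp
qed

lemma pick_append_prefix:
  assumes "set xs \<subseteq> Z" "k < length xs"
  shows "pick (positions Z (xs @ ys)) k = k"
proof (rule pick_eqI)
  have x: "xs ! a \<in> Z" if "a < length xs" for a using assms(1) that by auto
  show "k \<in> positions Z (xs @ ys)" using assms(2) x by (simp add: positions_def nth_append)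
  have "{a \<in> positions Z (xs @ ys). a < k} = {..<k}"
    using x assms(2) by (auto simp: positions_def nth_append)
  then show "card {a \<in> positions Z (xs @ ys). a < k} = k" by simp
qed

lemma mat_no_rows: "A \<in> carrier_mat 0 n \<Longrightarrow> B \<in> carrier_mat 0 n \<Longrightarrow> A = B"
  by (intro eq_matI) auto

section \<open>Extension by zero\<close>

lemma sdim_extend_sheaf[simp]: "sdim (extend_sheaf Z F) \<sigma> = (if \<sigma> \<in> Z then sdim F \<sigma> else 0)"
  by (simp add: extend_sheaf_def Let_def)

lemma res_extend_sheaf: "res (extend_sheaf Z F) \<sigma> \<tau> =
   (if \<sigma> \<in> Z \<and> \<tau> \<in> Z then res F \<sigma> \<tau> else 0\<^sub>m (sdim (extend_sheaf Z F) \<tau>) (sdim (extend_sheaf Z F) \<sigma>))"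
  by (simp add: extend_sheaf_def Let_def)

lemma obj_extend_complex[simp]: "obj (extend_complex Z I) d = extend_sheaf Z (obj I d)"
  by (simp add: extend_complex_def)

lemma diff_extend_complex: "diff (extend_complex Z I) d \<sigma> = (if \<sigma> \<in> Z then diff I d \<sigma> else 0\<^sub>m 0 0)"
  by (simp add: extend_complex_def)

text \<open>The issue is functoriality for \<open>\<sigma> \<le> \<tau> \<le> \<upsilon>\<close>. If
  an end lies outside \<open>Z\<close>, the matrices have no rows or no columns. If both ends lie in
  \<open>Z\<close>, so does \<open>\<tau>\<close>, by local closedness; otherwise a composite
  through zero could differ from the restriction.\<close>

lemma sheaf_on_extend_sheaf:
  assumes lc: "locally_closed P Z" and F: "sheaf_on Z F"
  shows "sheaf_on P (extend_sheaf Z F)"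
proof -
  have r: "res (extend_sheaf Z F) \<sigma> \<tau> \<in> carrier_mat (sdim (extend_sheaf Z F) \<tau>) (sdim (extend_sheaf Z F) \<sigma>)"
    if "\<sigma> \<le> \<tau>" for \<sigma> \<tau>
    using sheaf_onD(1)[OF F _ _ that] by (auto simp: res_extend_sheaf)
  show ?thesis
    unfolding sheaf_on_def
  proof (intro conjI ballI impI r)
    show "res (extend_sheaf Z F) \<sigma> \<sigma> = 1\<^sub>m (sdim (extend_sheaf Z F) \<sigma>)" for \<sigma>
      using sheaf_onD(2)[OF F] by (auto simp: res_extend_sheaf intro!: eq_matI)
    fix \<sigma> \<tau> \<upsilon> assume s: "\<sigma> \<in> P" "\<tau> \<in> P" "\<upsilon> \<in> P" "\<sigma> \<le> \<tau>" "\<tau> \<le> \<upsilon>"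
    then have su: "\<sigma> \<le> \<upsilon>" by auto
    note m = mult_carrier_mat[OF r[OF s(5)] r[OF s(4)]]
    consider "\<sigma> \<notin> Z" | "\<upsilon> \<notin> Z" | "\<sigma> \<in> Z" "\<upsilon> \<in> Z" by blast
    then show "res (extend_sheaf Z F) \<sigma> \<upsilon> = res (extend_sheaf Z F) \<tau> \<upsilon> * res (extend_sheaf Z F) \<sigma> \<tau>"
    proof cases
      case 1
      then show ?thesis using m r[OF su] by (intro mat_no_cols) auto
    next
      case 2
      then show ?thesis using m r[OF su] by (intro mat_no_rows) auto
    next
      case 3
      then have "\<tau> \<in> Z" using lc s unfolding locally_closed_def by blast
      then show ?thesis using 3 sheaf_onD(3)[OF F _ _ _ s(4,5)] by (simp add: res_extend_sheaf)
    qed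
  qed
qed

lemma bounded_extend_complex:
  assumes lc: "locally_closed P Z" and I: "bounded_complex Z I"
  shows "bounded_complex P (extend_complex Z I)"
proof -
  note sh = sheaf_on_extend_sheaf[OF lc bounded_complexD(1)[OF I]]
  have c: "diff (extend_complex Z I) d \<sigma> \<in> carrier_mat (sdim (obj (extend_complex Z I) (d + 1)) \<sigma>) (sdim (obj (extend_complex Z I) d) \<sigma>)" for d \<sigma>
    using diff_carrier(1)[OF I, of \<sigma> d] by (auto simp: diff_extend_complex)
  show ?thesis
    unfolding bounded_complex_def
  proof (intro conjI allI ballI)
    show "sheaf_on P (obj (extend_complex Z I) d)" for d using sh by simp
    show "sheaf_hom P (obj (extend_complex Z I) d) (obj (extend_complex Z I) (d + 1)) (diff (extend_complex Z I) d)" for d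
      unfolding sheaf_hom_def
    proof (intro conjI ballI impI c)
      fix \<sigma> \<tau> assume st: "\<sigma> \<in> P" "\<tau> \<in> P" "\<sigma> \<le> \<tau>"
      note r = sheaf_onD(1)[OF sh st]
      note m = mult_carrier_mat[OF c[of d \<tau>, unfolded obj_extend_complex] r[of d]]
        mult_carrier_mat[OF r[of "d + 1"] c[of d \<sigma>, unfolded obj_extend_complex]]
      consider "\<sigma> \<notin> Z" | "\<tau> \<notin> Z" | "\<sigma> \<in> Z" "\<tau> \<in> Z" by blast
      then show "diff (extend_complex Z I) d \<tau> * res (obj (extend_complex Z I) d) \<sigma> \<tau> =
         res (obj (extend_complex Z I) (d + 1)) \<sigma> \<tau> * diff (extend_complex Z I) d \<sigma>"
      proof cases
        case 1
        then show ?thesis using m by (intro mat_no_cols) auto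
      next
        case 2
        then show ?thesis using m by (intro mat_no_rows) auto
      next
        case 3
        then show ?thesis using sheaf_homD(2)[OF bounded_complexD(2)[OF I] 3 st(3)]
          by (simp add: res_extend_sheaf diff_extend_complex)
      qed
    qed
    fix d \<pi>
    show "diff (extend_complex Z I) (d + 1) \<pi> * diff (extend_complex Z I) d \<pi> =
       0\<^sub>m (sdim (obj (extend_complex Z I) (d + 2)) \<pi>) (sdim (obj (extend_complex Z I) d) \<pi>)"
      using bounded_complexD(3)[OF I, of \<pi> d] by (auto simp: diff_extend_complex intro!: eq_matI)
  next
    obtain a b where "\<forall>d. d < a \<or> b < d \<longrightarrow> (\<forall>\<pi>\<in>Z. sdim (obj I d) \<pi> = 0)" using bounded_complexD(4)[OF I] by blast
    then show "\<exists>a b. \<forall>d. d < a \<or> b < d \<longrightarrow> (\<forall>\<pi>\<in>P. sdim (obj (extend_complex Z I) d) \<pi> = 0)"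
      by (intro exI[of _ a] exI[of _ b]) auto
  qed
qed

lemma zero_is_boundary:
  assumes "bounded_complex X C" "\<pi> \<in> X"
  shows "is_boundary C d \<pi> (0\<^sub>v (sdim (obj C d) \<pi>))"
  unfolding is_boundary_def using mult_mat_zero_vec[OF diff_carrier(2)[OF assms, of d]]
  by (intro bexI[of _ "0\<^sub>v (sdim (obj C (d - 1)) \<pi>)"]) auto

section \<open>Comparing the output with the extended input\<close>

context pushforward
begin

text \<open>Over \<open>Z\<close> the summands labeled by \<open>C\<close> are invisible, and
  \<open>f\<close> itself serves. Over \<open>C\<close> the extension is zero and the target is
  exact by \<open>ex\<close>. Elsewhere both complexes are zero.\<close>

lemma extension_quasi_iso:
  fixes I :: "('p, 'k) sheaf_complex" and Ms Ns :: "int \<Rightarrow> 'k mat"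
  assumes I: "bounded_complex Z I" and f: "quasi_iso Z I (label_complex Ks Ns) f"
    and N: "matrix_complex Z Ks Ns" and M: "matrix_complex P Ls Ms"
    and lab: "\<And>d. \<exists>rest. Ls d = Ks d @ rest \<and> set rest \<subseteq> C"
    and ent: "\<And>d r j. r < length (Ks (d + 1)) \<Longrightarrow> j < length (Ks d) \<Longrightarrow> Ms d $$ (r, j) = Ns d $$ (r, j)"
    and ex: "\<And>\<pi> d w. \<pi> \<in> C \<Longrightarrow> is_cycle (label_complex Ls Ms) d \<pi> w \<Longrightarrow> is_boundary (label_complex Ls Ms) d \<pi> w"
  shows "\<exists>F. quasi_iso P (extend_complex Z I) (label_complex Ls Ms) F"
proof -
  let ?E = "extend_complex Z I" and ?J = "label_complex Ls Ms" and ?K = "label_complex Ks Ns"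
  note Eb = bounded_extend_complex[OF Z I]
  note Jb = labeled_complex_onD(1)[OF labeled_complex_on_label_complex[OF M]]
  note Kb = labeled_complex_onD(1)[OF labeled_complex_on_label_complex[OF N]]
  have fc: "chain_map Z I ?K f" and fb: "bijective_on_cohomology Z I ?K f" using f quasi_iso_iff[OF I Kb] by auto
  have pos: "positions {\<sigma>..} (Ls d) = positions {\<sigma>..} (Ks d)" if s: "\<sigma> \<in> Z" for \<sigma> d
  proof -
    obtain rest where r: "Ls d = Ks d @ rest" "set rest \<subseteq> C" using lab by blast
    then have "set rest \<inter> {\<sigma>..} = {}" using not_Z_le_C[OF s] by auto
    then show ?thesis unfolding r(1) by (rule positions_append_disjoint)
  qed
  have labels: "set (Ls d) \<subseteq> Z \<union> C" for d
    using lab[of d] matrix_complexD(1)[OF N, of d] by auto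
  \<comment> \<open>All labels lie in the closure of \<open>Z\<close>, which is closed downwards in
    \<open>P\<close>. A point below a label is therefore in \<open>Z\<close> or in
    \<open>C\<close>.\<close>
  have empty: "positions {\<tau>..} (Ls d) = {}" if t: "\<tau> \<in> P" "\<tau> \<notin> Z" "\<tau> \<notin> C" for \<tau> d
  proof (rule ccontr)
    assume "positions {\<tau>..} (Ls d) \<noteq> {}"
    then obtain i where "i \<in> positions {\<tau>..} (Ls d)" by blast
    then have "i < length (Ls d)" "\<tau> \<le> Ls d ! i" by (auto simp: positions_def)
    then obtain l where l: "l \<in> set (Ls d)" "\<tau> \<le> l" using nth_mem by metis
    then have "l \<in> closure_in P Z" using labels[of d] Z_subset by (auto simp: C_def closure_in_def)
    then have "\<tau> \<in> closure_in P Z" using l(2) t(1) by (auto simp: closure_in_def intro: order_trans)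
    then show False using t by (simp add: C_def)
  qed
  have above_C: "\<tau> \<notin> C" if "\<sigma> \<in> Z" "\<sigma> \<le> \<tau>" for \<sigma> \<tau> using not_Z_le_C that by blast
  have diffJ: "diff ?J d \<sigma> = diff ?K d \<sigma>" if s: "\<sigma> \<in> Z" for d \<sigma>
  proof -
    have cK: "Ns d \<in> carrier_mat (length (Ks (d + 1))) (length (Ks d))" using lmatD(1)[OF matrix_complexD(2)[OF N]] .
    have cM: "Ms d \<in> carrier_mat (length (Ls (d + 1))) (length (Ls d))" using lmatD(1)[OF matrix_complexD(2)[OF M]] .
    show ?thesis
      unfolding diff_label_complex
    proof (rule block_eqI[OF cM])
      show "block {\<sigma>..} (Ks (d + 1)) (Ks d) (Ns d) \<in> carrier_mat (card (positions {\<sigma>..} (Ls (d + 1)))) (card (positions {\<sigma>..} (Ls d)))"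
        unfolding pos[OF s] by (rule dim_block(1)[OF cK])
      fix i j assume "i < card (positions {\<sigma>..} (Ls (d + 1)))" "j < card (positions {\<sigma>..} (Ls d))"
      then show "block {\<sigma>..} (Ks (d + 1)) (Ks d) (Ns d) $$ (i, j) =
        Ms d $$ (pick (positions {\<sigma>..} (Ls (d + 1))) i, pick (positions {\<sigma>..} (Ls d)) j)"
        unfolding pos[OF s] by (simp add: block_index[OF cK] ent pick_positions(1))
    qed
  qed
  have sd: "sdim (obj ?J d) \<sigma> = sdim (obj ?K d) \<sigma>" if "\<sigma> \<in> Z" for d \<sigma>
    using pos[OF that] by simp
  have resJ: "res (obj ?J d) \<sigma> \<tau> = res (obj ?K d) \<sigma> \<tau>" if s: "\<sigma> \<in> Z" and t: "\<tau> \<in> Z" and st: "\<sigma> \<le> \<tau>" for d \<sigma> \<tau>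
    using dim_res_labeled_sum[OF st, of "Ls d", where 'k='k] dim_res_labeled_sum[OF st, of "Ks d", where 'k='k]
    by (intro eq_matI) (auto simp: pos[OF s] pos[OF t] res_labeled_sum_index[OF st])
  define F where "F d \<sigma> = (if \<sigma> \<in> Z then f d \<sigma> else 0\<^sub>m (sdim (obj ?J d) \<sigma>) 0)" for d \<sigma>
  have cF: "F d \<sigma> \<in> carrier_mat (sdim (obj ?J d) \<sigma>) (sdim (obj ?E d) \<sigma>)" for d \<sigma>
    using chain_mapD(2)[OF fc, of \<sigma> d] sd[of \<sigma> d] by (auto simp: F_def)
  have Fc: "chain_map P ?E ?J F"
    unfolding chain_map_def sheaf_hom_def
  proof (intro conjI allI ballI impI cF)
    fix d \<sigma> \<tau> assume st: "\<sigma> \<in> P" "\<tau> \<in> P" "\<sigma> \<le> \<tau>"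
    note m = mult_carrier_mat[OF cF[of d \<tau>] sheaf_onD(1)[OF bounded_complexD(1)[OF Eb] st]]
      mult_carrier_mat[OF sheaf_onD(1)[OF bounded_complexD(1)[OF Jb] st] cF[of d \<sigma>]]
    consider "\<sigma> \<notin> Z" | "\<sigma> \<in> Z" "\<tau> \<notin> Z" | "\<sigma> \<in> Z" "\<tau> \<in> Z" by blast
    then show "F d \<tau> * res (obj ?E d) \<sigma> \<tau> = res (obj ?J d) \<sigma> \<tau> * F d \<sigma>"
    proof cases
      case 1
      then show ?thesis using m by (intro mat_no_cols) auto
    next
      case 2
      \<comment> \<open>The case in which extending \<open>f\<close> by zero might fail to be
        natural. A point above a point of \<open>Z\<close> is not in \<open>C\<close>, so outside
        \<open>Z\<close> the target vanishes there.\<close>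
      then have "sdim (obj ?J d) \<tau> = 0" using empty[OF st(2)] above_C[OF _ st(3)] by simp
      then show ?thesis using m by (intro mat_no_rows) auto
    next
      case 3
      then show ?thesis using sheaf_homD(2)[OF chain_mapD(1)[OF fc] 3 st(3)] resJ[OF 3 st(3)]
        by (simp add: F_def res_extend_sheaf)
    qed
  next
    fix d \<pi>
    assume p: "\<pi> \<in> P"
    show "F (d + 1) \<pi> * diff ?E d \<pi> = diff ?J d \<pi> * F d \<pi>"
    proof (cases "\<pi> \<in> Z")
      case True
      then show ?thesis using chain_mapD(3)[OF fc True] diffJ[OF True] by (simp add: F_def diff_extend_complex)
    next
      case False
      then show ?thesis
        using mult_carrier_mat[OF cF diff_carrier(1)[OF Eb p], of d] mult_carrier_mat[OF diff_carrier(1)[OF Jb p] cF, of d]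
        by (intro mat_no_cols) auto
    qed
  qed
  have cyc: "is_cycle ?E d \<pi> v \<longleftrightarrow> is_cycle I d \<pi> v" "is_cycle ?J d \<pi> w \<longleftrightarrow> is_cycle ?K d \<pi> w"
    "is_boundary ?E d \<pi> v \<longleftrightarrow> is_boundary I d \<pi> v" "is_boundary ?J d \<pi> w \<longleftrightarrow> is_boundary ?K d \<pi> w"
    if p: "\<pi> \<in> Z" for d \<pi> v w
    unfolding is_cycle_def is_boundary_def diffJ[OF p] sd[OF p] using p by (simp_all add: diff_extend_complex)
  have "bijective_on_cohomology P ?E ?J F"
    unfolding bijective_on_cohomology_def
  proof (intro allI ballI)
    fix d \<pi> assume p: "\<pi> \<in> P"
    show "(\<forall>v. is_cycle ?E d \<pi> v \<longrightarrow> is_boundary ?J d \<pi> (F d \<pi> *\<^sub>v v) \<longrightarrow> is_boundary ?E d \<pi> v) \<and>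
     (\<forall>w. is_cycle ?J d \<pi> w \<longrightarrow> (\<exists>v u. is_cycle ?E d \<pi> v \<and> is_boundary ?J d \<pi> u \<and> w = F d \<pi> *\<^sub>v v + u))"
    proof (cases "\<pi> \<in> Z")
      case True
      have "F d \<pi> = f d \<pi>" using True by (simp add: F_def)
      then show ?thesis
        using fb True unfolding cyc[OF True] bijective_on_cohomology_def by simp
    next
      case False
      then have z: "sdim (obj ?E d) \<pi> = 0" for d by simp
      have bJ: "is_boundary ?J d \<pi> w" if w: "is_cycle ?J d \<pi> w" for w
      proof (cases "\<pi> \<in> C")
        case True
        then show ?thesis using ex w by blast
      next
        case F: False
        then have "w = 0\<^sub>v (sdim (obj ?J d) \<pi>)"
          using w empty[OF p False F] unfolding is_cycle_def by (auto intro!: eq_vecI)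
        then show ?thesis using zero_is_boundary[OF Jb p] by metis
      qed
      have zc: "is_cycle ?E d \<pi> (0\<^sub>v (sdim (obj ?E d) \<pi>))"
        by (rule boundary_cycle[OF Eb p zero_is_boundary[OF Eb p]])
      show ?thesis
      proof (intro conjI allI impI)
        fix v assume "is_cycle ?E d \<pi> v"
        then have "v = 0\<^sub>v (sdim (obj ?E d) \<pi>)" using z[of d] unfolding is_cycle_def by (auto intro!: eq_vecI)
        then show "is_boundary ?E d \<pi> v" using zero_is_boundary[OF Eb p] by metis
      next
        fix w assume w: "is_cycle ?J d \<pi> w"
        have "w = F d \<pi> *\<^sub>v 0\<^sub>v (sdim (obj ?E d) \<pi>) + w"
          using w unfolding mult_mat_zero_vec[OF cF] is_cycle_def by simp
        then show "\<exists>v u. is_cycle ?E d \<pi> v \<and> is_boundary ?J d \<pi> u \<and> w = F d \<pi> *\<^sub>v v + u"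
          using zc bJ[OF w] by blast
      qed
    qed
  qed
  then show ?thesis using Fc quasi_iso_iff[OF Eb Jb] by blast
qed

lemma labeled_complex_good:
  assumes g: "good \<delta>s"
  shows "labeled_complex P \<delta>s"
proof -
  have n: "labeled (\<delta>s ! i)" "set (row_labels (\<delta>s ! i)) \<subseteq> P" if "i < length \<delta>s" for i
    using goodD(3)[OF g that] node_row_labels(1)[OF goodD(3)[OF g that]] Z_subset C_subset unfolding node_def by blast+
  have l: "composes_to_zero (\<delta>s ! Suc i) (\<delta>s ! i)" if "Suc i < length \<delta>s" for i
    using goodD(4)[OF g that] unfolding link_def by blast
  have "labeled_matrix P (\<delta>s ! i)" if i: "i < length \<delta>s" for i
  proof -
    have "set (col_labels (\<delta>s ! i)) \<subseteq> P"
    proof (cases i)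
      case 0
      then show ?thesis using goodD(1,2)[OF g] by (simp add: hd_conv_nth)
    next
      case (Suc i')
      then show ?thesis using l[of i'] n(2)[of i'] i unfolding composes_to_zero_def by simp
    qed
    then show ?thesis using n[OF i] unfolding labeled_matrix_def labeled_def lmat_def by blast
  qed
  then have "\<forall>M\<in>set \<delta>s. labeled_matrix P M" by (metis in_set_conv_nth)
  then show ?thesis
    unfolding labeled_complex_def using goodD(1,2)[OF g] l unfolding composes_to_zero_def by blast
qed

lemma list_labels_input: "list_labels \<eta>s d = (if 0 \<le> d then input_labels (nat d) else [])"
proof (cases "0 \<le> d \<and> d < int (length \<eta>s)")
  case True
  then have "nat d < length \<eta>s" by auto
  then show ?thesis using True \<eta>_labeled(3) by (simp add: list_labels_def)
next
  case False
  then show ?thesis using input_labels_beyond[of "nat d"] by (auto simp: list_labels_def)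
qed

lemma list_labels_extend:
  assumes g: "good \<delta>s" and b: "\<And>i. length \<delta>s \<le> i \<Longrightarrow> input_labels i = []"
  shows "\<exists>rest. list_labels \<delta>s d = list_labels \<eta>s d @ rest \<and> set rest \<subseteq> C"
proof (cases "0 \<le> d \<and> d < int (length \<delta>s)")
  case True
  then have "nat d < length \<delta>s" by auto
  then have "node (nat d) (\<delta>s ! nat d)" by (rule goodD(3)[OF g])
  then show ?thesis using True unfolding node_def list_labels_input by (simp add: list_labels_def)
next
  case False
  then have "list_labels \<delta>s d = []" by (auto simp: list_labels_def)
  moreover have "list_labels \<eta>s d = []" using False b[of "nat d"] unfolding list_labels_input by auto
  ultimately show ?thesis by simp
qed

lemma list_mats_extend:
  assumes g: "good \<delta>s" and b: "\<And>i. length \<delta>s \<le> i \<Longrightarrow> input_labels i = []"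
    and r: "r < length (list_labels \<eta>s (d + 1))" and j: "j < length (list_labels \<eta>s d)"
  shows "list_mats \<delta>s d $$ (r, j) = list_mats \<eta>s d $$ (r, j)"
proof -
  have d: "0 \<le> d" using j unfolding list_labels_input by (auto split: if_splits)
  then have n: "nat (d + 1) = Suc (nat d)" by simp
  have r': "r < length (input_labels (Suc (nat d)))" and j': "j < length (input_labels (nat d))"
    using r j d unfolding list_labels_input n by auto
  have 1: "Suc (nat d) < length \<delta>s" using r' b[of "Suc (nat d)"] by (cases "Suc (nat d) < length \<delta>s") auto
  have 2: "Suc (nat d) < length \<eta>s" using r' input_labels_beyond[of "Suc (nat d)"] by (cases "Suc (nat d) < length \<eta>s") auto
  have "list_mats \<delta>s d = entries (\<delta>s ! Suc (nat d))" "list_mats \<eta>s d = entries (\<eta>s ! Suc (nat d))"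
    using d 1 2 n by (auto simp: list_mats_def)
  then show ?thesis using goodD(4)[OF g 1] r' j' unfolding link_def by simp
qed

text \<open>If \<open>b\<close> annihilates the image of the incoming matrix,
  \<open>exact_at\<close> makes it a combination of rows of the outgoing one, so it annihilates the
  cycle \<open>w\<close>. By \<open>image_of_orthogonal\<close>, \<open>w\<close> lies in the
  image.\<close>

lemma exact_on_C:
  assumes g: "good \<delta>s" and last: "row_labels (last \<delta>s) = []" and p: "\<pi> \<in> C"
    and w: "is_cycle (label_complex (list_labels \<delta>s) (list_mats \<delta>s)) d \<pi> w"
  shows "is_boundary (label_complex (list_labels \<delta>s) (list_mats \<delta>s)) d \<pi> w"
proof -
  let ?L = "list_labels \<delta>s" and ?M = "list_mats \<delta>s"
  let ?J = "label_complex ?L ?M"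
  note mc = matrix_complex_list[OF labeled_complex_good[OF g]]
  note Jb = labeled_complex_onD(1)[OF labeled_complex_on_label_complex[OF mc]]
  have pP: "\<pi> \<in> P" using p C_subset by blast
  have wc: "w \<in> carrier_vec (card (positions {\<pi>..} (?L d)))" using w unfolding is_cycle_def by simp
  show ?thesis
  proof (cases "?L d = []")
    case True
    then have "w = 0\<^sub>v (sdim (obj ?J d) \<pi>)" using wc by (auto intro!: eq_vecI)
    then show ?thesis using zero_is_boundary[OF Jb pP] by metis
  next
    case ne: False
    then have d: "0 \<le> d" "d < int (length \<delta>s)" unfolding list_labels_def by (auto split: if_splits)
    define i where "i = nat d"
    have Ld: "?L d = row_labels (\<delta>s ! i)" and i: "i < length \<delta>s" using d by (auto simp: list_labels_def i_def)
    \<comment> \<open>The last matrix has no rows, so a nonempty degree is followed by a further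
      matrix, whose exactness is used.\<close>
    have "i \<noteq> length \<delta>s - 1" using ne last goodD(1)[OF g] unfolding Ld by (auto simp: last_conv_nth)
    then have si: "Suc i < length \<delta>s" using i by simp
    have n1: "nat (d + 1) = Suc i" using d by (simp add: i_def)
    let ?A = "\<delta>s ! i" and ?B = "\<delta>s ! Suc i"
    have lA: "labeled ?A" and lB: "labeled ?B" using goodD(3)[OF g] i si unfolding node_def by blast+
    have cr: "col_labels ?B = row_labels ?A" and ex: "exact_at ?A ?B \<pi>"
      using goodD(4)[OF g si] p unfolding link_def composes_to_zero_def by blast+
    have d1: "d + 1 < int (length \<delta>s)" using si d unfolding i_def by linarith
    then have LMd: "?L (d + 1) = row_labels ?B" "?M d = entries ?B" using d n1 by (auto simp: list_labels_def list_mats_def)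
    have dB: "diff ?J d \<pi> = at_star ?B \<pi>"
      unfolding diff_label_complex at_star_eq_block LMd Ld cr ..
    have cA: "at_star ?A \<pi> \<in> carrier_mat (rowdim ?A \<pi>) (coldim ?A \<pi>)" by (rule at_star_carrier[OF lA])
    have cB: "at_star ?B \<pi> \<in> carrier_mat (rowdim ?B \<pi>) (rowdim ?A \<pi>)" using at_star_carrier[OF lB, of \<pi>] cr by simp
    have Lsd: "card (positions {\<pi>..} (?L (d + 1))) = rowdim ?B \<pi>" unfolding LMd ..
    have wA: "w \<in> carrier_vec (rowdim ?A \<pi>)" using wc unfolding Ld .
    have Bw: "at_star ?B \<pi> *\<^sub>v w = 0\<^sub>v (rowdim ?B \<pi>)" using w Lsd unfolding is_cycle_def dB by simp
    have "\<exists>u\<in>carrier_vec (coldim ?A \<pi>). w = at_star ?A \<pi> *\<^sub>v u"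
    proof (rule image_of_orthogonal[OF cA wA])
      fix b assume "b \<in> carrier_vec (rowdim ?A \<pi>)" "transpose_mat (at_star ?A \<pi>) *\<^sub>v b = 0\<^sub>v (coldim ?A \<pi>)"
      then have "in_row_space (at_star ?B \<pi>) b" using ex unfolding exact_at_def by blast
      then obtain c where c: "c \<in> carrier_vec (rowdim ?B \<pi>)" "b = transpose_mat (at_star ?B \<pi>) *\<^sub>v c"
        using cB unfolding in_row_space_def by auto
      have "b \<bullet> w = c \<bullet> (at_star ?B \<pi> *\<^sub>v w)"
        unfolding c(2) using transpose_vec_mult_scalar[OF cB wA c(1)] by simp
      then show "b \<bullet> w = 0" using c(1) unfolding Bw by simp
    qed
    then obtain u where u: "u \<in> carrier_vec (coldim ?A \<pi>)" "w = at_star ?A \<pi> *\<^sub>v u" by blast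
    show ?thesis
    proof (cases i)
      case 0
      \<comment> \<open>The list starts with a matrix without columns, so in degree zero exactness
        means that all cycles are zero.\<close>
      then have "coldim ?A \<pi> = 0" using goodD(1,2)[OF g] by (simp add: hd_conv_nth)
      then have "u = 0\<^sub>v (coldim ?A \<pi>)" using u(1) by (auto intro!: eq_vecI)
      then have "w = 0\<^sub>v (sdim (obj ?J d) \<pi>)" using u(2) mult_mat_zero_vec[OF cA] Ld by simp
      then show ?thesis using zero_is_boundary[OF Jb pP] by metis
    next
      case (Suc i')
      then have d': "nat (d - 1) = i'" "0 \<le> d - 1" "nat d = Suc i'" using d by (auto simp: i_def)
      have cr': "col_labels ?A = row_labels (\<delta>s ! i')" using goodD(4)[OF g, of i'] i Suc unfolding link_def composes_to_zero_def by simp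
      have LMd': "?L (d - 1) = col_labels ?A" "?M (d - 1) = entries ?A"
        using d d' cr' by (auto simp: list_labels_def list_mats_def i_def)
      have "diff ?J (d - 1) \<pi> = at_star ?A \<pi>"
        unfolding diff_label_complex at_star_eq_block LMd' using Ld by simp
      moreover have "card (positions {\<pi>..} (?L (d - 1))) = coldim ?A \<pi>" unfolding LMd' ..
      ultimately show ?thesis unfolding is_boundary_def using u by (intro bexI[of _ u]) auto
    qed
  qed
qed

text \<open>A label outside \<open>Z\<close> that occurs in the list lies in \<open>C\<close>, where
  all matrices of the list are independent; \<open>diagonal_entry_zero\<close> applies.\<close>

lemma list_mats_diagonal:
  assumes g: "good \<delta>s" and p: "\<pi> \<in> P - Z"
  shows "block {\<pi>} (list_labels \<delta>s (d + 1)) (list_labels \<delta>s d) (list_mats \<delta>s d) =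
    0\<^sub>m (card (positions {\<pi>} (list_labels \<delta>s (d + 1)))) (card (positions {\<pi>} (list_labels \<delta>s d)))"
proof (rule block_eqI)
  show "list_mats \<delta>s d \<in> carrier_mat (length (list_labels \<delta>s (d + 1))) (length (list_labels \<delta>s d))"
    by (rule lmatD(1)[OF matrix_complexD(2)[OF matrix_complex_list[OF labeled_complex_good[OF g]]]])
  fix k l assume kl: "k < card (positions {\<pi>} (list_labels \<delta>s (d + 1)))" "l < card (positions {\<pi>} (list_labels \<delta>s d))"
  note k = pick_positions[OF kl(1)] and l = pick_positions[OF kl(2)]
  have d: "0 \<le> d" "d + 1 < int (length \<delta>s)"
    using k(1) l(1) unfolding list_labels_def by (auto split: if_splits)
  define i where "i = nat d"
  have si: "Suc i < length \<delta>s" and n: "nat (d + 1) = Suc i" using d by (auto simp: i_def)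
  have e: "list_labels \<delta>s (d + 1) = row_labels (\<delta>s ! Suc i)" "list_labels \<delta>s d = row_labels (\<delta>s ! i)"
    "list_mats \<delta>s d = entries (\<delta>s ! Suc i)" using d n by (auto simp: list_labels_def list_mats_def i_def)
  have A: "node i (\<delta>s ! i)" and B: "node (Suc i) (\<delta>s ! Suc i)" and li: "link i (\<delta>s ! i) (\<delta>s ! Suc i)"
    using goodD(3)[OF g, of i] goodD(3)[OF g si] goodD(4)[OF g si] si by auto
  have "\<pi> \<in> set (row_labels (\<delta>s ! i))" using l unfolding e by (metis nth_mem singletonD)
  then have "\<pi> \<in> C" using node_row_labels(1)[OF A] p by blast
  then have "entries (\<delta>s ! Suc i) $$ (pick (positions {\<pi>} (row_labels (\<delta>s ! Suc i))) k, pick (positions {\<pi>} (row_labels (\<delta>s ! i))) l) = 0"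
    using A B li k l unfolding node_def link_def e by (intro diagonal_entry_zero[of "\<delta>s ! i" "\<delta>s ! Suc i" \<pi>]) auto
  then show "0\<^sub>m (card (positions {\<pi>} (list_labels \<delta>s (d + 1)))) (card (positions {\<pi>} (list_labels \<delta>s d))) $$ (k, l) =
    list_mats \<delta>s d $$ (pick (positions {\<pi>} (list_labels \<delta>s (d + 1))) k, pick (positions {\<pi>} (list_labels \<delta>s d)) l)"
    using kl unfolding e by simp
qed simp

text \<open>The resolution is taken to be \<open>complex_of out\<close> itself, so the isomorphism
  required by \<open>represents\<close> is the identity.\<close>

lemma output_resolution:
  assumes I: "minimal_injective_complex Z I" and iso: "complex_isomorphic Z (complex_of \<eta>s) I"
    and out: "push_output P Z \<eta>s out"
  shows "minimal_injective_resolution P (extend_complex Z I) (complex_of out) \<and> represents P out (complex_of out)"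
proof -
  note g = output_good(1)[OF out] and last = output_good(2)[OF out] and b = output_good(3)[OF out]
  note lc = labeled_complex_good[OF g]
  note N = matrix_complex_list[OF \<eta>s] and M = matrix_complex_list[OF lc]
  let ?Ks = "list_labels \<eta>s" and ?Ns = "list_mats \<eta>s" and ?Ls = "list_labels out" and ?Ms = "list_mats out"
  have Ib: "bounded_complex Z I" using I unfolding minimal_injective_complex_def injective_complex_def by blast
  have J: "complex_of out = label_complex ?Ls ?Ms" by (rule complex_of_eq_label_complex[OF lc])
  note min\<eta> = minimal_injective_complex_isomorphic[OF I iso[unfolded complex_of_eq_label_complex[OF \<eta>s]] N]
  have sub: "sub Z (?Ls d) = ?Ks d" for d
  proof -
    obtain rest where r: "?Ls d = ?Ks d @ rest" "set rest \<subseteq> C" using list_labels_extend[OF g b, of d] by blast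
    then have "set rest \<inter> Z = {}" using C_disjoint by blast
    then show ?thesis unfolding r(1) by (rule sub_append[OF matrix_complexD(1)[OF N]])
  qed
  \<comment> \<open>The labels in \<open>Z\<close> are initial segments of rows and columns, so the
    block over \<open>Z\<close> of the output is literally the input, and the minimality of the
    input can be passed to \<open>minimal_label_complex\<close>.\<close>
  have blk: "block Z (?Ls (d + 1)) (?Ls d) (?Ms d) = ?Ns d" for d
  proof (rule block_eqI[OF lmatD(1)[OF matrix_complexD(2)[OF M]]])
    have len: "card (positions Z (?Ls d)) = length (?Ks d)" for d
      unfolding sub[symmetric] by (rule length_nths_positions[symmetric])
    show "?Ns d \<in> carrier_mat (card (positions Z (?Ls (d + 1)))) (card (positions Z (?Ls d)))"
      unfolding len by (rule lmatD(1)[OF matrix_complexD(2)[OF N]])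
    fix i j assume "i < card (positions Z (?Ls (d + 1)))" "j < card (positions Z (?Ls d))"
    then have ij: "i < length (?Ks (d + 1))" "j < length (?Ks d)" unfolding len .
    have "pick (positions Z (?Ls d)) k = k" if "k < length (?Ks d)" for k d
      using list_labels_extend[OF g b, of d] pick_append_prefix[OF matrix_complexD(1)[OF N] that] by auto
    then show "?Ns d $$ (i, j) = ?Ms d $$ (pick (positions Z (?Ls (d + 1))) i, pick (positions Z (?Ls d)) j)"
      using ij list_mats_extend[OF g b ij] by simp
  qed
  have min: "minimal_injective_complex P (label_complex ?Ls ?Ms)"
  proof (rule minimal_label_complex[OF finite_P M locally_closed_convex_in[OF Z] Z_subset list_mats_diagonal[OF g]])
    show "minimal_injective_complex Z (label_complex (\<lambda>d. sub Z (?Ls d)) (\<lambda>d. block Z (?Ls (d + 1)) (?Ls d) (?Ms d)))"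
      unfolding sub blk using min\<eta>(1) .
  qed
  obtain f where f: "quasi_iso Z I (label_complex ?Ks ?Ns) f" using min\<eta>(2) by blast
  note Eb = bounded_extend_complex[OF Z Ib]
  note Jb = labeled_complex_onD(1)[OF labeled_complex_on_label_complex[OF M]]
  have "\<exists>F. quasi_iso P (extend_complex Z I) (label_complex ?Ls ?Ms) F"
    by (rule extension_quasi_iso[OF Ib f N M list_labels_extend[OF g b] list_mats_extend[OF g b] exact_on_C[OF g last]])
  then have "quasi_isomorphic P (extend_complex Z I) (label_complex ?Ls ?Ms)"
    using quasi_isomorphicI[OF Eb Jb] by blast
  then have "minimal_injective_resolution P (extend_complex Z I) (complex_of out)"
    unfolding minimal_injective_resolution_def J using Eb min by blast
  moreover have "complex_isomorphic P (complex_of out) (complex_of out)"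
    unfolding complex_isomorphic_def J using chain_map_identity[OF Jb]
    by (intro exI[of _ "identity_map (label_complex ?Ls ?Ms)"]) simp
  ultimately show ?thesis unfolding represents_def using lc by blast
qed

end

theorem proposition5p21:
  fixes P Z :: "'p::order set"
    and I :: "('p, 'k::field) sheaf_complex"
    and \<eta>s :: "('p, 'k) labeled_mat list"
  assumes "finite P"
    and "locally_closed P Z"
    and "minimal_injective_complex Z I"
    and "represents Z \<eta>s I"
  shows "push_terminates P Z \<eta>s \<and>
    (\<forall>out. push_output P Z \<eta>s out \<longrightarrow>
      (\<exists>J. minimal_injective_resolution P (extend_complex Z I) J \<and> represents P out J))"
proof -
  have r: "labeled_complex Z \<eta>s" "complex_isomorphic Z (complex_of \<eta>s) I" using assms(4) unfolding represents_def by auto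
  interpret pushforward P Z \<eta>s by unfold_locales (use assms(1,2) r(1) in auto)
  show ?thesis using terminates output_resolution[OF assms(3) r(2)] by blast
qed

end
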